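(* Let $H$ be a braided unital algebra and consider $\underline\Delta:H'\to(H\otimes H)'$ defined by $\langle\langle\underline\Delta(f),a\otimes b\rangle\rangle:=f\big(m(\Psi_{HH}(a\otimes b))\big)$ for $f\in H'$, $a,b\in H$. Then there exists a largest coalgebra $H^{\underline\circ}$ in $H'$ such that the coproduct is given by $\underline\Delta$ and the counit by $\varepsilon(f):=f(1)$. Suppose that $U\subset H^{\underline\circ}$ is a subcoalgebra separating the points of $H$. If $\Psi_{UU}$ is bijective, then it turns $U$ into a braided coalgebra. If moreover $\Psi_{UH}$ (resp. $\Psi_{UH}^\circ$) is bijective, then it is a braiding (turning $H$ into a left $U$-braided and $U$ into a right $H$-braided vector space) that is compatible with the comultiplication of $U$. The same holds for the opposite version: if $\Psi_{UU}$ and $\Psi_{HU}$ (resp. $\Psi_{HU}^\circ$) are bijective, then $\Psi_{HU}$ (resp. $\Psi_{HU}^\circ$) is a braiding (turning $U$ into a left $H$-braided and $H$ into a right $U$-braided vector space) that is compatible with the comultiplication of $U$.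
   Context: All vector spaces are over a fixed field $\mathbb K$, $\otimes$ is the algebraic tensor product, $X'$ is the full linear dual of $X$, and composition of maps is written by juxtaposition. A braiding on $V$ is a bijective linear map $\Psi_{VV}:V\otimes V\to V\otimes V$ with $(\Psi_{VV}\otimes\mathrm{id})(\mathrm{id}\otimes\Psi_{VV})(\Psi_{VV}\otimes\mathrm{id})=(\mathrm{id}\otimes\Psi_{VV})(\Psi_{VV}\otimes\mathrm{id})(\mathrm{id}\otimes\Psi_{VV})$; $V$ is then a braided vector space. Let $\Psi_{VW}:V\otimes W\to W\otimes V$ be bijective and linear. If $V$ is braided, $W$ is a left $V$-braided vector space if $(\Psi_{VW}\otimes\mathrm{id})(\mathrm{id}\otimes\Psi_{VW})(\Psi_{VV}\otimes\mathrm{id})=(\mathrm{id}\otimes\Psi_{VV})(\Psi_{VW}\otimes\mathrm{id})(\mathrm{id}\otimes\Psi_{VW})$. If $W$ is braided, $V$ is a right $W$-braided vector space if $(\mathrm{id}\otimes\Psi_{VW})(\Psi_{VW}\otimes\mathrm{id})(\mathrm{id}\otimes\Psi_{WW})=(\Psi_{WW}\otimes\mathrm{id})(\mathrm{id}\otimes\Psi_{VW})(\Psi_{VW}\otimes\mathrm{id})$. Compatibility of $\Psi=\Psi_{VW}$: with the multiplication of an algebra $V$: $\Psi(m_V\otimes\mathrm{id})=(\mathrm{id}\otimes m_V)(\Psi\otimes\mathrm{id})(\mathrm{id}\otimes\Psi)$ and $\Psi(1\otimes w)=w\otimes1$ if $1\in V$; with the multiplication of an algebra $W$: $\Psi(\mathrm{id}\otimes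 m_W)=(m_W\otimes\mathrm{id})(\mathrm{id}\otimes\Psi)(\Psi\otimes\mathrm{id})$ and $\Psi(v\otimes1)=1\otimes v$ if $1\in W$; with the comultiplication of a coalgebra $V$: $(\mathrm{id}\otimes\Delta)\Psi=(\Psi\otimes\mathrm{id})(\mathrm{id}\otimes\Psi)(\Delta\otimes\mathrm{id})$ and $(\mathrm{id}\otimes\varepsilon)\Psi=\varepsilon\otimes\mathrm{id}$; with the comultiplication of a coalgebra $W$: $(\Delta\otimes\mathrm{id})\Psi=(\mathrm{id}\otimes\Psi)(\Psi\otimes\mathrm{id})(\mathrm{id}\otimes\Delta)$ and $(\varepsilon\otimes\mathrm{id})\Psi=\mathrm{id}\otimes\varepsilon$. A braided (co)algebra is a (co)algebra with a braiding satisfying both compatibility conditions with its (co)multiplication. Duality notation: $\langle f,a\rangle=\langle a,f\rangle=f(a)$. $\langle\langle\xi\otimes\eta,x\otimes y\rangle\rangle:=\langle\xi,y\rangle\langle\eta,x\rangle$. For a subspace $C\subset H'$, "$\underline\Delta(f)\in C\otimes C$" means that there is $t\in C\otimes C$ with $\langle\langle t,a\otimes b\rangle\rangle=f(m\Psi_{HH}(a\otimes b))$ for all $a,b\in H$, and then $\underline\Delta(f):=t$; a coalgebra in $H'$ with coproduct $\underline\Delta$ is a subspace $C$ with $\underline\Delta(C)\subset C\otimes C$ that is a coalgebra with this coproduct and counit $f\mapsto f(1)$. For the definitions of induced braidings, tensor products are embedded into duals by $(\xi\otimes\eta)(x\otimes y)=\langle\xi,x\rangle\langle\eta,y\rangle$.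 For $a,b\in H$ define $\Psi_{UU}(f\otimes g)(b\otimes a):=\langle\langle f\otimes g,\Psi_{HH}(a\otimes b)\rangle\rangle$, $f,g\in U$ (values in $(H\otimes H)'\supset U\otimes U$); $\Psi_{UH}(g\otimes a)(f\otimes b):=\langle\langle f\otimes g,\Psi_{HH}(a\otimes b)\rangle\rangle$ and $\Psi_{UH}^\circ(g\otimes a)(f\otimes b):=\langle\langle f\otimes g,\Psi_{HH}^{-1}(a\otimes b)\rangle\rangle$, $g\in U$, $f\in H'$ (values in $(H'\otimes H)'\supset H\otimes U$); $\Psi_{HU}(b\otimes f)(a\otimes g):=\langle\langle f\otimes g,\Psi_{HH}(a\otimes b)\rangle\rangle$ and $\Psi_{HU}^\circ(b\otimes f)(a\otimes g):=\langle\langle f\otimes g,\Psi_{HH}^{-1}(a\otimes b)\rangle\rangle$, $f\in U$, $g\in H'$ (values in $(H\otimes H')'\supset U\otimes H$). Such a map $\Psi_{XY}$ is called bijective if it is a bijection $X\otimes Y\to Y\otimes X$. *)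

theory Defs
  imports Complex_Main "HOL-Library.Function_Algebras"
begin

section \<open>Vector spaces and linear maps\<close>

text \<open>A vector space over the field \<open>'k\<close> is a subspace \<open>carr X\<close> of an ambient vector space
  whose elements form the type \<open>'v\<close> and whose scalar multiplication is \<open>scal X\<close>. Maps between
  vector spaces matter only on the carrier.\<close>

record ('k, 'v) vs =
  scal :: "'k \<Rightarrow> 'v \<Rightarrow> 'v"
  carr :: "'v set"

definition vspace :: "('k::field, 'v::ab_group_add) vs \<Rightarrow> bool" where
  "vspace X \<longleftrightarrow> vector_space (scal X) \<and> module.subspace (scal X) (carr X)"

definition lin :: "('k::field, 'v::ab_group_add) vs \<Rightarrow> ('k, 'w::ab_group_add) vs \<Rightarrow> ('v \<Rightarrow> 'w) \<Rightarrow> bool" where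
  "lin X Y f \<longleftrightarrow> f ` carr X \<subseteq> carr Y
     \<and> (\<forall>x\<in>carr X. \<forall>y\<in>carr X. f (x + y) = f x + f y)
     \<and> (\<forall>c. \<forall>x\<in>carr X. f (scal X c x) = scal Y c (f x))"

definition lin_iso :: "('k::field, 'v::ab_group_add) vs \<Rightarrow> ('k, 'w::ab_group_add) vs \<Rightarrow> ('v \<Rightarrow> 'w) \<Rightarrow> bool" where
  "lin_iso X Y f \<longleftrightarrow> lin X Y f \<and> bij_betw f (carr X) (carr Y)"

definition bilin :: "('k::field, 'v::ab_group_add) vs \<Rightarrow> ('k, 'w::ab_group_add) vs \<Rightarrow> ('k, 'z::ab_group_add) vs
    \<Rightarrow> ('v \<Rightarrow> 'w \<Rightarrow> 'z) \<Rightarrow> bool" where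
  "bilin X Y Z B \<longleftrightarrow> (\<forall>y\<in>carr Y. lin X Z (\<lambda>x. B x y)) \<and> (\<forall>x\<in>carr X. lin Y Z (B x))"

definition scalars :: "('k::field, 'k) vs" where
  "scalars = \<lparr>scal = (*), carr = UNIV\<rparr>"

definition fspace :: "('a \<Rightarrow> 'k::field) set \<Rightarrow> ('k, 'a \<Rightarrow> 'k) vs" where
  "fspace S = \<lparr>scal = (\<lambda>c \<phi> x. c * \<phi> x), carr = S\<rparr>"

text \<open>A functional is made a HOL function by the value \<open>0\<close> outside the carrier.\<close>

definition dual :: "('k::field, 'v::ab_group_add) vs \<Rightarrow> ('k, 'v \<Rightarrow> 'k) vs" where
  "dual X = fspace {\<phi>. lin X scalars \<phi> \<and> (\<forall>x. x \<notin> carr X \<longrightarrow> \<phi> x = 0)}"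


section \<open>The algebraic tensor product\<close>

text \<open>\<open>X \<otimes> Y\<close> is realised inside the dual of the space of bilinear forms: \<open>x \<otimes> y\<close> is the
  evaluation functional \<open>B \<mapsto> B x y\<close>, and \<open>X \<otimes> Y\<close> is the span of these. The bilinear forms
  live on the ambient spaces, so that for subspaces \<open>C \<subseteq> X\<close>, \<open>D \<subseteq> Y\<close> the space \<open>C \<otimes> D\<close> is
  literally a subspace of \<open>X \<otimes> Y\<close>. The universal property is proved at the end of this
  section.\<close>

type_synonym ('k, 'v, 'w) tens = "('v \<Rightarrow> 'w \<Rightarrow> 'k) \<Rightarrow> 'k"

definition ambient :: "('k, 'v) vs \<Rightarrow> ('k, 'v) vs" where
  "ambient X = \<lparr>scal = scal X, carr = UNIV\<rparr>"

definition pure :: "('k::field, 'v::ab_group_add) vs \<Rightarrow> ('k, 'w::ab_group_add) vs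
    \<Rightarrow> 'v \<Rightarrow> 'w \<Rightarrow> ('k, 'v, 'w) tens" where
  "pure X Y x y = (\<lambda>B. if bilin (ambient X) (ambient Y) scalars B then B x y else 0)"

definition tensor :: "('k::field, 'v::ab_group_add) vs \<Rightarrow> ('k, 'w::ab_group_add) vs
    \<Rightarrow> ('k, ('k, 'v, 'w) tens) vs"  (infixl \<open>\<otimes>\<close> 75) where
  "X \<otimes> Y = fspace (module.span (\<lambda>c \<phi> B. c * \<phi> B) {pure X Y x y | x y. x \<in> carr X \<and> y \<in> carr Y})"

text \<open>The linear map on \<open>X \<otimes> Y\<close> determined by \<open>x \<otimes> y \<mapsto> B x y\<close>, for \<open>B\<close> bilinear
  (and \<open>0\<close> outside \<open>X \<otimes> Y\<close>).\<close>

definition tlift :: "('k::field, 'v::ab_group_add) vs \<Rightarrow> ('k, 'w::ab_group_add) vs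
    \<Rightarrow> ('v \<Rightarrow> 'w \<Rightarrow> 'z::ab_group_add) \<Rightarrow> ('k, 'v, 'w) tens \<Rightarrow> 'z" where
  "tlift X Y B t = (if t \<in> carr (X \<otimes> Y) then
     (THE z. \<exists>ps. set ps \<subseteq> carr X \<times> carr Y \<and> t = (\<Sum>(x, y)\<leftarrow>ps. pure X Y x y)
                  \<and> z = (\<Sum>(x, y)\<leftarrow>ps. B x y))
     else 0)"

lemma vector_space_fun: "vector_space (\<lambda>(c::'k::field) (\<phi>::'a \<Rightarrow> 'k) x. c * \<phi> x)"
  by unfold_locales (auto simp: fun_eq_iff algebra_simps)

lemma vspace_tensor:
  fixes X :: "('k::field, 'v::ab_group_add) vs" and Y :: "('k, 'w::ab_group_add) vs"
  shows "vspace (X \<otimes> Y)"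
proof -
  interpret F: vector_space "\<lambda>(c::'k) \<phi> (B::'v \<Rightarrow> 'w \<Rightarrow> 'k). c * \<phi> B" by (rule vector_space_fun)
  show ?thesis unfolding vspace_def tensor_def fspace_def by (simp add: F.vector_space_axioms)
qed

lemma vspace_scalars: "vspace (scalars :: ('k::field, 'k) vs)"
proof -
  interpret S: vector_space "(*) :: 'k \<Rightarrow> 'k \<Rightarrow> 'k" by unfold_locales (auto simp: algebra_simps)
  show ?thesis unfolding vspace_def scalars_def by (simp add: S.vector_space_axioms)
qed

lemma vspace_dual:
  fixes X :: "('k::field, 'v::ab_group_add) vs"
  shows "vspace (dual X)"
proof -
  interpret F: vector_space "\<lambda>(c::'k) \<phi> (x::'v). c * \<phi> x" by (rule vector_space_fun)
  have "F.subspace {\<phi>. lin X scalars \<phi> \<and> (\<forall>x. x \<notin> carr X \<longrightarrow> \<phi> x = 0)}" (is "F.subspace ?S")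
  proof (rule F.subspaceI)
    show "0 \<in> ?S" by (simp add: lin_def scalars_def)
  next
    fix f g assume "f \<in> ?S" "g \<in> ?S"
    then show "f + g \<in> ?S" by (simp add: lin_def scalars_def distrib_left)
  next
    fix c f assume "f \<in> ?S"
    then show "(\<lambda>x. c * f x) \<in> ?S" by (simp add: lin_def scalars_def distrib_left)
  qed
  then show ?thesis
    unfolding vspace_def dual_def fspace_def by (simp add: F.vector_space_axioms)
qed

lemma pure_in_tensor:
  fixes X :: "('k::field, 'v::ab_group_add) vs" and Y :: "('k, 'w::ab_group_add) vs"
  assumes "x \<in> carr X" "y \<in> carr Y"
  shows "pure X Y x y \<in> carr (X \<otimes> Y)"
proof -
  interpret F: vector_space "\<lambda>(c::'k) \<phi> (B::'v \<Rightarrow> 'w \<Rightarrow> 'k). c * \<phi> B" by (rule vector_space_fun)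
  have "pure X Y x y \<in> {pure X Y x y | x y. x \<in> carr X \<and> y \<in> carr Y}" using assms by blast
  from F.span_base[OF this] show ?thesis by (simp add: tensor_def fspace_def)
qed

lemma bilin_pure:
  assumes "vspace X" "vspace Y"
  shows "bilin X Y (X \<otimes> Y) (pure X Y)"
proof -
  have "pure X Y x y \<in> carr (X \<otimes> Y)" if "x \<in> carr X" "y \<in> carr Y" for x y
    using that by (rule pure_in_tensor)
  moreover have "pure X Y (x + x') y = pure X Y x y + pure X Y x' y"
    "pure X Y x (y + y') = pure X Y x y + pure X Y x y'"
    "pure X Y (scal X c x) y = scal (X \<otimes> Y) c (pure X Y x y)"
    "pure X Y x (scal Y c y) = scal (X \<otimes> Y) c (pure X Y x y)" for x x' y y' c
    by (auto simp: bilin_def lin_def pure_def ambient_def scalars_def fun_eq_iff tensor_def fspace_def)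
  ultimately show ?thesis by (auto simp: bilin_def lin_def)
qed

lemma tensor_repr:
  fixes X :: "('k::field, 'v::ab_group_add) vs" and Y :: "('k, 'w::ab_group_add) vs"
  assumes X: "vspace X" and Y: "vspace Y" and t: "t \<in> carr (X \<otimes> Y)"
  shows "\<exists>ps. set ps \<subseteq> carr X \<times> carr Y \<and> t = (\<Sum>(x, y)\<leftarrow>ps. pure X Y x y)"
proof -
  interpret F: vector_space "\<lambda>(c::'k) \<phi> (B::'v \<Rightarrow> 'w \<Rightarrow> 'k). c * \<phi> B" by (rule vector_space_fun)
  interpret MX: vector_space "scal X" using X by (simp add: vspace_def)
  have "t \<in> F.span {pure X Y x y | x y. x \<in> carr X \<and> y \<in> carr Y}"
    using t by (simp add: tensor_def fspace_def)
  then show ?thesis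
  proof (induction rule: F.span_induct_alt)
    case base
    show ?case by (rule exI[of _ "[]"]) (auto simp: fun_eq_iff)
  next
    case (step c s t)
    then obtain x y ps where s: "s = pure X Y x y" "x \<in> carr X" "y \<in> carr Y"
      and ps: "set ps \<subseteq> carr X \<times> carr Y" "t = (\<Sum>(x, y)\<leftarrow>ps. pure X Y x y)" by blast
    have "scal X c x \<in> carr X" using X s MX.subspace_scale by (auto simp: vspace_def)
    moreover have "(\<lambda>B. c * s B) = pure X Y (scal X c x) y"
      using s by (auto simp: pure_def bilin_def lin_def ambient_def scalars_def fun_eq_iff)
    ultimately show ?case using ps s by (intro exI[of _ "(scal X c x, y) # ps"]) auto
  qed
qed

lemma lin_sum_list:
  assumes X: "vspace X" and Y: "vspace Y" and f: "lin X Y f" and "set xs \<subseteq> carr X"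
  shows "sum_list xs \<in> carr X \<and> f (sum_list xs) = sum_list (map f xs)"
  using \<open>set xs \<subseteq> carr X\<close>
proof (induction xs)
  case Nil
  interpret MX: vector_space "scal X" using X by (simp add: vspace_def)
  interpret MY: vector_space "scal Y" using Y by (simp add: vspace_def)
  have z: "0 \<in> carr X" using X MX.subspace_0 by (auto simp: vspace_def)
  then have "f (scal X 0 0) = scal Y 0 (f 0)" using f unfolding lin_def by blast
  then show ?case using z by simp
next
  case (Cons a xs)
  interpret MX: vector_space "scal X" using X by (simp add: vspace_def)
  show ?case using Cons f X MX.subspace_add by (auto simp: lin_def vspace_def)
qed

lemma ex_projection:
  assumes X: "vspace X"
  shows "\<exists>p. lin (ambient X) X p \<and> (\<forall>x\<in>carr X. p x = x)"
proof -
  interpret vector_space_pair "scal X" "scal X"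
    using X by (simp add: vspace_def vector_space_pair_def)
  have "Vector_Spaces.linear (scal X) (scal X) (\<lambda>x. x)"
    using X by (simp add: vspace_def vector_space.linear_ident)
  from linear_exists_left_inverse_on[OF this, of "carr X"] X
  obtain g where g: "range g \<subseteq> carr X" "Vector_Spaces.linear (scal X) (scal X) g" "\<forall>v\<in>carr X. g v = v"
    by (auto simp: vspace_def)
  interpret G: Vector_Spaces.linear "scal X" "scal X" g by (rule g)
  show ?thesis using g by (intro exI[of _ g]) (auto simp: lin_def ambient_def G.add G.scale)
qed

lemma ex_functional:
  fixes Z :: "('k::field, 'z::ab_group_add) vs"
  assumes Z: "vspace Z" and "z \<noteq> 0"
  shows "\<exists>\<phi>. lin (ambient Z) scalars \<phi> \<and> \<phi> z = 1"
proof -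
  interpret vector_space_pair "scal Z" "(*) :: 'k \<Rightarrow> 'k \<Rightarrow> 'k"
    using Z vspace_scalars[where 'k = 'k] by (simp add: vspace_def vector_space_pair_def scalars_def)
  have "vs1.independent {z}" using \<open>z \<noteq> 0\<close> by simp
  then obtain g where g: "Vector_Spaces.linear (scal Z) (*) g" "g z = 1"
    using linear_independent_extend[of "{z}" "\<lambda>_. 1"] by auto
  interpret G: Vector_Spaces.linear "scal Z" "(*)" g by (rule g)
  show ?thesis using g by (intro exI[of _ g]) (auto simp: lin_def ambient_def scalars_def G.add G.scale)
qed

lemma tens_sum_list_eq:
  assumes X: "vspace X" and Y: "vspace Y" and Z: "vspace Z" and B: "bilin X Y Z B"
    and ps: "set ps \<subseteq> carr X \<times> carr Y" and qs: "set qs \<subseteq> carr X \<times> carr Y"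
    and eq: "(\<Sum>(x, y)\<leftarrow>ps. pure X Y x y) = (\<Sum>(x, y)\<leftarrow>qs. pure X Y x y)"
  shows "(\<Sum>(x, y)\<leftarrow>ps. B x y) = (\<Sum>(x, y)\<leftarrow>qs. B x y)"
proof (rule ccontr)
  assume ne: "\<not> ?thesis"
  obtain p where p: "lin (ambient X) X p" "\<forall>x\<in>carr X. p x = x" using ex_projection[OF X] by blast
  obtain q where q: "lin (ambient Y) Y q" "\<forall>y\<in>carr Y. q y = y" using ex_projection[OF Y] by blast
  obtain \<phi> where \<phi>: "lin (ambient Z) scalars \<phi>"
      "\<phi> ((\<Sum>(x, y)\<leftarrow>ps. B x y) - (\<Sum>(x, y)\<leftarrow>qs. B x y)) = 1"
    using ex_functional[OF Z, of "(\<Sum>(x, y)\<leftarrow>ps. B x y) - (\<Sum>(x, y)\<leftarrow>qs. B x y)"] ne by auto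
  define b where "b = (\<lambda>x y. \<phi> (B (p x) (q y)))"
  have px: "p x \<in> carr X" and qx: "q y \<in> carr Y" for x y
    using p q by (auto simp: lin_def ambient_def)
  have pl: "p (x + x') = p x + p x'" "p (scal X c x) = scal X c (p x)" for x x' c
    using p(1) by (auto simp: lin_def ambient_def)
  have ql: "q (x + x') = q x + q x'" "q (scal Y c x) = scal Y c (q x)" for x x' c
    using q(1) by (auto simp: lin_def ambient_def)
  have fl: "\<phi> (x + x') = \<phi> x + \<phi> x'" "\<phi> (scal Z c x) = c * \<phi> x" for x x' c
    using \<phi>(1) by (auto simp: lin_def ambient_def scalars_def)
  have b: "bilin (ambient X) (ambient Y) scalars b"
    unfolding bilin_def using B px qx pl ql fl
    by (auto simp: b_def lin_def bilin_def ambient_def scalars_def)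
  have ev: "(\<Sum>(x, y)\<leftarrow>rs. pure X Y x y) b = \<phi> (\<Sum>(x, y)\<leftarrow>rs. B x y)"
    if "set rs \<subseteq> carr X \<times> carr Y" for rs
    using that
  proof (induction rs)
    case Nil
    have "\<phi> 0 = 0" using fl(1)[of 0 0] by (metis add.right_neutral add_left_cancel)
    then show ?case by simp
  next
    case (Cons a rs)
    then show ?case using b p q by (auto simp: fl pure_def b_def)
  qed
  have "\<phi> (\<Sum>(x, y)\<leftarrow>ps. B x y) = \<phi> (\<Sum>(x, y)\<leftarrow>qs. B x y)" using ev ps qs eq by metis
  moreover have "\<phi> (u - v) = \<phi> u - \<phi> v" for u v using fl(1)[of "u - v" v] by simp
  ultimately show False using \<phi>(2) by simp
qed

lemma tlift_sum_list:
  assumes "vspace X" "vspace Y" "vspace Z" "bilin X Y Z B" "set ps \<subseteq> carr X \<times> carr Y"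
  shows "tlift X Y B (\<Sum>(x, y)\<leftarrow>ps. pure X Y x y) = (\<Sum>(x, y)\<leftarrow>ps. B x y)"
proof -
  have "lin (X \<otimes> Y) (X \<otimes> Y) (\<lambda>t. t)" by (auto simp: lin_def)
  moreover have "set (map (\<lambda>(x, y). pure X Y x y) ps) \<subseteq> carr (X \<otimes> Y)"
    using assms(5) by (auto intro: pure_in_tensor)
  ultimately have t: "(\<Sum>(x, y)\<leftarrow>ps. pure X Y x y) \<in> carr (X \<otimes> Y)"
    using lin_sum_list[OF vspace_tensor vspace_tensor] by blast
  have "(THE z. \<exists>qs. set qs \<subseteq> carr X \<times> carr Y
           \<and> (\<Sum>(x, y)\<leftarrow>ps. pure X Y x y) = (\<Sum>(x, y)\<leftarrow>qs. pure X Y x y)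
           \<and> z = (\<Sum>(x, y)\<leftarrow>qs. B x y)) = (\<Sum>(x, y)\<leftarrow>ps. B x y)"
  proof (rule the_equality)
    show "\<exists>qs. set qs \<subseteq> carr X \<times> carr Y
           \<and> (\<Sum>(x, y)\<leftarrow>ps. pure X Y x y) = (\<Sum>(x, y)\<leftarrow>qs. pure X Y x y)
           \<and> (\<Sum>(x, y)\<leftarrow>ps. B x y) = (\<Sum>(x, y)\<leftarrow>qs. B x y)"
      using assms(5) by blast
  next
    fix z
    assume "\<exists>qs. set qs \<subseteq> carr X \<times> carr Y
           \<and> (\<Sum>(x, y)\<leftarrow>ps. pure X Y x y) = (\<Sum>(x, y)\<leftarrow>qs. pure X Y x y)
           \<and> z = (\<Sum>(x, y)\<leftarrow>qs. B x y)"
    then obtain qs where qs: "set qs \<subseteq> carr X \<times> carr Y"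
        "(\<Sum>(x, y)\<leftarrow>ps. pure X Y x y) = (\<Sum>(x, y)\<leftarrow>qs. pure X Y x y)"
      and z: "z = (\<Sum>(x, y)\<leftarrow>qs. B x y)" by (elim exE conjE)
    show "z = (\<Sum>(x, y)\<leftarrow>ps. B x y)"
      unfolding z by (rule tens_sum_list_eq[OF assms(1-4) assms(5) qs, symmetric])
  qed
  then show ?thesis using t by (simp add: tlift_def)
qed

theorem tlift_pure:
  assumes "vspace X" "vspace Y" "vspace Z" "bilin X Y Z B" "x \<in> carr X" "y \<in> carr Y"
  shows "tlift X Y B (pure X Y x y) = B x y"
  using tlift_sum_list[OF assms(1-4), of "[(x, y)]"] assms(5,6) by simp

theorem lin_tlift:
  assumes X: "vspace X" and Y: "vspace Y" and Z: "vspace Z" and B: "bilin X Y Z B"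
  shows "lin (X \<otimes> Y) Z (tlift X Y B)"
proof -
  interpret MX: vector_space "scal X" using X by (simp add: vspace_def)
  interpret MZ: vector_space "scal Z" using Z by (simp add: vspace_def)
  note S = tlift_sum_list[OF X Y Z B]
  have mem: "tlift X Y B t \<in> carr Z" if t: "t \<in> carr (X \<otimes> Y)" for t
  proof -
    obtain ps where ps: "set ps \<subseteq> carr X \<times> carr Y" "t = (\<Sum>(x, y)\<leftarrow>ps. pure X Y x y)"
      using tensor_repr[OF X Y t] by blast
    have "lin Z Z (\<lambda>t. t)" by (auto simp: lin_def)
    moreover have "B x y \<in> carr Z" if "x \<in> carr X" "y \<in> carr Y" for x y
      using B that unfolding bilin_def lin_def by blast
    then have "set (map (\<lambda>(x, y). B x y) ps) \<subseteq> carr Z" using ps(1) by auto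
    ultimately have "(\<Sum>(x, y)\<leftarrow>ps. B x y) \<in> carr Z" using lin_sum_list[OF Z Z] by blast
    then show ?thesis unfolding ps(2) S[OF ps(1)] .
  qed
  have add: "tlift X Y B (s + t) = tlift X Y B s + tlift X Y B t"
    if st: "s \<in> carr (X \<otimes> Y)" "t \<in> carr (X \<otimes> Y)" for s t
  proof -
    obtain ps where ps: "set ps \<subseteq> carr X \<times> carr Y" "s = (\<Sum>(x, y)\<leftarrow>ps. pure X Y x y)"
      using tensor_repr[OF X Y st(1)] by blast
    obtain qs where qs: "set qs \<subseteq> carr X \<times> carr Y" "t = (\<Sum>(x, y)\<leftarrow>qs. pure X Y x y)"
      using tensor_repr[OF X Y st(2)] by blast
    have "set (ps @ qs) \<subseteq> carr X \<times> carr Y" using ps(1) qs(1) by simp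
    from S[OF this] show ?thesis
      unfolding ps(2) qs(2) S[OF ps(1)] S[OF qs(1)] by (simp only: map_append sum_list_append)
  qed
  have scale: "tlift X Y B (scal (X \<otimes> Y) c t) = scal Z c (tlift X Y B t)"
    if t: "t \<in> carr (X \<otimes> Y)" for c t
  proof -
    obtain ps where ps: "set ps \<subseteq> carr X \<times> carr Y" "t = (\<Sum>(x, y)\<leftarrow>ps. pure X Y x y)"
      using tensor_repr[OF X Y t] by blast
    let ?m = "map (\<lambda>(x, y). (scal X c x, y))"
    have m: "set (?m ps) \<subseteq> carr X \<times> carr Y"
      using ps X MX.subspace_scale by (auto simp: vspace_def)
    have t': "scal (X \<otimes> Y) c (\<Sum>(x, y)\<leftarrow>rs. pure X Y x y) = (\<Sum>(x, y)\<leftarrow>?m rs. pure X Y x y)" for rs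
    proof (induction rs)
      case Nil
      then show ?case by (simp add: tensor_def fspace_def fun_eq_iff)
    next
      case (Cons a rs)
      have "scal (X \<otimes> Y) c (pure X Y x y) = pure X Y (scal X c x) y" for x y
        by (auto simp: tensor_def fspace_def pure_def bilin_def lin_def ambient_def scalars_def fun_eq_iff)
      moreover have "scal (X \<otimes> Y) c (u + v) = scal (X \<otimes> Y) c u + scal (X \<otimes> Y) c v" for u v
        by (simp add: tensor_def fspace_def fun_eq_iff algebra_simps)
      ultimately show ?case using Cons
        by (cases a) (simp only: list.map sum_list.Cons prod.case)
    qed
    have z': "scal Z c (\<Sum>(x, y)\<leftarrow>rs. B x y) = (\<Sum>(x, y)\<leftarrow>?m rs. B x y)"
      if "set rs \<subseteq> carr X \<times> carr Y" for rs
      using that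
    proof (induction rs)
      case (Cons a rs)
      then show ?case using B by (cases a) (auto simp: MZ.scale_right_distrib bilin_def lin_def)
    qed simp
    show ?thesis unfolding ps(2) t' S[OF m] S[OF ps(1)] z'[OF ps(1)] ..
  qed
  show ?thesis using mem add scale unfolding lin_def by blast
qed

theorem lin_tensor_unique:
  assumes X: "vspace X" and Y: "vspace Y" and Z: "vspace Z"
    and f: "lin (X \<otimes> Y) Z f" and g: "lin (X \<otimes> Y) Z g"
    and eq: "\<And>x y. x \<in> carr X \<Longrightarrow> y \<in> carr Y \<Longrightarrow> f (pure X Y x y) = g (pure X Y x y)"
    and t: "t \<in> carr (X \<otimes> Y)"
  shows "f t = g t"
proof -
  obtain ps where ps: "set ps \<subseteq> carr X \<times> carr Y" "t = (\<Sum>(x, y)\<leftarrow>ps. pure X Y x y)"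
    using tensor_repr[OF X Y t] by blast
  have s: "set (map (\<lambda>(x, y). pure X Y x y) ps) \<subseteq> carr (X \<otimes> Y)"
    using ps by (auto intro: pure_in_tensor)
  have "map f (map (\<lambda>(x, y). pure X Y x y) ps) = map g (map (\<lambda>(x, y). pure X Y x y) ps)"
    using ps eq by auto
  then show ?thesis
    using lin_sum_list[OF vspace_tensor Z f s] lin_sum_list[OF vspace_tensor Z g s] ps by metis
qed


section \<open>Tensor products of maps\<close>

definition tmap :: "('k::field, 'v::ab_group_add) vs \<Rightarrow> ('k, 'w::ab_group_add) vs
    \<Rightarrow> ('k, 'v2::ab_group_add) vs \<Rightarrow> ('k, 'w2::ab_group_add) vs
    \<Rightarrow> ('v \<Rightarrow> 'v2) \<Rightarrow> ('w \<Rightarrow> 'w2) \<Rightarrow> ('k, 'v, 'w) tens \<Rightarrow> ('k, 'v2, 'w2) tens" where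
  "tmap X Y X2 Y2 f g = tlift X Y (\<lambda>x y. pure X2 Y2 (f x) (g y))"

definition assoc :: "('k::field, 'u::ab_group_add) vs \<Rightarrow> ('k, 'v::ab_group_add) vs \<Rightarrow> ('k, 'w::ab_group_add) vs
    \<Rightarrow> ('k, ('k, 'u, 'v) tens, 'w) tens \<Rightarrow> ('k, 'u, ('k, 'v, 'w) tens) tens" where
  "assoc X Y Z = tlift (X \<otimes> Y) Z (\<lambda>t z. tlift X Y (\<lambda>x y. pure X (Y \<otimes> Z) x (pure Y Z y z)) t)"

definition assoc_inv :: "('k::field, 'u::ab_group_add) vs \<Rightarrow> ('k, 'v::ab_group_add) vs \<Rightarrow> ('k, 'w::ab_group_add) vs
    \<Rightarrow> ('k, 'u, ('k, 'v, 'w) tens) tens \<Rightarrow> ('k, ('k, 'u, 'v) tens, 'w) tens" where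
  "assoc_inv X Y Z = tlift X (Y \<otimes> Z) (\<lambda>x t. tlift Y Z (\<lambda>y z. pure (X \<otimes> Y) Z (pure X Y x y) z) t)"

text \<open>Triple tensor products are bracketed to the left. For \<open>\<Psi> : X \<otimes> Y \<rightarrow> Y \<otimes> X\<close> (resp.
  \<open>\<Psi> : Y \<otimes> Z \<rightarrow> Z \<otimes> Y\<close>), \<open>\<Psi> \<otimes> id\<close> (resp. \<open>id \<otimes> \<Psi>\<close>) on \<open>X \<otimes> Y \<otimes> Z\<close>:\<close>

definition br12 :: "('k::field, 'u::ab_group_add) vs \<Rightarrow> ('k, 'v::ab_group_add) vs \<Rightarrow> ('k, 'w::ab_group_add) vs
    \<Rightarrow> (('k, 'u, 'v) tens \<Rightarrow> ('k, 'v, 'u) tens)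
    \<Rightarrow> ('k, ('k, 'u, 'v) tens, 'w) tens \<Rightarrow> ('k, ('k, 'v, 'u) tens, 'w) tens" where
  "br12 X Y Z \<Psi> = tmap (X \<otimes> Y) Z (Y \<otimes> X) Z \<Psi> (\<lambda>z. z)"

definition br23 :: "('k::field, 'u::ab_group_add) vs \<Rightarrow> ('k, 'v::ab_group_add) vs \<Rightarrow> ('k, 'w::ab_group_add) vs
    \<Rightarrow> (('k, 'v, 'w) tens \<Rightarrow> ('k, 'w, 'v) tens)
    \<Rightarrow> ('k, ('k, 'u, 'v) tens, 'w) tens \<Rightarrow> ('k, ('k, 'u, 'w) tens, 'v) tens" where
  "br23 X Y Z \<Psi> t =
     assoc_inv X Z Y (tmap X (Y \<otimes> Z) X (Z \<otimes> Y) (\<lambda>x. x) \<Psi> (assoc X Y Z t))"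


section \<open>Braided vector spaces\<close>

definition braided :: "('k::field, 'v::ab_group_add) vs \<Rightarrow> (('k, 'v, 'v) tens \<Rightarrow> ('k, 'v, 'v) tens) \<Rightarrow> bool" where
  "braided V \<Psi> \<longleftrightarrow> vspace V \<and> lin_iso (V \<otimes> V) (V \<otimes> V) \<Psi> \<and>
     (\<forall>t\<in>carr (V \<otimes> V \<otimes> V).
        br12 V V V \<Psi> (br23 V V V \<Psi> (br12 V V V \<Psi> t))
      = br23 V V V \<Psi> (br12 V V V \<Psi> (br23 V V V \<Psi> t)))"

text \<open>\<open>left_braided V \<Psi>\<^sub>V\<^sub>V W \<Psi>\<close>: \<open>W\<close> is a left \<open>V\<close>-braided vector space by \<open>\<Psi> : V \<otimes> W \<rightarrow> W \<otimes> V\<close>.\<close>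

definition left_braided :: "('k::field, 'v::ab_group_add) vs \<Rightarrow> (('k, 'v, 'v) tens \<Rightarrow> ('k, 'v, 'v) tens)
    \<Rightarrow> ('k, 'w::ab_group_add) vs \<Rightarrow> (('k, 'v, 'w) tens \<Rightarrow> ('k, 'w, 'v) tens) \<Rightarrow> bool" where
  "left_braided V \<Psi>V W \<Psi> \<longleftrightarrow> braided V \<Psi>V \<and> vspace W \<and> lin_iso (V \<otimes> W) (W \<otimes> V) \<Psi> \<and>
     (\<forall>t\<in>carr (V \<otimes> V \<otimes> W).
        br12 V W V \<Psi> (br23 V V W \<Psi> (br12 V V W \<Psi>V t))
      = br23 W V V \<Psi>V (br12 V W V \<Psi> (br23 V V W \<Psi> t)))"

text \<open>\<open>right_braided W \<Psi>\<^sub>W\<^sub>W V \<Psi>\<close>: \<open>V\<close> is a right \<open>W\<close>-braided vector space by \<open>\<Psi> : V \<otimes> W \<rightarrow> W \<otimes> V\<close>.\<close>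

definition right_braided :: "('k::field, 'w::ab_group_add) vs \<Rightarrow> (('k, 'w, 'w) tens \<Rightarrow> ('k, 'w, 'w) tens)
    \<Rightarrow> ('k, 'v::ab_group_add) vs \<Rightarrow> (('k, 'v, 'w) tens \<Rightarrow> ('k, 'w, 'v) tens) \<Rightarrow> bool" where
  "right_braided W \<Psi>W V \<Psi> \<longleftrightarrow> braided W \<Psi>W \<and> vspace V \<and> lin_iso (V \<otimes> W) (W \<otimes> V) \<Psi> \<and>
     (\<forall>t\<in>carr (V \<otimes> W \<otimes> W).
        br23 W V W \<Psi> (br12 V W W \<Psi> (br23 V W W \<Psi>W t))
      = br12 W W V \<Psi>W (br23 W V W \<Psi> (br12 V W W \<Psi> t)))"


section \<open>Braided algebras and coalgebras\<close>

definition unital_algebra :: "('k::field, 'v::ab_group_add) vs \<Rightarrow> (('k, 'v, 'v) tens \<Rightarrow> 'v) \<Rightarrow> 'v \<Rightarrow> bool" where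
  "unital_algebra A m e \<longleftrightarrow> vspace A \<and> lin (A \<otimes> A) A m \<and> e \<in> carr A \<and>
     (\<forall>t\<in>carr (A \<otimes> A \<otimes> A). m (tmap (A \<otimes> A) A A A m (\<lambda>x. x) t)
        = m (tmap A (A \<otimes> A) A A (\<lambda>x. x) m (assoc A A A t))) \<and>
     (\<forall>x\<in>carr A. m (pure A A e x) = x \<and> m (pure A A x e) = x)"

text \<open>Under the identifications \<open>X \<otimes> \<K> = X = \<K> \<otimes> X\<close>:\<close>

definition id_counit :: "('k::field, 'v::ab_group_add) vs \<Rightarrow> ('k, 'w::ab_group_add) vs \<Rightarrow> ('w \<Rightarrow> 'k)
    \<Rightarrow> ('k, 'v, 'w) tens \<Rightarrow> 'v" where
  "id_counit X Y \<epsilon> = tlift X Y (\<lambda>x y. scal X (\<epsilon> y) x)"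

definition counit_id :: "('k::field, 'v::ab_group_add) vs \<Rightarrow> ('k, 'w::ab_group_add) vs \<Rightarrow> ('v \<Rightarrow> 'k)
    \<Rightarrow> ('k, 'v, 'w) tens \<Rightarrow> 'w" where
  "counit_id X Y \<epsilon> = tlift X Y (\<lambda>x y. scal Y (\<epsilon> x) y)"

definition coalgebra :: "('k::field, 'v::ab_group_add) vs \<Rightarrow> ('v \<Rightarrow> ('k, 'v, 'v) tens) \<Rightarrow> ('v \<Rightarrow> 'k) \<Rightarrow> bool" where
  "coalgebra C \<Delta> \<epsilon> \<longleftrightarrow> vspace C \<and> lin C (C \<otimes> C) \<Delta> \<and> lin C scalars \<epsilon> \<and>
     (\<forall>c\<in>carr C. assoc C C C (tmap C C (C \<otimes> C) C \<Delta> (\<lambda>x. x) (\<Delta> c))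
        = tmap C C C (C \<otimes> C) (\<lambda>x. x) \<Delta> (\<Delta> c)) \<and>
     (\<forall>c\<in>carr C. counit_id C C \<epsilon> (\<Delta> c) = c \<and> id_counit C C \<epsilon> (\<Delta> c) = c)"

text \<open>In the compatibility conditions \<open>\<Psi> : V \<otimes> W \<rightarrow> W \<otimes> V\<close>; the suffix 1 (resp. 2) refers to
  the structure on \<open>V\<close> (resp. on \<open>W\<close>).\<close>

definition compat_mult1 :: "('k::field, 'v::ab_group_add) vs \<Rightarrow> (('k, 'v, 'v) tens \<Rightarrow> 'v) \<Rightarrow> 'v
    \<Rightarrow> ('k, 'w::ab_group_add) vs \<Rightarrow> (('k, 'v, 'w) tens \<Rightarrow> ('k, 'w, 'v) tens) \<Rightarrow> bool" where
  "compat_mult1 V m e W \<Psi> \<longleftrightarrow>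
     (\<forall>t\<in>carr (V \<otimes> V \<otimes> W). \<Psi> (tmap (V \<otimes> V) W V W m (\<lambda>w. w) t)
        = tmap W (V \<otimes> V) W V (\<lambda>w. w) m (assoc W V V (br12 V W V \<Psi> (br23 V V W \<Psi> t)))) \<and>
     (\<forall>w\<in>carr W. \<Psi> (pure V W e w) = pure W V w e)"

definition compat_mult2 :: "('k::field, 'w::ab_group_add) vs \<Rightarrow> (('k, 'w, 'w) tens \<Rightarrow> 'w) \<Rightarrow> 'w
    \<Rightarrow> ('k, 'v::ab_group_add) vs \<Rightarrow> (('k, 'v, 'w) tens \<Rightarrow> ('k, 'w, 'v) tens) \<Rightarrow> bool" where
  "compat_mult2 W m e V \<Psi> \<longleftrightarrow>
     (\<forall>t\<in>carr (V \<otimes> W \<otimes> W). \<Psi> (tmap V (W \<otimes> W) V W (\<lambda>v. v) m (assoc V W W t))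
        = tmap (W \<otimes> W) V W V m (\<lambda>v. v) (br23 W V W \<Psi> (br12 V W W \<Psi> t))) \<and>
     (\<forall>v\<in>carr V. \<Psi> (pure V W v e) = pure W V e v)"

definition compat_comult1 :: "('k::field, 'v::ab_group_add) vs \<Rightarrow> ('v \<Rightarrow> ('k, 'v, 'v) tens) \<Rightarrow> ('v \<Rightarrow> 'k)
    \<Rightarrow> ('k, 'w::ab_group_add) vs \<Rightarrow> (('k, 'v, 'w) tens \<Rightarrow> ('k, 'w, 'v) tens) \<Rightarrow> bool" where
  "compat_comult1 V \<Delta> \<epsilon> W \<Psi> \<longleftrightarrow>
     (\<forall>t\<in>carr (V \<otimes> W). tmap W V W (V \<otimes> V) (\<lambda>w. w) \<Delta> (\<Psi> t)
        = assoc W V V (br12 V W V \<Psi> (br23 V V W \<Psi> (tmap V W (V \<otimes> V) W \<Delta> (\<lambda>w. w) t)))) \<and>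
     (\<forall>t\<in>carr (V \<otimes> W). id_counit W V \<epsilon> (\<Psi> t) = counit_id V W \<epsilon> t)"

definition compat_comult2 :: "('k::field, 'w::ab_group_add) vs \<Rightarrow> ('w \<Rightarrow> ('k, 'w, 'w) tens) \<Rightarrow> ('w \<Rightarrow> 'k)
    \<Rightarrow> ('k, 'v::ab_group_add) vs \<Rightarrow> (('k, 'v, 'w) tens \<Rightarrow> ('k, 'w, 'v) tens) \<Rightarrow> bool" where
  "compat_comult2 W \<Delta> \<epsilon> V \<Psi> \<longleftrightarrow>
     (\<forall>t\<in>carr (V \<otimes> W). tmap W V (W \<otimes> W) V \<Delta> (\<lambda>v. v) (\<Psi> t)
        = br23 W V W \<Psi> (br12 V W W \<Psi> (assoc_inv V W W (tmap V W V (W \<otimes> W) (\<lambda>v. v) \<Delta> t)))) \<and>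
     (\<forall>t\<in>carr (V \<otimes> W). counit_id W V \<epsilon> (\<Psi> t) = id_counit V W \<epsilon> t)"

definition braided_unital_algebra :: "('k::field, 'v::ab_group_add) vs \<Rightarrow> (('k, 'v, 'v) tens \<Rightarrow> 'v) \<Rightarrow> 'v
    \<Rightarrow> (('k, 'v, 'v) tens \<Rightarrow> ('k, 'v, 'v) tens) \<Rightarrow> bool" where
  "braided_unital_algebra A m e \<Psi> \<longleftrightarrow> unital_algebra A m e \<and> braided A \<Psi> \<and>
     compat_mult1 A m e A \<Psi> \<and> compat_mult2 A m e A \<Psi>"

definition braided_coalgebra :: "('k::field, 'v::ab_group_add) vs \<Rightarrow> ('v \<Rightarrow> ('k, 'v, 'v) tens) \<Rightarrow> ('v \<Rightarrow> 'k)
    \<Rightarrow> (('k, 'v, 'v) tens \<Rightarrow> ('k, 'v, 'v) tens) \<Rightarrow> bool" where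
  "braided_coalgebra C \<Delta> \<epsilon> \<Psi> \<longleftrightarrow> coalgebra C \<Delta> \<epsilon> \<and> braided C \<Psi> \<and>
     compat_comult1 C \<Delta> \<epsilon> C \<Psi> \<and> compat_comult2 C \<Delta> \<epsilon> C \<Psi>"


section \<open>Coalgebras in the dual of a braided algebra\<close>

text \<open>The nested pairing \<open>\<langle>\<langle>\<xi> \<otimes> \<eta>, x \<otimes> y\<rangle>\<rangle> = \<langle>\<xi>, y\<rangle> \<langle>\<eta>, x\<rangle>\<close> on \<open>(H' \<otimes> H') \<times> (H \<otimes> H)\<close>.\<close>

definition npair :: "('k::field, 'h::ab_group_add) vs \<Rightarrow> ('k, 'h \<Rightarrow> 'k, 'h \<Rightarrow> 'k) tens \<Rightarrow> ('k, 'h, 'h) tens \<Rightarrow> 'k" where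
  "npair H = tlift (dual H) (dual H) (\<lambda>\<xi> \<eta>. tlift H H (\<lambda>x y. \<xi> y * \<eta> x))"

text \<open>\<open>t\<close> represents \<open>\<Delta>(f) \<in> (H \<otimes> H)'\<close>.\<close>

definition represents_coprod :: "('k::field, 'h::ab_group_add) vs \<Rightarrow> (('k, 'h, 'h) tens \<Rightarrow> 'h)
    \<Rightarrow> (('k, 'h, 'h) tens \<Rightarrow> ('k, 'h, 'h) tens) \<Rightarrow> ('h \<Rightarrow> 'k) \<Rightarrow> ('k, 'h \<Rightarrow> 'k, 'h \<Rightarrow> 'k) tens \<Rightarrow> bool" where
  "represents_coprod H m \<Psi> f t \<longleftrightarrow>
     (\<forall>a\<in>carr H. \<forall>b\<in>carr H. npair H t (pure H H a b) = f (m (\<Psi> (pure H H a b))))"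

definition coprod :: "('k::field, 'h::ab_group_add) vs \<Rightarrow> (('k, 'h, 'h) tens \<Rightarrow> 'h)
    \<Rightarrow> (('k, 'h, 'h) tens \<Rightarrow> ('k, 'h, 'h) tens) \<Rightarrow> ('h \<Rightarrow> 'k) \<Rightarrow> ('k, 'h \<Rightarrow> 'k, 'h \<Rightarrow> 'k) tens" where
  "coprod H m \<Psi> f = (THE t. t \<in> carr (dual H \<otimes> dual H) \<and> represents_coprod H m \<Psi> f t)"

definition coprod_closed :: "('k::field, 'h::ab_group_add) vs \<Rightarrow> (('k, 'h, 'h) tens \<Rightarrow> 'h)
    \<Rightarrow> (('k, 'h, 'h) tens \<Rightarrow> ('k, 'h, 'h) tens) \<Rightarrow> ('h \<Rightarrow> 'k) set \<Rightarrow> bool" where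
  "coprod_closed H m \<Psi> C \<longleftrightarrow>
     (\<forall>f\<in>C. \<exists>t\<in>carr (fspace C \<otimes> fspace C). represents_coprod H m \<Psi> f t)"

definition coalgebra_in_dual :: "('k::field, 'h::ab_group_add) vs \<Rightarrow> (('k, 'h, 'h) tens \<Rightarrow> 'h) \<Rightarrow> 'h
    \<Rightarrow> (('k, 'h, 'h) tens \<Rightarrow> ('k, 'h, 'h) tens) \<Rightarrow> ('h \<Rightarrow> 'k) set \<Rightarrow> bool" where
  "coalgebra_in_dual H m e \<Psi> C \<longleftrightarrow> C \<subseteq> carr (dual H) \<and> vspace (fspace C) \<and> coprod_closed H m \<Psi> C \<and>
     coalgebra (fspace C) (coprod H m \<Psi>) (\<lambda>f. f e)"

definition subcoalgebra_in_dual :: "('k::field, 'h::ab_group_add) vs \<Rightarrow> (('k, 'h, 'h) tens \<Rightarrow> 'h)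
    \<Rightarrow> (('k, 'h, 'h) tens \<Rightarrow> ('k, 'h, 'h) tens) \<Rightarrow> ('h \<Rightarrow> 'k) set \<Rightarrow> ('h \<Rightarrow> 'k) set \<Rightarrow> bool" where
  "subcoalgebra_in_dual H m \<Psi> C U \<longleftrightarrow> U \<subseteq> C \<and> vspace (fspace U) \<and> coprod_closed H m \<Psi> U"

definition separates_points :: "('k, 'h) vs \<Rightarrow> ('h \<Rightarrow> 'k) set \<Rightarrow> bool" where
  "separates_points H U \<longleftrightarrow> (\<forall>x\<in>carr H. \<forall>y\<in>carr H. x \<noteq> y \<longrightarrow> (\<exists>f\<in>U. f x \<noteq> f y))"


section \<open>The induced braidings\<close>

text \<open>The embeddings \<open>U \<otimes> U \<subseteq> (H \<otimes> H)'\<close>, \<open>H \<otimes> U \<subseteq> (H' \<otimes> H)'\<close> and \<open>U \<otimes> H \<subseteq> (H \<otimes> H')'\<close>,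
  \<open>(\<xi> \<otimes> \<eta>)(x \<otimes> y) = \<langle>\<xi>, x\<rangle> \<langle>\<eta>, y\<rangle>\<close>.\<close>

definition emb_UU :: "('k::field, 'h::ab_group_add) vs \<Rightarrow> ('k, 'h \<Rightarrow> 'k) vs
    \<Rightarrow> ('k, 'h \<Rightarrow> 'k, 'h \<Rightarrow> 'k) tens \<Rightarrow> ('k, 'h, 'h) tens \<Rightarrow> 'k" where
  "emb_UU H U = tlift U U (\<lambda>\<xi> \<eta>. tlift H H (\<lambda>x y. \<xi> x * \<eta> y))"

definition emb_HU :: "('k::field, 'h::ab_group_add) vs \<Rightarrow> ('k, 'h \<Rightarrow> 'k) vs
    \<Rightarrow> ('k, 'h, 'h \<Rightarrow> 'k) tens \<Rightarrow> ('k, 'h \<Rightarrow> 'k, 'h) tens \<Rightarrow> 'k" where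
  "emb_HU H U = tlift H U (\<lambda>\<xi> \<eta>. tlift (dual H) H (\<lambda>x y. x \<xi> * \<eta> y))"

definition emb_UH :: "('k::field, 'h::ab_group_add) vs \<Rightarrow> ('k, 'h \<Rightarrow> 'k) vs
    \<Rightarrow> ('k, 'h \<Rightarrow> 'k, 'h) tens \<Rightarrow> ('k, 'h, 'h \<Rightarrow> 'k) tens \<Rightarrow> 'k" where
  "emb_UH H U = tlift U H (\<lambda>\<xi> \<eta>. tlift H (dual H) (\<lambda>x y. \<xi> x * y \<eta>))"

text \<open>The maps \<open>\<Psi>\<^sub>U\<^sub>U\<close>, \<open>\<Psi>\<^sub>U\<^sub>H\<close>, \<open>\<Psi>\<^sub>H\<^sub>U\<close> with values in these duals; in the last two, the argument
  \<open>\<Phi>\<close> is \<open>\<Psi>\<^sub>H\<^sub>H\<close> or, for the maps with superscript \<open>\<circ>\<close>, the inverse of \<open>\<Psi>\<^sub>H\<^sub>H\<close>.\<close>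

definition dPsi_UU :: "('k::field, 'h::ab_group_add) vs \<Rightarrow> (('k, 'h, 'h) tens \<Rightarrow> ('k, 'h, 'h) tens)
    \<Rightarrow> ('k, 'h \<Rightarrow> 'k) vs \<Rightarrow> ('k, 'h \<Rightarrow> 'k, 'h \<Rightarrow> 'k) tens \<Rightarrow> ('k, 'h, 'h) tens \<Rightarrow> 'k" where
  "dPsi_UU H \<Psi> U = tlift U U (\<lambda>f g. tlift H H (\<lambda>b a.
     npair H (pure (dual H) (dual H) f g) (\<Psi> (pure H H a b))))"

definition dPsi_UH :: "('k::field, 'h::ab_group_add) vs \<Rightarrow> (('k, 'h, 'h) tens \<Rightarrow> ('k, 'h, 'h) tens)
    \<Rightarrow> ('k, 'h \<Rightarrow> 'k) vs \<Rightarrow> ('k, 'h \<Rightarrow> 'k, 'h) tens \<Rightarrow> ('k, 'h \<Rightarrow> 'k, 'h) tens \<Rightarrow> 'k" where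
  "dPsi_UH H \<Phi> U = tlift U H (\<lambda>g a. tlift (dual H) H (\<lambda>f b.
     npair H (pure (dual H) (dual H) f g) (\<Phi> (pure H H a b))))"

definition dPsi_HU :: "('k::field, 'h::ab_group_add) vs \<Rightarrow> (('k, 'h, 'h) tens \<Rightarrow> ('k, 'h, 'h) tens)
    \<Rightarrow> ('k, 'h \<Rightarrow> 'k) vs \<Rightarrow> ('k, 'h, 'h \<Rightarrow> 'k) tens \<Rightarrow> ('k, 'h, 'h \<Rightarrow> 'k) tens \<Rightarrow> 'k" where
  "dPsi_HU H \<Phi> U = tlift H U (\<lambda>b f. tlift H (dual H) (\<lambda>a g.
     npair H (pure (dual H) (dual H) f g) (\<Phi> (pure H H a b))))"

text \<open>Bijectivity of \<open>\<Psi>\<^sub>X\<^sub>Y\<close> means that it is a bijection from \<open>X \<otimes> Y\<close> onto the embedded copy of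
  \<open>Y \<otimes> X\<close>. The map into \<open>Y \<otimes> X\<close> itself is then obtained by undoing the embedding.\<close>

definition bij_UU where
  "bij_UU H \<Psi> U \<longleftrightarrow> bij_betw (dPsi_UU H \<Psi> U) (carr (U \<otimes> U)) (emb_UU H U ` carr (U \<otimes> U))"

definition bij_UH where
  "bij_UH H \<Phi> U \<longleftrightarrow> bij_betw (dPsi_UH H \<Phi> U) (carr (U \<otimes> H)) (emb_HU H U ` carr (H \<otimes> U))"

definition bij_HU where
  "bij_HU H \<Phi> U \<longleftrightarrow> bij_betw (dPsi_HU H \<Phi> U) (carr (H \<otimes> U)) (emb_UH H U ` carr (U \<otimes> H))"

definition Psi_UU where
  "Psi_UU H \<Psi> U t = inv_into (carr (U \<otimes> U)) (emb_UU H U) (dPsi_UU H \<Psi> U t)"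

definition Psi_UH where
  "Psi_UH H \<Phi> U t = inv_into (carr (H \<otimes> U)) (emb_HU H U) (dPsi_UH H \<Phi> U t)"

definition Psi_HU where
  "Psi_HU H \<Phi> U t = inv_into (carr (U \<otimes> H)) (emb_UH H U) (dPsi_HU H \<Phi> U t)"

definition Psi_inv where
  "Psi_inv H \<Psi> = inv_into (carr (H \<otimes> H)) \<Psi>"

end

theory Submission
  imports Defs
begin

text \<open>Write \<open>\<mu> = m \<Psi>\<^sub>H\<^sub>H\<close>. By the Yang-Baxter equation and the compatibility of \<open>\<Psi>\<^sub>H\<^sub>H\<close> with \<open>m\<close>, the map \<open>\<mu>\<close> is
again an associative multiplication with unit \<open>1\<close>, and it is compatible with \<open>\<Psi>\<^sub>H\<^sub>H\<close> and with its
inverse (\<open>unital_algebra_\<mu>\<close>, \<open>admissible_compat_\<mu>\<close>).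

The coproduct of \<open>H'\<close> is the transpose of \<open>\<mu>\<close> with respect to the nested pairing, and \<open>\<Psi>\<^sub>U\<^sub>U\<close> is
the transpose of \<open>\<Psi>\<^sub>H\<^sub>H\<close>. Transposition reverses the order of composition, and the nesting of the
pairing reverses the order of the tensor factors, so \<open>\<Psi> \<otimes> id\<close> and \<open>id \<otimes> \<Psi>\<close> are exchanged. Since the
pairings are nondegenerate on the side of the functionals, every identity between the structure
maps of \<open>H\<close> on \<open>H \<otimes> H \<otimes> H\<close> gives one for \<open>U\<close>: associativity gives coassociativity, the Yang-Baxter
equation of \<open>\<Psi>\<^sub>H\<^sub>H\<close> gives that of \<open>\<Psi>\<^sub>U\<^sub>U\<close>, and compatibility with \<open>\<mu>\<close> gives compatibility with the
coproduct (\<open>coalgebra\<close>, \<open>braided_coalgebra_adjoint\<close>). In particular a subspace of \<open>H'\<close> that is closed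
under the coproduct is automatically a coalgebra, and the span of all such subspaces is closed, hence
is the largest coalgebra (\<open>coalgebra_in_dual_span_Union\<close>).

In \<open>\<Psi>\<^sub>U\<^sub>H\<close> and \<open>\<Psi>\<^sub>H\<^sub>U\<close> only one of the two strands of \<open>\<Phi> = \<Psi>\<^sub>H\<^sub>H\<^sup>\<plusminus>\<^sup>1\<close> is transposed:
\<open>(id \<otimes> ev\<^sub>b) \<Psi>\<^sub>U\<^sub>H (g \<otimes> a) = (g \<otimes> id) \<Phi> (a \<otimes> b)\<close>, and similarly for \<open>\<Psi>\<^sub>H\<^sub>U\<close>. Evaluating the \<open>U\<close>-strands
of a composite of two such crossings gives the corresponding composite of two copies of \<open>\<Phi>\<close>, read
with the \<open>U\<close>-strand moved to the other side (\<open>UHH_slice\<close>, \<open>UUH_slice\<close>, \<open>HHU_slice\<close>, \<open>HUU_slice\<close>). So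
each equation to be proved is the evaluation of an equation on \<open>H \<otimes> H \<otimes> H\<close> that involves \<open>\<Psi>\<^sub>H\<^sub>H\<close> once
and \<open>\<Phi>\<close> twice, or \<open>\<mu>\<close> once and \<open>\<Phi>\<close>. For \<open>\<Phi> = \<Psi>\<^sub>H\<^sub>H\<close> these are the Yang-Baxter
equation and the compatibility of \<open>\<Psi>\<^sub>H\<^sub>H\<close> with \<open>\<mu>\<close>; for \<open>\<Phi> = \<Psi>\<^sub>H\<^sub>H\<^sup>-\<^sup>1\<close> they follow by moving crossings from one
side to the other.\<close>

section \<open>Linear maps and tensors\<close>

declare vspace_tensor [simp] vspace_scalars [simp] vspace_dual [simp] pure_in_tensor [simp]

lemma vspace_add: "vspace X \<Longrightarrow> x \<in> carr X \<Longrightarrow> y \<in> carr X \<Longrightarrow> x + y \<in> carr X"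
  unfolding vspace_def by (metis module.subspace_add module_iff_vector_space)

lemma vspace_scale: "vspace X \<Longrightarrow> x \<in> carr X \<Longrightarrow> scal X c x \<in> carr X"
  unfolding vspace_def using module.subspace_scale by (metis module_iff_vector_space)

lemma vspace_zero: "vspace X \<Longrightarrow> 0 \<in> carr X"
  unfolding vspace_def using module.subspace_0 by (metis module_iff_vector_space)

lemma vspace_diff: "vspace X \<Longrightarrow> x \<in> carr X \<Longrightarrow> y \<in> carr X \<Longrightarrow> x - y \<in> carr X"
  unfolding vspace_def using module.subspace_diff by (metis module_iff_vector_space)

lemma vspace_module: "vspace X \<Longrightarrow> module (scal X)"
  unfolding vspace_def by (simp add: module_iff_vector_space)

lemma carr_scalars [simp]: "carr scalars = UNIV" and scal_scalars [simp]: "scal scalars = (*)"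
  by (simp_all add: scalars_def)

lemma lin_id [simp]: "lin X X (\<lambda>x. x)"
  by (simp add: lin_def)

lemma lin_in: "lin X Y f \<Longrightarrow> x \<in> carr X \<Longrightarrow> f x \<in> carr Y"
  by (auto simp: lin_def)

lemma lin_add: "lin X Y f \<Longrightarrow> x \<in> carr X \<Longrightarrow> y \<in> carr X \<Longrightarrow> f (x + y) = f x + f y"
  by (auto simp: lin_def)

lemma lin_scale: "lin X Y f \<Longrightarrow> x \<in> carr X \<Longrightarrow> f (scal X c x) = scal Y c (f x)"
  by (auto simp: lin_def)

lemma lin_zero: "vspace X \<Longrightarrow> vspace Y \<Longrightarrow> lin X Y f \<Longrightarrow> f 0 = 0"
  using lin_sum_list[of X Y f "[]"] by simp

lemma lin_diff: "vspace X \<Longrightarrow> lin X Y f \<Longrightarrow> x \<in> carr X \<Longrightarrow> y \<in> carr X \<Longrightarrow> f (x - y) = f x - f y"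
  using lin_add[of X Y f "x - y" y] by (simp add: vspace_diff)

lemma linI:
  assumes "\<And>x. x \<in> carr X \<Longrightarrow> f x \<in> carr Y"
    "\<And>x y. x \<in> carr X \<Longrightarrow> y \<in> carr X \<Longrightarrow> f (x + y) = f x + f y"
    "\<And>c x. x \<in> carr X \<Longrightarrow> f (scal X c x) = scal Y c (f x)"
  shows "lin X Y f"
  using assms by (auto simp: lin_def)

lemma lin_comp: "lin Y Z g \<Longrightarrow> lin X Y f \<Longrightarrow> lin X Z (\<lambda>x. g (f x))"
  by (rule linI) (simp_all add: lin_in[of X Y f] lin_in[of Y Z g] lin_add lin_scale)

lemma lin_cong: "vspace X \<Longrightarrow> (\<And>x. x \<in> carr X \<Longrightarrow> f x = g x) \<Longrightarrow> lin X Y f \<longleftrightarrow> lin X Y g"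
  by (auto simp: lin_def vspace_add vspace_scale image_subset_iff)

lemma lin_scaled_vector: "vspace Y \<Longrightarrow> lin X scalars f \<Longrightarrow> y \<in> carr Y \<Longrightarrow> lin X Y (\<lambda>x. scal Y (f x) y)"
  by (rule linI)
    (simp_all add: vspace_scale lin_add lin_scale module.scale_left_distrib[OF vspace_module]
      module.scale_scale[OF vspace_module])

lemma lin_scaled_map: "vspace Y \<Longrightarrow> lin X Y f \<Longrightarrow> lin X Y (\<lambda>x. scal Y c (f x))"
  by (rule linI)
    (simp_all add: vspace_scale lin_in[of X Y f] lin_add lin_scale module.scale_right_distrib[OF vspace_module]
      module.scale_scale[OF vspace_module] mult.commute)

lemma bilinI:
  assumes "\<And>y. y \<in> carr Y \<Longrightarrow> lin X Z (\<lambda>x. B x y)" "\<And>x. x \<in> carr X \<Longrightarrow> lin Y Z (\<lambda>y. B x y)"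
  shows "bilin X Y Z B"
  using assms by (simp add: bilin_def)

lemma bilinD1: "bilin X Y Z B \<Longrightarrow> y \<in> carr Y \<Longrightarrow> lin X Z (\<lambda>x. B x y)"
  by (simp add: bilin_def)

lemma bilinD2: "bilin X Y Z B \<Longrightarrow> x \<in> carr X \<Longrightarrow> lin Y Z (\<lambda>y. B x y)"
  by (simp_all add: bilin_def)

text \<open>The rules for the linearity of the maps below have the form \<open>lin W _ (\<lambda>w. F (h w))\<close>, so that the
simplifier proves the linearity of composites from the outermost map inwards.\<close>

lemma lin_pure1 [simp]:
  "vspace X \<Longrightarrow> vspace Y \<Longrightarrow> lin W X h \<Longrightarrow> y \<in> carr Y \<Longrightarrow> lin W (X \<otimes> Y) (\<lambda>w. pure X Y (h w) y)"
  using lin_comp[OF bilinD1[OF bilin_pure]] by blast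

lemma lin_pure2 [simp]:
  "vspace X \<Longrightarrow> vspace Y \<Longrightarrow> lin W Y h \<Longrightarrow> x \<in> carr X \<Longrightarrow> lin W (X \<otimes> Y) (\<lambda>w. pure X Y x (h w))"
  using lin_comp[OF bilinD2[OF bilin_pure]] by blast

lemma pure_zero1: "vspace X \<Longrightarrow> vspace Y \<Longrightarrow> y \<in> carr Y \<Longrightarrow> pure X Y 0 y = 0"
  using lin_zero[OF _ _ bilinD1[OF bilin_pure, of X Y y]] by simp

lemma pure_zero2: "vspace X \<Longrightarrow> vspace Y \<Longrightarrow> x \<in> carr X \<Longrightarrow> pure X Y x 0 = 0"
  using lin_zero[OF _ _ bilinD2[OF bilin_pure, of X Y x]] by simp

lemma tensor_ext:
  assumes "vspace X" "vspace Y" "vspace Z" "lin (X \<otimes> Y) Z f" "lin (X \<otimes> Y) Z g"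
    "\<And>x y. x \<in> carr X \<Longrightarrow> y \<in> carr Y \<Longrightarrow> f (pure X Y x y) = g (pure X Y x y)"
  shows "\<forall>t\<in>carr (X \<otimes> Y). f t = g t"
  using lin_tensor_unique[OF assms] by blast

lemma tensor_ext3:
  assumes v: "vspace X" "vspace Y" "vspace Z" "vspace W"
    and f: "lin (X \<otimes> Y \<otimes> Z) W f" and g: "lin (X \<otimes> Y \<otimes> Z) W g"
    and eq: "\<And>x y z. x \<in> carr X \<Longrightarrow> y \<in> carr Y \<Longrightarrow> z \<in> carr Z
      \<Longrightarrow> f (pure (X \<otimes> Y) Z (pure X Y x y) z) = g (pure (X \<otimes> Y) Z (pure X Y x y) z)"
  shows "\<forall>t\<in>carr (X \<otimes> Y \<otimes> Z). f t = g t"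
proof (rule tensor_ext[OF _ v(3,4) f g])
  fix s z assume s: "s \<in> carr (X \<otimes> Y)" and z: "z \<in> carr Z"
  have "\<forall>s\<in>carr (X \<otimes> Y). f (pure (X \<otimes> Y) Z s z) = g (pure (X \<otimes> Y) Z s z)"
    by (rule tensor_ext[OF v(1,2,4)]) (use v z eq in \<open>simp_all add: lin_comp[OF f] lin_comp[OF g]\<close>)
  then show "f (pure (X \<otimes> Y) Z s z) = g (pure (X \<otimes> Y) Z s z)" using s by blast
qed simp

text \<open>A form \<open>B w\<close> that depends linearly on a parameter \<open>w\<close> induces a map on \<open>X \<otimes> Y\<close> that depends
  linearly on \<open>w\<close>; used where one
  argument of a bilinear construction is a fixed tensor and the other one varies.\<close>

lemma lin_tlift_param:
  assumes v: "vspace X" "vspace Y" "vspace Z" "vspace W" and t: "t \<in> carr (X \<otimes> Y)"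
    and B: "\<And>w. w \<in> carr W \<Longrightarrow> bilin X Y Z (B w)"
    and l: "\<And>x y. x \<in> carr X \<Longrightarrow> y \<in> carr Y \<Longrightarrow> lin W Z (\<lambda>w. B w x y)"
  shows "lin W Z (\<lambda>w. tlift X Y (B w) t)"
proof (rule linI)
  note L = lin_tlift[OF v(1-3) B]
  fix w assume w: "w \<in> carr W"
  show "tlift X Y (B w) t \<in> carr Z" using L[OF w] t by (rule lin_in)
  fix c
  have "\<forall>t\<in>carr (X \<otimes> Y). tlift X Y (B (scal W c w)) t = scal Z c (tlift X Y (B w) t)"
    by (rule tensor_ext[OF v(1-3) _ lin_scaled_map])
      (use v w L B in \<open>simp_all add: vspace_scale tlift_pure[OF v(1-3) B] lin_scale[OF l]\<close>)
  then show "tlift X Y (B (scal W c w)) t = scal Z c (tlift X Y (B w) t)" using t by blast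
next
  note L = lin_tlift[OF v(1-3) B]
  fix w w' assume w: "w \<in> carr W" "w' \<in> carr W"
  have s: "lin (X \<otimes> Y) Z (\<lambda>t. tlift X Y (B w) t + tlift X Y (B w') t)"
    by (rule linI) (use v w L in \<open>simp_all add: vspace_add lin_in[OF L] lin_add[OF L] lin_scale[OF L]
        module.scale_right_distrib[OF vspace_module]\<close>)
  have "\<forall>t\<in>carr (X \<otimes> Y). tlift X Y (B (w + w')) t = tlift X Y (B w) t + tlift X Y (B w') t"
    by (rule tensor_ext[OF v(1-3) _ s])
      (use v w L B in \<open>simp_all add: vspace_add tlift_pure[OF v(1-3) B] lin_add[OF l]\<close>)
  then show "tlift X Y (B (w + w')) t = tlift X Y (B w) t + tlift X Y (B w') t" using t by blast
qed

text \<open>The tensor \<open>x \<otimes> y\<close> depends on \<open>X\<close> and \<open>Y\<close> only through their scalar multiplications; so the tensor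
  product of subspaces is literally a subspace.\<close>

lemma pure_cong_scal: "scal X = scal X' \<Longrightarrow> scal Y = scal Y' \<Longrightarrow> pure X Y = pure X' Y'"
  by (intro ext) (simp add: pure_def ambient_def)

lemma tensor_mono:
  fixes X X' :: "('k::field, 'v::ab_group_add) vs" and Y Y' :: "('k, 'w::ab_group_add) vs"
  assumes "scal X = scal X'" "scal Y = scal Y'" and "carr X \<subseteq> carr X'" "carr Y \<subseteq> carr Y'"
  shows "carr (X \<otimes> Y) \<subseteq> carr (X' \<otimes> Y')"
proof -
  interpret F: vector_space "\<lambda>(c::'k) \<phi> (B::'v \<Rightarrow> 'w \<Rightarrow> 'k). c * \<phi> B" by (rule vector_space_fun)
  have "{pure X Y x y | x y. x \<in> carr X \<and> y \<in> carr Y} \<subseteq> {pure X' Y' x y | x y. x \<in> carr X' \<and> y \<in> carr Y'}"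
    using assms by (auto simp: pure_cong_scal[OF assms(1,2)])
  from F.span_mono[OF this] show ?thesis by (simp add: tensor_def fspace_def)
qed

section \<open>The structural maps of tensor products\<close>

lemma bilin_tmap:
  "vspace X2 \<Longrightarrow> vspace Y2 \<Longrightarrow> lin X X2 f \<Longrightarrow> lin Y Y2 g
    \<Longrightarrow> bilin X Y (X2 \<otimes> Y2) (\<lambda>x y. pure X2 Y2 (f x) (g y))"
  by (rule bilinI) (simp_all add: lin_in[of X X2 f] lin_in[of Y Y2 g])

lemma tmap_pure [simp]:
  "vspace X \<Longrightarrow> vspace Y \<Longrightarrow> vspace X2 \<Longrightarrow> vspace Y2 \<Longrightarrow> lin X X2 f \<Longrightarrow> lin Y Y2 g
    \<Longrightarrow> x \<in> carr X \<Longrightarrow> y \<in> carr Y \<Longrightarrow> tmap X Y X2 Y2 f g (pure X Y x y) = pure X2 Y2 (f x) (g y)"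
  by (simp add: tmap_def tlift_pure[OF _ _ _ bilin_tmap])

lemma lin_tmap [simp]:
  "vspace X \<Longrightarrow> vspace Y \<Longrightarrow> vspace X2 \<Longrightarrow> vspace Y2 \<Longrightarrow> lin X X2 f \<Longrightarrow> lin Y Y2 g
    \<Longrightarrow> lin W (X \<otimes> Y) h \<Longrightarrow> lin W (X2 \<otimes> Y2) (\<lambda>w. tmap X Y X2 Y2 f g (h w))"
  unfolding tmap_def by (rule lin_comp[OF lin_tlift]) (simp_all add: bilin_tmap)

lemma tmap_in [simp]:
  "vspace X \<Longrightarrow> vspace Y \<Longrightarrow> vspace X2 \<Longrightarrow> vspace Y2 \<Longrightarrow> lin X X2 f \<Longrightarrow> lin Y Y2 g
    \<Longrightarrow> t \<in> carr (X \<otimes> Y) \<Longrightarrow> tmap X Y X2 Y2 f g t \<in> carr (X2 \<otimes> Y2)"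
  by (rule lin_in[OF lin_tmap[OF _ _ _ _ _ _ lin_id]])

text \<open>For a functional \<open>\<beta>\<close> on \<open>Y\<close>, not only for a counit, \<open>id_counit X Y \<beta>\<close> is the slice map \<open>id \<otimes> \<beta>\<close>, and
\<open>counit_id\<close> is the slice map \<open>\<alpha> \<otimes> id\<close>.\<close>

lemma lin_id_counit [simp]:
  assumes "vspace X" "vspace Y" "lin Y scalars \<beta>" "lin W (X \<otimes> Y) h"
  shows "lin W X (\<lambda>w. id_counit X Y \<beta> (h w))"
  unfolding id_counit_def using assms
  by (intro lin_comp[OF lin_tlift _]) (auto intro!: bilinI simp: lin_scaled_vector lin_scaled_map)

lemma id_counit_pure [simp]:
  "vspace X \<Longrightarrow> vspace Y \<Longrightarrow> lin Y scalars \<beta> \<Longrightarrow> x \<in> carr X \<Longrightarrow> y \<in> carr Y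
    \<Longrightarrow> id_counit X Y \<beta> (pure X Y x y) = scal X (\<beta> y) x"
  unfolding id_counit_def
  by (rule tlift_pure) (auto intro!: bilinI simp: lin_scaled_vector lin_scaled_map)

lemma id_counit_in [simp]:
  "vspace X \<Longrightarrow> vspace Y \<Longrightarrow> lin Y scalars \<beta> \<Longrightarrow> t \<in> carr (X \<otimes> Y) \<Longrightarrow> id_counit X Y \<beta> t \<in> carr X"
  by (rule lin_in[OF lin_id_counit[OF _ _ _ lin_id]])

lemma lin_counit_id [simp]:
  assumes "vspace X" "vspace Y" "lin X scalars \<alpha>" "lin W (X \<otimes> Y) h"
  shows "lin W Y (\<lambda>w. counit_id X Y \<alpha> (h w))"
  unfolding counit_id_def using assms
  by (intro lin_comp[OF lin_tlift _]) (auto intro!: bilinI simp: lin_scaled_vector lin_scaled_map)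

lemma counit_id_pure [simp]:
  "vspace X \<Longrightarrow> vspace Y \<Longrightarrow> lin X scalars \<alpha> \<Longrightarrow> x \<in> carr X \<Longrightarrow> y \<in> carr Y
    \<Longrightarrow> counit_id X Y \<alpha> (pure X Y x y) = scal Y (\<alpha> x) y"
  unfolding counit_id_def
  by (rule tlift_pure) (auto intro!: bilinI simp: lin_scaled_vector lin_scaled_map)

lemma counit_id_in [simp]:
  "vspace X \<Longrightarrow> vspace Y \<Longrightarrow> lin X scalars \<alpha> \<Longrightarrow> t \<in> carr (X \<otimes> Y) \<Longrightarrow> counit_id X Y \<alpha> t \<in> carr Y"
  by (rule lin_in[OF lin_counit_id[OF _ _ _ lin_id]])

lemma lin_id_counit_param:
  assumes "vspace X" "vspace Y" "vspace W" "z \<in> carr (X \<otimes> Y)"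
    "\<And>w. w \<in> carr W \<Longrightarrow> lin Y scalars (\<beta> w)" "\<And>y. y \<in> carr Y \<Longrightarrow> lin W scalars (\<lambda>w. \<beta> w y)"
  shows "lin W X (\<lambda>w. id_counit X Y (\<beta> w) z)"
  unfolding id_counit_def
  by (rule lin_tlift_param) (use assms in \<open>simp_all add: lin_scaled_vector lin_scaled_map bilinI\<close>)

lemma lin_counit_id_param:
  assumes "vspace X" "vspace Y" "vspace W" "z \<in> carr (X \<otimes> Y)"
    "\<And>w. w \<in> carr W \<Longrightarrow> lin X scalars (\<alpha> w)" "\<And>x. x \<in> carr X \<Longrightarrow> lin W scalars (\<lambda>w. \<alpha> w x)"
  shows "lin W Y (\<lambda>w. counit_id X Y (\<alpha> w) z)"
  unfolding counit_id_def
  by (rule lin_tlift_param) (use assms in \<open>simp_all add: lin_scaled_vector lin_scaled_map bilinI\<close>)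

lemma id_counit_tmap:
  assumes "vspace X" "vspace Y" "vspace X2" "vspace Y2" "lin X X2 f" "lin Y Y2 g" "lin Y2 scalars \<beta>"
    and t: "t \<in> carr (X \<otimes> Y)"
  shows "id_counit X2 Y2 \<beta> (tmap X Y X2 Y2 f g t) = f (id_counit X Y (\<lambda>y. \<beta> (g y)) t)"
proof -
  note [simp] = lin_in[OF assms(5)] lin_in[OF assms(6)] lin_comp[OF assms(7,6)] lin_comp[OF assms(5)]
  have "\<forall>t\<in>carr (X \<otimes> Y). id_counit X2 Y2 \<beta> (tmap X Y X2 Y2 f g t) = f (id_counit X Y (\<lambda>y. \<beta> (g y)) t)"
    by (rule tensor_ext[of _ _ X2]) (use assms in \<open>simp_all add: lin_scale[OF assms(5)]\<close>)
  then show ?thesis using t by blast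
qed

lemma counit_id_tmap:
  assumes "vspace X" "vspace Y" "vspace X2" "vspace Y2" "lin X X2 f" "lin Y Y2 g" "lin X2 scalars \<alpha>"
    and t: "t \<in> carr (X \<otimes> Y)"
  shows "counit_id X2 Y2 \<alpha> (tmap X Y X2 Y2 f g t) = g (counit_id X Y (\<lambda>x. \<alpha> (f x)) t)"
proof -
  note [simp] = lin_in[OF assms(5)] lin_in[OF assms(6)] lin_comp[OF assms(7,5)] lin_comp[OF assms(6)]
  have "\<forall>t\<in>carr (X \<otimes> Y). counit_id X2 Y2 \<alpha> (tmap X Y X2 Y2 f g t) = g (counit_id X Y (\<lambda>x. \<alpha> (f x)) t)"
    by (rule tensor_ext[of _ _ Y2]) (use assms in \<open>simp_all add: lin_scale[OF assms(6)]\<close>)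
  then show ?thesis using t by blast
qed

lemma id_counit_cong:
  assumes "vspace X" "vspace Y" "lin Y scalars \<beta>" "\<And>y. y \<in> carr Y \<Longrightarrow> \<beta> y = \<beta>' y" and t: "t \<in> carr (X \<otimes> Y)"
  shows "id_counit X Y \<beta> t = id_counit X Y \<beta>' t"
proof -
  have "lin Y scalars \<beta>'" using assms(2,3,4) lin_cong[of Y \<beta> \<beta>'] by simp
  then have "\<forall>t\<in>carr (X \<otimes> Y). id_counit X Y \<beta> t = id_counit X Y \<beta>' t"
    by (intro tensor_ext[of _ _ X]) (use assms in simp_all)
  then show ?thesis using t by blast
qed

lemma counit_id_cong:
  assumes "vspace X" "vspace Y" "lin X scalars \<alpha>" "\<And>x. x \<in> carr X \<Longrightarrow> \<alpha> x = \<alpha>' x" and t: "t \<in> carr (X \<otimes> Y)"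
  shows "counit_id X Y \<alpha> t = counit_id X Y \<alpha>' t"
proof -
  have "lin X scalars \<alpha>'" using assms(1,3,4) lin_cong[of X \<alpha> \<alpha>'] by simp
  then have "\<forall>t\<in>carr (X \<otimes> Y). counit_id X Y \<alpha> t = counit_id X Y \<alpha>' t"
    by (intro tensor_ext[of _ _ Y]) (use assms in simp_all)
  then show ?thesis using t by blast
qed

context
  fixes X :: "('k::field, 'u::ab_group_add) vs" and Y :: "('k, 'v::ab_group_add) vs"
    and Z :: "('k, 'w::ab_group_add) vs"
  assumes v [simp]: "vspace X" "vspace Y" "vspace Z"
begin

lemma bilin_assoc:
  "bilin (X \<otimes> Y) Z (X \<otimes> (Y \<otimes> Z)) (\<lambda>t z. tlift X Y (\<lambda>x y. pure X (Y \<otimes> Z) x (pure Y Z y z)) t)"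
proof (rule bilinI)
  fix z assume "z \<in> carr Z"
  then show "lin (X \<otimes> Y) (X \<otimes> (Y \<otimes> Z)) (tlift X Y (\<lambda>x y. pure X (Y \<otimes> Z) x (pure Y Z y z)))"
    by (intro lin_tlift bilinI) simp_all
next
  fix t assume "t \<in> carr (X \<otimes> Y)"
  then show "lin Z (X \<otimes> (Y \<otimes> Z)) (\<lambda>z. tlift X Y (\<lambda>x y. pure X (Y \<otimes> Z) x (pure Y Z y z)) t)"
    by (intro lin_tlift_param bilinI) simp_all
qed

lemma bilin_assoc_inv:
  "bilin X (Y \<otimes> Z) (X \<otimes> Y \<otimes> Z) (\<lambda>x t. tlift Y Z (\<lambda>y z. pure (X \<otimes> Y) Z (pure X Y x y) z) t)"
proof (rule bilinI)
  fix x assume "x \<in> carr X"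
  then show "lin (Y \<otimes> Z) (X \<otimes> Y \<otimes> Z) (tlift Y Z (\<lambda>y z. pure (X \<otimes> Y) Z (pure X Y x y) z))"
    by (intro lin_tlift bilinI) simp_all
next
  fix t assume "t \<in> carr (Y \<otimes> Z)"
  then show "lin X (X \<otimes> Y \<otimes> Z) (\<lambda>x. tlift Y Z (\<lambda>y z. pure (X \<otimes> Y) Z (pure X Y x y) z) t)"
    by (intro lin_tlift_param bilinI) simp_all
qed

lemma assoc_pure [simp]:
  assumes "x \<in> carr X" "y \<in> carr Y" "z \<in> carr Z"
  shows "assoc X Y Z (pure (X \<otimes> Y) Z (pure X Y x y) z) = pure X (Y \<otimes> Z) x (pure Y Z y z)"
proof -
  have "bilin X Y (X \<otimes> (Y \<otimes> Z)) (\<lambda>x y. pure X (Y \<otimes> Z) x (pure Y Z y z))"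
    using assms by (intro bilinI) simp_all
  then show ?thesis unfolding assoc_def using assms
    by (simp add: tlift_pure[OF _ _ _ bilin_assoc] tlift_pure[where Z = "X \<otimes> (Y \<otimes> Z)"])
qed

lemma lin_assoc [simp]: "lin W (X \<otimes> Y \<otimes> Z) h \<Longrightarrow> lin W (X \<otimes> (Y \<otimes> Z)) (\<lambda>w. assoc X Y Z (h w))"
  unfolding assoc_def by (rule lin_comp[OF lin_tlift]) (simp_all add: bilin_assoc)

lemma assoc_inv_pure [simp]:
  assumes "x \<in> carr X" "y \<in> carr Y" "z \<in> carr Z"
  shows "assoc_inv X Y Z (pure X (Y \<otimes> Z) x (pure Y Z y z)) = pure (X \<otimes> Y) Z (pure X Y x y) z"
proof -
  have "bilin Y Z (X \<otimes> Y \<otimes> Z) (\<lambda>y z. pure (X \<otimes> Y) Z (pure X Y x y) z)"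
    using assms by (intro bilinI) simp_all
  then show ?thesis unfolding assoc_inv_def using assms
    by (simp add: tlift_pure[OF _ _ _ bilin_assoc_inv] tlift_pure[where Z = "X \<otimes> Y \<otimes> Z"])
qed

lemma lin_assoc_inv [simp]:
  "lin W (X \<otimes> (Y \<otimes> Z)) h \<Longrightarrow> lin W (X \<otimes> Y \<otimes> Z) (\<lambda>w. assoc_inv X Y Z (h w))"
  unfolding assoc_inv_def by (rule lin_comp[OF lin_tlift]) (simp_all add: bilin_assoc_inv)

lemma assoc_in [simp]: "t \<in> carr (X \<otimes> Y \<otimes> Z) \<Longrightarrow> assoc X Y Z t \<in> carr (X \<otimes> (Y \<otimes> Z))"
  by (rule lin_in[OF lin_assoc[OF lin_id]])

lemma assoc_inv_in [simp]: "t \<in> carr (X \<otimes> (Y \<otimes> Z)) \<Longrightarrow> assoc_inv X Y Z t \<in> carr (X \<otimes> Y \<otimes> Z)"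
  by (rule lin_in[OF lin_assoc_inv[OF lin_id]])

lemma assoc_inv_assoc [simp]:
  assumes "t \<in> carr (X \<otimes> Y \<otimes> Z)"
  shows "assoc_inv X Y Z (assoc X Y Z t) = t"
proof -
  have "\<forall>t\<in>carr (X \<otimes> Y \<otimes> Z). assoc_inv X Y Z (assoc X Y Z t) = t"
    by (rule tensor_ext3[of _ _ _ "X \<otimes> Y \<otimes> Z"]) simp_all
  then show ?thesis using assms by blast
qed

lemma assoc_assoc_inv [simp]:
  assumes "t \<in> carr (X \<otimes> (Y \<otimes> Z))"
  shows "assoc X Y Z (assoc_inv X Y Z t) = t"
proof -
  have "assoc X Y Z (assoc_inv X Y Z (pure X (Y \<otimes> Z) x s)) = pure X (Y \<otimes> Z) x s"
    if x: "x \<in> carr X" and s: "s \<in> carr (Y \<otimes> Z)" for x s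
  proof -
    have "\<forall>s\<in>carr (Y \<otimes> Z). assoc X Y Z (assoc_inv X Y Z (pure X (Y \<otimes> Z) x s)) = pure X (Y \<otimes> Z) x s"
      by (rule tensor_ext[of _ _ "X \<otimes> (Y \<otimes> Z)"]) (use x in simp_all)
    then show ?thesis using s by blast
  qed
  then have "\<forall>t\<in>carr (X \<otimes> (Y \<otimes> Z)). assoc X Y Z (assoc_inv X Y Z t) = t"
    by (intro tensor_ext[of _ _ "X \<otimes> (Y \<otimes> Z)"]) simp_all
  then show ?thesis using assms by blast
qed

end

lemma tensor_ext3_assoc_inv:
  assumes v: "vspace X" "vspace Y" "vspace Z" "vspace W"
    and f: "lin (X \<otimes> Y \<otimes> Z) W f" and g: "lin (X \<otimes> Y \<otimes> Z) W g"
    and eq: "\<And>x s. x \<in> carr X \<Longrightarrow> s \<in> carr (Y \<otimes> Z)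
      \<Longrightarrow> f (assoc_inv X Y Z (pure X (Y \<otimes> Z) x s)) = g (assoc_inv X Y Z (pure X (Y \<otimes> Z) x s))"
  shows "\<forall>t\<in>carr (X \<otimes> Y \<otimes> Z). f t = g t"
proof (rule tensor_ext3[OF v f g])
  fix x y z assume xyz: "x \<in> carr X" "y \<in> carr Y" "z \<in> carr Z"
  show "f (pure (X \<otimes> Y) Z (pure X Y x y) z) = g (pure (X \<otimes> Y) Z (pure X Y x y) z)"
    unfolding assoc_inv_pure[OF v(1-3) xyz, symmetric] using xyz by (intro eq pure_in_tensor)
qed

lemma assoc_cancel:
  assumes "vspace X" "vspace Y" "vspace Z" "s \<in> carr (X \<otimes> Y \<otimes> Z)" "t \<in> carr (X \<otimes> Y \<otimes> Z)"
    "assoc X Y Z s = assoc X Y Z t"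
  shows "s = t"
  using assoc_inv_assoc[OF assms(1-3,4)] assoc_inv_assoc[OF assms(1-3,5)] unfolding assms(6) by (rule trans[OF sym])

lemma br12_pure [simp]:
  "vspace X \<Longrightarrow> vspace Y \<Longrightarrow> vspace Z \<Longrightarrow> lin (X \<otimes> Y) (Y \<otimes> X) \<Psi> \<Longrightarrow> t \<in> carr (X \<otimes> Y) \<Longrightarrow> z \<in> carr Z
    \<Longrightarrow> br12 X Y Z \<Psi> (pure (X \<otimes> Y) Z t z) = pure (Y \<otimes> X) Z (\<Psi> t) z"
  by (simp add: br12_def)

lemma lin_br12 [simp]:
  "vspace X \<Longrightarrow> vspace Y \<Longrightarrow> vspace Z \<Longrightarrow> lin (X \<otimes> Y) (Y \<otimes> X) \<Psi> \<Longrightarrow> lin W (X \<otimes> Y \<otimes> Z) h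
    \<Longrightarrow> lin W (Y \<otimes> X \<otimes> Z) (\<lambda>w. br12 X Y Z \<Psi> (h w))"
  by (simp add: br12_def)

lemma br12_in [simp]:
  "vspace X \<Longrightarrow> vspace Y \<Longrightarrow> vspace Z \<Longrightarrow> lin (X \<otimes> Y) (Y \<otimes> X) \<Psi> \<Longrightarrow> t \<in> carr (X \<otimes> Y \<otimes> Z)
    \<Longrightarrow> br12 X Y Z \<Psi> t \<in> carr (Y \<otimes> X \<otimes> Z)"
  by (rule lin_in[OF lin_br12[OF _ _ _ _ lin_id]])

lemma br23_pure [simp]:
  "vspace X \<Longrightarrow> vspace Y \<Longrightarrow> vspace Z \<Longrightarrow> lin (Y \<otimes> Z) (Z \<otimes> Y) \<Psi>
    \<Longrightarrow> x \<in> carr X \<Longrightarrow> y \<in> carr Y \<Longrightarrow> z \<in> carr Z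
    \<Longrightarrow> br23 X Y Z \<Psi> (pure (X \<otimes> Y) Z (pure X Y x y) z)
      = assoc_inv X Z Y (pure X (Z \<otimes> Y) x (\<Psi> (pure Y Z y z)))"
  by (simp add: br23_def)

lemma br23_assoc_inv [simp]:
  "vspace X \<Longrightarrow> vspace Y \<Longrightarrow> vspace Z \<Longrightarrow> lin (Y \<otimes> Z) (Z \<otimes> Y) \<Psi> \<Longrightarrow> x \<in> carr X \<Longrightarrow> t \<in> carr (Y \<otimes> Z)
    \<Longrightarrow> br23 X Y Z \<Psi> (assoc_inv X Y Z (pure X (Y \<otimes> Z) x t)) = assoc_inv X Z Y (pure X (Z \<otimes> Y) x (\<Psi> t))"
  by (simp add: br23_def)

lemma lin_br23 [simp]:
  "vspace X \<Longrightarrow> vspace Y \<Longrightarrow> vspace Z \<Longrightarrow> lin (Y \<otimes> Z) (Z \<otimes> Y) \<Psi> \<Longrightarrow> lin W (X \<otimes> Y \<otimes> Z) h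
    \<Longrightarrow> lin W (X \<otimes> Z \<otimes> Y) (\<lambda>w. br23 X Y Z \<Psi> (h w))"
  by (simp add: br23_def)

lemma br23_in [simp]:
  "vspace X \<Longrightarrow> vspace Y \<Longrightarrow> vspace Z \<Longrightarrow> lin (Y \<otimes> Z) (Z \<otimes> Y) \<Psi> \<Longrightarrow> t \<in> carr (X \<otimes> Y \<otimes> Z)
    \<Longrightarrow> br23 X Y Z \<Psi> t \<in> carr (X \<otimes> Z \<otimes> Y)"
  by (rule lin_in[OF lin_br23[OF _ _ _ _ lin_id]])

lemma assoc_br23:
  "vspace X \<Longrightarrow> vspace Y \<Longrightarrow> vspace Z \<Longrightarrow> lin (Y \<otimes> Z) (Z \<otimes> Y) \<Psi> \<Longrightarrow> t \<in> carr (X \<otimes> Y \<otimes> Z)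
    \<Longrightarrow> assoc X Z Y (br23 X Y Z \<Psi> t) = tmap X (Y \<otimes> Z) X (Z \<otimes> Y) (\<lambda>x. x) \<Psi> (assoc X Y Z t)"
  by (simp add: br23_def)

lemma br12_inverse:
  assumes "vspace X" "vspace Y" "vspace Z" "lin (X \<otimes> Y) (Y \<otimes> X) \<Psi>" "lin (Y \<otimes> X) (X \<otimes> Y) \<Phi>"
    "\<And>t. t \<in> carr (X \<otimes> Y) \<Longrightarrow> \<Phi> (\<Psi> t) = t" and t: "t \<in> carr (X \<otimes> Y \<otimes> Z)"
  shows "br12 Y X Z \<Phi> (br12 X Y Z \<Psi> t) = t"
proof -
  have "\<forall>t\<in>carr (X \<otimes> Y \<otimes> Z). br12 Y X Z \<Phi> (br12 X Y Z \<Psi> t) = t"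
    by (rule tensor_ext[of _ _ "X \<otimes> Y \<otimes> Z"]) (use assms in \<open>simp_all add: lin_in[OF assms(4)]\<close>)
  then show ?thesis using t by blast
qed

lemma br23_inverse:
  assumes "vspace X" "vspace Y" "vspace Z" "lin (Y \<otimes> Z) (Z \<otimes> Y) \<Psi>" "lin (Z \<otimes> Y) (Y \<otimes> Z) \<Phi>"
    "\<And>t. t \<in> carr (Y \<otimes> Z) \<Longrightarrow> \<Phi> (\<Psi> t) = t" and t: "t \<in> carr (X \<otimes> Y \<otimes> Z)"
  shows "br23 X Z Y \<Phi> (br23 X Y Z \<Psi> t) = t"
proof -
  have "\<forall>t\<in>carr (X \<otimes> Y \<otimes> Z). br23 X Z Y \<Phi> (br23 X Y Z \<Psi> t) = t"
    by (rule tensor_ext3[of _ _ _ "X \<otimes> Y \<otimes> Z"]) (use assms in \<open>simp_all add: lin_in[OF assms(4)]\<close>)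
  then show ?thesis using t by blast
qed

section \<open>Tensors are determined by functionals\<close>

text \<open>A summand whose left factor \<open>x\<close> depends linearly on the other left factors can be distributed over
the other summands without increasing their number. The induction removes from \<open>x\<close> the contribution
of one left factor at a time.\<close>

lemma absorb_in_sum_of_pures:
  fixes X :: "('k::field, 'v::ab_group_add) vs" and Y :: "('k, 'w::ab_group_add) vs"
  assumes v: "vspace X" "vspace Y"
    and "set ps \<subseteq> carr X \<times> carr Y" "x \<in> module.span (scal X) (fst ` set ps)" "x \<in> carr X" "y \<in> carr Y"
  shows "\<exists>qs. set qs \<subseteq> carr X \<times> carr Y \<and> length qs = length ps
    \<and> pure X Y x y + (\<Sum>(x, y)\<leftarrow>ps. pure X Y x y) = (\<Sum>(x, y)\<leftarrow>qs. pure X Y x y)"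
  using assms(3-)
proof (induction ps arbitrary: x)
  case Nil
  interpret MX: vector_space "scal X" using v by (simp add: vspace_def)
  have "x = 0" using Nil by simp
  then have "pure X Y x y = 0" using pure_zero1[OF v Nil(4)] by (simp only:)
  then have "pure X Y x y + (\<Sum>(x, y)\<leftarrow>[]. pure X Y x y) = (\<Sum>(x, y)\<leftarrow>[]. pure X Y x y)"
    by (simp only: list.map sum_list.Nil add_0)
  then show ?case by (intro exI[of _ "[]"] conjI) simp_all
next
  case (Cons p ps)
  interpret MX: vector_space "scal X" using v by (simp add: vspace_def)
  obtain x0 y0 where p: "p = (x0, y0)" by (cases p)
  have in0: "x0 \<in> carr X" "y0 \<in> carr Y" and ps: "set ps \<subseteq> carr X \<times> carr Y" using Cons.prems p by auto
  obtain c where c: "x - scal X c x0 \<in> MX.span (fst ` set ps)"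
    using Cons.prems p MX.span_breakdown_eq[of x x0 "fst ` set ps"] by auto
  define x' where "x' = x - scal X c x0"
  have x': "x' \<in> carr X" "x = x' + scal X c x0"
    using in0 Cons.prems v by (simp_all add: x'_def vspace_diff vspace_scale)
  \<comment> \<open>\<open>x \<otimes> y + x0 \<otimes> y0 = x' \<otimes> y + x0 \<otimes> (c y + y0)\<close>, and \<open>x'\<close> needs one left factor less than \<open>x\<close>.\<close>
  obtain qs where qs: "set qs \<subseteq> carr X \<times> carr Y" "length qs = length ps"
    "pure X Y x' y + (\<Sum>(x, y)\<leftarrow>ps. pure X Y x y) = (\<Sum>(x, y)\<leftarrow>qs. pure X Y x y)"
    using Cons.IH[OF ps c[folded x'_def] x'(1)] Cons.prems by blast
  note b = bilin_pure[OF v]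
  have "pure X Y x y + pure X Y x0 y0 = pure X Y x' y + pure X Y x0 (scal Y c y + y0)"
    unfolding x'(2) using x'(1) in0 Cons.prems(4) v
    by (simp add: lin_add[OF bilinD1[OF b]] lin_add[OF bilinD2[OF b]] lin_scale[OF bilinD1[OF b]]
        lin_scale[OF bilinD2[OF b]] vspace_scale algebra_simps)
  then have "pure X Y x y + (pure X Y x0 y0 + (\<Sum>(x, y)\<leftarrow>ps. pure X Y x y))
      = pure X Y x0 (scal Y c y + y0) + (\<Sum>(x, y)\<leftarrow>qs. pure X Y x y)"
    by (simp only: qs(3)[symmetric] add.assoc[symmetric] add.commute[of "pure X Y x0 (scal Y c y + y0)"])
  then have "pure X Y x y + (\<Sum>(x, y)\<leftarrow>p # ps. pure X Y x y)
      = (\<Sum>(x, y)\<leftarrow>(x0, scal Y c y + y0) # qs. pure X Y x y)"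
    by (simp only: p list.map sum_list.Cons prod.case)
  then show ?case using qs(1,2) in0 v Cons.prems(4)
    by (intro exI[of _ "(x0, scal Y c y + y0) # qs"] conjI) (simp_all only: list.set length_Cons,
      auto simp: vspace_add vspace_scale)
qed

lemma ex_functional_vanishing_on:
  fixes X :: "('k::field, 'v::ab_group_add) vs"
  assumes X: "vspace X" and x: "x \<notin> module.span (scal X) S"
  shows "\<exists>\<phi>. lin X scalars \<phi> \<and> \<phi> x = 1 \<and> (\<forall>s\<in>S. \<phi> s = 0)"
proof -
  interpret vector_space_pair "scal X" "(*) :: 'k \<Rightarrow> 'k \<Rightarrow> 'k"
    using X vspace_scalars[where 'k = 'k] by (simp add: vspace_def vector_space_pair_def scalars_def)
  obtain B where B: "B \<subseteq> S" "vs1.independent B" "vs1.span B = vs1.span S"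
    using vs1.maximal_independent_subset[of S] vs1.span_mono vs1.span_subspace vs1.subspace_span
    by (metis subset_antisym vs1.span_minimal)
  have "vs1.independent (insert x B)" using B x vs1.independent_insert by auto
  then obtain g where g: "Vector_Spaces.linear (scal X) (*) g" "\<forall>z\<in>insert x B. g z = (if z = x then 1 else 0)"
    using linear_independent_extend[of "insert x B" "\<lambda>z. if z = x then 1 else 0"] by blast
  have xB: "x \<notin> B" using x B(1) vs1.span_base by blast
  have "g s = 0" if "s \<in> S" for s
  proof (rule linear_eq_0_on_span[OF g(1), of B])
    show "g b = 0" if "b \<in> B" for b using g(2) that xB by auto
    show "s \<in> vs1.span B" using that B vs1.span_base by auto
  qed
  moreover have "lin X scalars g"
  proof -
    interpret G: Vector_Spaces.linear "scal X" "(*)" g by (rule g)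
    show ?thesis by (rule linI) (simp_all add: G.add G.scale)
  qed
  ultimately show ?thesis using g(2) by auto
qed

text \<open>In a shortest representation of \<open>t\<close> as a sum of decomposable tensors no summand can be absorbed in
the others. So there is a functional that is \<open>1\<close> on the left factor of one summand and \<open>0\<close> on all other left
factors; slicing with it gives the right factor of that summand, which is therefore \<open>0\<close>.\<close>

lemma tensor_eq_zeroI:
  fixes X :: "('k::field, 'v::ab_group_add) vs" and Y :: "('k, 'w::ab_group_add) vs"
  assumes v: "vspace X" "vspace Y" and t: "t \<in> carr (X \<otimes> Y)"
    and z: "\<And>\<phi>. lin X scalars \<phi> \<Longrightarrow> counit_id X Y \<phi> t = 0"
  shows "t = 0"
proof -
  have "(\<Sum>(x, y)\<leftarrow>ps. pure X Y x y) = 0"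
    if "set ps \<subseteq> carr X \<times> carr Y"
      "\<And>\<phi>. lin X scalars \<phi> \<Longrightarrow> counit_id X Y \<phi> (\<Sum>(x, y)\<leftarrow>ps. pure X Y x y) = 0" for ps
    using that
  proof (induction ps rule: measure_induct_rule[of length])
    case (less ps)
    show ?case
    proof (cases ps)
      case Nil
      then show ?thesis by simp
    next
      case (Cons p qs)
      obtain x y where p: "p = (x, y)" by (cases p)
      have xy: "x \<in> carr X" "y \<in> carr Y" and qs: "set qs \<subseteq> carr X \<times> carr Y"
        using less.prems(1) Cons p by auto
      show ?thesis
      proof (cases "x \<in> module.span (scal X) (fst ` set qs)")
        case True
        obtain rs where rs: "set rs \<subseteq> carr X \<times> carr Y" "length rs = length qs"
          "pure X Y x y + (\<Sum>(x, y)\<leftarrow>qs. pure X Y x y) = (\<Sum>(x, y)\<leftarrow>rs. pure X Y x y)"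
          using absorb_in_sum_of_pures[OF v qs True xy] by blast
        then have eq: "(\<Sum>(x, y)\<leftarrow>ps. pure X Y x y) = (\<Sum>(x, y)\<leftarrow>rs. pure X Y x y)"
          using Cons p by simp
        have "length rs < length ps" using rs(2) Cons by simp
        moreover have "counit_id X Y \<phi> (\<Sum>(x, y)\<leftarrow>rs. pure X Y x y) = 0" if "lin X scalars \<phi>" for \<phi>
          using less.prems(2)[OF that] eq by (rule subst[of _ _ "\<lambda>t. counit_id X Y \<phi> t = 0", rotated])
        ultimately show ?thesis unfolding eq using less.IH rs(1) by blast
      next
        case False
        obtain \<phi> where \<phi>: "lin X scalars \<phi>" "\<phi> x = 1" "\<forall>s\<in>fst ` set qs. \<phi> s = 0"
          using ex_functional_vanishing_on[OF v(1) False] by blast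
        have b: "bilin X Y Y (\<lambda>x y. scal Y (\<phi> x) y)"
          using \<phi> v by (intro bilinI) (simp_all add: lin_scaled_vector lin_scaled_map)
        have one: "scal Y 1 y = y" and zero: "scal Y 0 w = 0" for w
          using v vspace_module[OF v(2)] by (simp_all add: module.scale_one module.scale_zero_left)
        have "(\<Sum>(x, y)\<leftarrow>qs. scal Y (\<phi> x) y) = 0"
          using \<phi>(3) by (induction qs) (auto simp: zero)
        then have "counit_id X Y \<phi> (\<Sum>(x, y)\<leftarrow>ps. pure X Y x y) = y"
          unfolding counit_id_def tlift_sum_list[OF v v(2) b less.prems(1)] using Cons p \<phi>(2) by (simp add: one)
        then have "y = 0" using less.prems(2)[OF \<phi>(1)] by simp
        then have eq: "(\<Sum>(x, y)\<leftarrow>ps. pure X Y x y) = (\<Sum>(x, y)\<leftarrow>qs. pure X Y x y)"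
          using Cons p v xy by (simp add: pure_zero2)
        show ?thesis unfolding eq
          by (rule less.IH) (use qs Cons less.prems(2) eq in auto)
      qed
    qed
  qed
  then show ?thesis using tensor_repr[OF v t] z by blast
qed

lemma functional_slices_commute:
  assumes v: "vspace X" "vspace Y" and l: "lin X scalars \<alpha>" "lin Y scalars \<beta>" and t: "t \<in> carr (X \<otimes> Y)"
  shows "\<beta> (counit_id X Y \<alpha> t) = \<alpha> (id_counit X Y \<beta> t)"
proof -
  have "\<forall>t\<in>carr (X \<otimes> Y). \<beta> (counit_id X Y \<alpha> t) = \<alpha> (id_counit X Y \<beta> t)"
    by (rule tensor_ext[of _ _ scalars])
      (use v l in \<open>simp_all add: lin_comp[OF l(1)] lin_comp[OF l(2)] lin_scale[OF l(1)] lin_scale[OF l(2)]\<close>)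
  then show ?thesis using t by blast
qed

text \<open>On one factor it suffices to test with functionals that separate its points: for every functional
\<open>\<phi>\<close> on \<open>X\<close>, each \<open>\<beta>\<close> in \<open>B\<close> kills \<open>(\<phi> \<otimes> id) t\<close>, because \<open>\<beta> ((\<phi> \<otimes> id) t) = \<phi> ((id \<otimes> \<beta>) t)\<close>.\<close>

lemma tensor_eq_zero_separating:
  fixes X :: "('k::field, 'v::ab_group_add) vs" and Y :: "('k, 'w::ab_group_add) vs"
  assumes v: "vspace X" "vspace Y" and t: "t \<in> carr (X \<otimes> Y)"
    and B: "\<And>\<beta>. \<beta> \<in> B \<Longrightarrow> lin Y scalars \<beta>" "\<And>y. y \<in> carr Y \<Longrightarrow> (\<And>\<beta>. \<beta> \<in> B \<Longrightarrow> \<beta> y = 0) \<Longrightarrow> y = 0"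
    and z: "\<And>\<beta>. \<beta> \<in> B \<Longrightarrow> id_counit X Y \<beta> t = 0"
  shows "t = 0"
proof (rule tensor_eq_zeroI[OF v t])
  fix \<phi> assume \<phi>: "lin X scalars \<phi>"
  show "counit_id X Y \<phi> t = 0"
  proof (rule B(2))
    show "counit_id X Y \<phi> t \<in> carr Y" using lin_in[OF lin_counit_id[OF v \<phi> lin_id] t] .
    fix \<beta> assume \<beta>: "\<beta> \<in> B"
    show "\<beta> (counit_id X Y \<phi> t) = 0"
      using functional_slices_commute[OF v \<phi> B(1)[OF \<beta>] t] z[OF \<beta>] lin_zero[OF v(1) _ \<phi>] by simp
  qed
qed

lemma tensor_eq_right:
  fixes X :: "('k::field, 'v::ab_group_add) vs" and Y :: "('k, 'w::ab_group_add) vs"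
  assumes v: "vspace X" "vspace Y" and st: "s \<in> carr (X \<otimes> Y)" "t \<in> carr (X \<otimes> Y)"
    and B: "\<And>\<beta>. \<beta> \<in> B \<Longrightarrow> lin Y scalars \<beta>" "\<And>y. y \<in> carr Y \<Longrightarrow> (\<And>\<beta>. \<beta> \<in> B \<Longrightarrow> \<beta> y = 0) \<Longrightarrow> y = 0"
    and eq: "\<And>\<beta>. \<beta> \<in> B \<Longrightarrow> id_counit X Y \<beta> s = id_counit X Y \<beta> t"
  shows "s = t"
proof -
  have "s - t = 0"
    by (rule tensor_eq_zero_separating[OF v _ B])
      (use st in \<open>auto simp: vspace_diff lin_diff[OF vspace_tensor lin_id_counit[OF v B(1) lin_id]] eq\<close>)
  then show ?thesis by simp
qed

lemma separating_functional:
  assumes Y: "vspace Y" "y \<in> carr Y" and z: "\<And>\<psi>. lin Y scalars \<psi> \<Longrightarrow> \<psi> y = 0"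
  shows "y = 0"
proof (rule ccontr)
  assume "y \<noteq> 0"
  then obtain \<psi> where "lin (ambient Y) scalars \<psi>" "\<psi> y = 1" using ex_functional[OF Y(1)] by blast
  moreover from this have "lin Y scalars \<psi>" by (auto simp: lin_def ambient_def)
  ultimately show False using z by force
qed

lemma tensor_eq_left:
  fixes X :: "('k::field, 'v::ab_group_add) vs" and Y :: "('k, 'w::ab_group_add) vs"
  assumes v: "vspace X" "vspace Y" and st: "s \<in> carr (X \<otimes> Y)" "t \<in> carr (X \<otimes> Y)"
    and A: "\<And>\<alpha>. \<alpha> \<in> A \<Longrightarrow> lin X scalars \<alpha>" "\<And>x. x \<in> carr X \<Longrightarrow> (\<And>\<alpha>. \<alpha> \<in> A \<Longrightarrow> \<alpha> x = 0) \<Longrightarrow> x = 0"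
    and eq: "\<And>\<alpha>. \<alpha> \<in> A \<Longrightarrow> counit_id X Y \<alpha> s = counit_id X Y \<alpha> t"
  shows "s = t"
proof (rule tensor_eq_right[OF v st, of "{\<beta>. lin Y scalars \<beta>}"])
  fix \<beta> assume "\<beta> \<in> {\<beta>. lin Y scalars \<beta>}"
  then have \<beta>: "lin Y scalars \<beta>" by simp
  note in' = lin_in[OF lin_id_counit[OF v \<beta> lin_id]]
  have "id_counit X Y \<beta> s - id_counit X Y \<beta> t = 0"
    by (rule A(2))
      (use st in \<open>auto simp: v vspace_diff in' lin_diff[OF v(1) A(1)] eq
        functional_slices_commute[OF v A(1) \<beta>, symmetric]\<close>)
  then show "id_counit X Y \<beta> s = id_counit X Y \<beta> t" by simp
qed (use v separating_functional in auto)

section \<open>Duals of tensor products\<close>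

lemma carr_dual: "\<phi> \<in> carr (dual X) \<longleftrightarrow> lin X scalars \<phi> \<and> (\<forall>x. x \<notin> carr X \<longrightarrow> \<phi> x = 0)"
  by (simp add: dual_def fspace_def)

lemma scal_dual [simp]: "scal (dual X) c \<phi> = (\<lambda>x. c * \<phi> x)"
  by (simp add: dual_def fspace_def)

lemma dual_lin: "\<phi> \<in> carr (dual X) \<Longrightarrow> lin X scalars \<phi>"
  by (simp add: carr_dual)

lemma dual_separates:
  assumes v: "vspace X" and x: "x \<in> carr X" and z: "\<And>\<phi>. \<phi> \<in> carr (dual X) \<Longrightarrow> \<phi> x = 0"
  shows "x = 0"
proof (rule separating_functional[OF v x])
  fix \<psi> assume \<psi>: "lin X scalars \<psi>"
  let ?\<phi> = "\<lambda>x. if x \<in> carr X then \<psi> x else 0"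
  have "lin X scalars ?\<phi>" using lin_cong[of X \<psi> ?\<phi> scalars] v \<psi> by simp
  then have "?\<phi> \<in> carr (dual X)" by (simp add: carr_dual)
  from z[OF this] show "\<psi> x = 0" using x by simp
qed

text \<open>Off the carrier of \<open>X\<close> the elements of the dual vanish, so linearity in \<open>w\<close> holds there automatically.\<close>

lemma lin_into_dualI:
  assumes W: "vspace W" and F: "\<And>w. w \<in> carr W \<Longrightarrow> F w \<in> carr (dual X)"
    and l: "\<And>x. x \<in> carr X \<Longrightarrow> lin W scalars (\<lambda>w. F w x)"
  shows "lin W (dual X) F"
proof -
  have pw: "lin W scalars (\<lambda>w. F w x)" for x
  proof (cases "x \<in> carr X")
    case False
    then have "F w x = 0" if "w \<in> carr W" for w using F[OF that] by (simp add: carr_dual)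
    then show ?thesis using W by (simp add: lin_def vspace_add vspace_scale image_subset_iff)
  qed (rule l)
  show ?thesis
    by (rule linI) (simp_all add: F fun_eq_iff lin_add[OF pw] lin_scale[OF pw])
qed

lemma lin_dual_apply: "lin W (dual X) F \<Longrightarrow> lin W scalars (\<lambda>w. F w x)"
  by (auto simp: lin_def)

lemma lin_times [simp]:
  "lin W scalars f \<Longrightarrow> lin W scalars (\<lambda>w. f w * c)" "lin W scalars f \<Longrightarrow> lin W scalars (\<lambda>w. c * f w)"
  by (simp_all add: lin_def algebra_simps)

lemma dual_eqI:
  assumes "\<phi> \<in> carr (dual X)" "\<psi> \<in> carr (dual X)" "\<And>x. x \<in> carr X \<Longrightarrow> \<phi> x = \<psi> x"
  shows "\<phi> = \<psi>"
proof
  show "\<phi> x = \<psi> x" for x using assms by (cases "x \<in> carr X") (auto simp: carr_dual)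
qed

lemma tlift_in_dual: "vspace X \<Longrightarrow> vspace Y \<Longrightarrow> bilin X Y scalars B \<Longrightarrow> tlift X Y B \<in> carr (dual (X \<otimes> Y))"
  using lin_tlift[of X Y scalars B] by (simp add: carr_dual tlift_def)

lemma
  assumes v: "vspace X" "vspace Y" "vspace P" "vspace Q"
    and l1: "\<And>y p q. y \<in> carr Y \<Longrightarrow> p \<in> carr P \<Longrightarrow> q \<in> carr Q \<Longrightarrow> lin X scalars (\<lambda>x. B x y p q)"
    and l2: "\<And>x p q. x \<in> carr X \<Longrightarrow> p \<in> carr P \<Longrightarrow> q \<in> carr Q \<Longrightarrow> lin Y scalars (\<lambda>y. B x y p q)"
    and l3: "\<And>x y q. x \<in> carr X \<Longrightarrow> y \<in> carr Y \<Longrightarrow> q \<in> carr Q \<Longrightarrow> lin P scalars (\<lambda>p. B x y p q)"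
    and l4: "\<And>x y p. x \<in> carr X \<Longrightarrow> y \<in> carr Y \<Longrightarrow> p \<in> carr P \<Longrightarrow> lin Q scalars (\<lambda>q. B x y p q)"
  shows lin_quadrilinear_lift: "lin (X \<otimes> Y) (dual (P \<otimes> Q)) (tlift X Y (\<lambda>x y. tlift P Q (B x y)))"
    and quadrilinear_lift_pure: "x \<in> carr X \<Longrightarrow> y \<in> carr Y \<Longrightarrow> p \<in> carr P \<Longrightarrow> q \<in> carr Q
      \<Longrightarrow> tlift X Y (\<lambda>x y. tlift P Q (B x y)) (pure X Y x y) (pure P Q p q) = B x y p q"
proof -
  have b: "bilin P Q scalars (B x y)" if "x \<in> carr X" "y \<in> carr Y" for x y
    using that l3 l4 by (intro bilinI) simp_all
  have bb: "bilin X Y (dual (P \<otimes> Q)) (\<lambda>x y. tlift P Q (B x y))"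
    by (rule bilinI; rule lin_into_dualI) (use v b l1 l2 in \<open>simp_all add: tlift_in_dual lin_tlift_param\<close>)
  show "lin (X \<otimes> Y) (dual (P \<otimes> Q)) (tlift X Y (\<lambda>x y. tlift P Q (B x y)))"
    by (rule lin_tlift[OF v(1,2) vspace_dual bb])
  show "tlift X Y (\<lambda>x y. tlift P Q (B x y)) (pure X Y x y) (pure P Q p q) = B x y p q"
    if "x \<in> carr X" "y \<in> carr Y" "p \<in> carr P" "q \<in> carr Q"
    using that by (simp add: tlift_pure[OF v(1,2) vspace_dual bb] tlift_pure[OF v(3,4) vspace_scalars b])
qed

text \<open>Bijectivity of an induced braiding \<open>D\<close> refers to the copy of \<open>X\<close> embedded by \<open>E\<close>; undoing the
embedding turns \<open>D\<close> into an isomorphism onto \<open>X\<close>, which is determined by its composite with \<open>E\<close>.\<close>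

lemma lin_iso_inv_into:
  assumes v: "vspace X" "vspace Y" and E: "lin X Z E" and inj: "inj_on E (carr X)" and D: "lin Y Z D"
    and bij: "bij_betw D (carr Y) (E ` carr X)"
  shows "lin_iso Y X (\<lambda>t. inv_into (carr X) E (D t))"
    and "t \<in> carr Y \<Longrightarrow> E (inv_into (carr X) E (D t)) = D t"
proof -
  have im: "D t \<in> E ` carr X" if "t \<in> carr Y" for t using bij that by (auto simp: bij_betw_def)
  have EI: "E (inv_into (carr X) E (D t)) = D t" if "t \<in> carr Y" for t
    using im[OF that] by (rule f_inv_into_f)
  have I: "inv_into (carr X) E (D t) \<in> carr X" if "t \<in> carr Y" for t
    using im[OF that] by (rule inv_into_into)
  have "lin Y X (\<lambda>t. inv_into (carr X) E (D t))"
  proof (rule linI)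
    show "inv_into (carr X) E (D t) \<in> carr X" if "t \<in> carr Y" for t using I[OF that] .
    show "inv_into (carr X) E (D (s + t)) = inv_into (carr X) E (D s) + inv_into (carr X) E (D t)"
      if "s \<in> carr Y" "t \<in> carr Y" for s t
      by (rule inj_onD[OF inj]) (use that v in \<open>simp_all add: EI I vspace_add lin_add[OF E] lin_add[OF D, symmetric]\<close>)
    show "inv_into (carr X) E (D (scal Y c t)) = scal X c (inv_into (carr X) E (D t))"
      if "t \<in> carr Y" for c t
      by (rule inj_onD[OF inj]) (use that v in \<open>simp_all add: EI I vspace_scale lin_scale[OF E] lin_scale[OF D, symmetric]\<close>)
  qed
  moreover have "bij_betw (inv_into (carr X) E \<circ> D) (carr Y) (carr X)"
    using bij inj by (intro bij_betw_trans[OF bij] bij_betw_inv_into) (simp add: bij_betw_def)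
  ultimately show "lin_iso Y X (\<lambda>t. inv_into (carr X) E (D t))"
    by (simp add: lin_iso_def comp_def)
  show "E (inv_into (carr X) E (D t)) = D t" if "t \<in> carr Y" using EI[OF that] .
qed

lemma lin_iso_inv:
  assumes v: "vspace X" and i: "lin_iso X Y \<Psi>"
  shows "lin_iso Y X (inv_into (carr X) \<Psi>)"
proof -
  have l: "lin X Y \<Psi>" and b: "bij_betw \<Psi> (carr X) (carr Y)" using i by (auto simp: lin_iso_def)
  have in': "inv_into (carr X) \<Psi> y \<in> carr X" and eq: "\<Psi> (inv_into (carr X) \<Psi> y) = y" if "y \<in> carr Y" for y
    using b that by (auto simp: bij_betw_def intro: inv_into_into f_inv_into_f)
  have e: "inv_into (carr X) \<Psi> (\<Psi> x) = x" if "x \<in> carr X" for x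
    using b that by (simp add: bij_betw_def)
  have "lin Y X (inv_into (carr X) \<Psi>)"
  proof (rule linI)
    show "inv_into (carr X) \<Psi> (x + y) = inv_into (carr X) \<Psi> x + inv_into (carr X) \<Psi> y"
      if "x \<in> carr Y" "y \<in> carr Y" for x y
      using e[of "inv_into (carr X) \<Psi> x + inv_into (carr X) \<Psi> y"] that v
      by (simp add: lin_add[OF l] in' eq vspace_add)
    show "inv_into (carr X) \<Psi> (scal Y c x) = scal X c (inv_into (carr X) \<Psi> x)" if "x \<in> carr Y" for c x
      using e[of "scal X c (inv_into (carr X) \<Psi> x)"] that v
      by (simp add: lin_scale[OF l] in' eq vspace_scale)
  qed (rule in')
  then show ?thesis using b bij_betw_inv_into by (auto simp: lin_iso_def)
qed

section \<open>The nested pairing\<close>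

locale space_of_functionals =
  fixes H :: "('k::field, 'h::ab_group_add) vs" and U :: "('k, 'h \<Rightarrow> 'k) vs"
  assumes vH [simp]: "vspace H" and vU [simp]: "vspace U"
    and scal_U [simp]: "scal U = (\<lambda>c \<phi> x. c * \<phi> x)" and U_dual: "carr U \<subseteq> carr (dual H)"
begin

lemma U_lin [simp]: "f \<in> carr U \<Longrightarrow> lin H scalars f"
  using U_dual dual_lin by blast

lemma lin_apply [simp]: "f \<in> carr U \<Longrightarrow> lin W H h \<Longrightarrow> lin W scalars (\<lambda>w. f (h w))"
  using lin_comp[OF U_lin] .

lemma lin_evaluation [simp]: "lin U scalars (\<lambda>f. f b)"
  by (simp add: lin_def)

lemma lin_evaluation_comp: "lin W U h \<Longrightarrow> lin W scalars (\<lambda>w. h w b)"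
  by (simp add: lin_def)

lemma U_eqI: "f \<in> carr U \<Longrightarrow> g \<in> carr U \<Longrightarrow> (\<And>b. b \<in> carr H \<Longrightarrow> f b = g b) \<Longrightarrow> f = g"
  using U_dual dual_eqI by blast

lemma U_eq_zero: "f \<in> carr U \<Longrightarrow> (\<And>b. b \<in> carr H \<Longrightarrow> f b = 0) \<Longrightarrow> f = 0"
  using U_eqI[of f 0] vspace_zero[OF vU] by simp

lemma pure_UU: "pure (dual H) (dual H) = pure U U"
  by (rule pure_cong_scal) (simp_all add: fun_eq_iff)

lemma UU_subset: "carr (U \<otimes> U) \<subseteq> carr (dual H \<otimes> dual H)"
  by (rule tensor_mono) (simp_all add: fun_eq_iff U_dual)

lemma lin_npair_dual: "lin (dual H \<otimes> dual H) (dual (H \<otimes> H)) (npair H)"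
  unfolding npair_def
  by (rule lin_quadrilinear_lift) (simp_all add: dual_lin lin_dual_apply[OF lin_id])

lemma lin_npair: "lin (U \<otimes> U) (dual (H \<otimes> H)) (npair H)"
  using lin_npair_dual UU_subset by (auto simp: lin_def tensor_def fspace_def subset_iff image_subset_iff)

lemma lin_npair1 [simp]: "lin W (U \<otimes> U) h \<Longrightarrow> lin W scalars (\<lambda>w. npair H (h w) p)"
  by (rule lin_dual_apply[OF lin_comp[OF lin_npair]])

lemma lin_npair2 [simp]: "s \<in> carr (U \<otimes> U) \<Longrightarrow> lin W (H \<otimes> H) h \<Longrightarrow> lin W scalars (\<lambda>w. npair H s (h w))"
  by (rule lin_comp[OF dual_lin[OF lin_in[OF lin_npair]]])

lemma npair_pure_dual:
  "f \<in> carr (dual H) \<Longrightarrow> g \<in> carr (dual H) \<Longrightarrow> a \<in> carr H \<Longrightarrow> b \<in> carr H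
    \<Longrightarrow> npair H (pure (dual H) (dual H) f g) (pure H H a b) = f b * g a"
  unfolding npair_def
  by (rule quadrilinear_lift_pure) (simp_all add: dual_lin lin_dual_apply[OF lin_id])

lemma npair_pure [simp]:
  "f \<in> carr U \<Longrightarrow> g \<in> carr U \<Longrightarrow> a \<in> carr H \<Longrightarrow> b \<in> carr H \<Longrightarrow> npair H (pure U U f g) (pure H H a b) = f b * g a"
  using npair_pure_dual[of f g a b] U_dual by (auto simp: pure_UU)

lemma npair_counit_id:
  assumes "f \<in> carr U" "g \<in> carr U" "p \<in> carr (H \<otimes> H)"
  shows "npair H (pure U U f g) p = f (counit_id H H g p)"
proof -
  have "\<forall>p\<in>carr (H \<otimes> H). npair H (pure U U f g) p = f (counit_id H H g p)"
    by (rule tensor_ext[of _ _ scalars]) (use assms in \<open>simp_all add: lin_scale[OF U_lin[of f]] mult.commute\<close>)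
  then show ?thesis using assms by blast
qed

lemma npair_id_counit:
  assumes "f \<in> carr U" "g \<in> carr U" "p \<in> carr (H \<otimes> H)"
  shows "npair H (pure U U f g) p = g (id_counit H H f p)"
proof -
  have "\<forall>p\<in>carr (H \<otimes> H). npair H (pure U U f g) p = g (id_counit H H f p)"
    by (rule tensor_ext[of _ _ scalars]) (use assms in \<open>simp_all add: lin_scale[OF U_lin[of g]]\<close>)
  then show ?thesis using assms by blast
qed

lemma id_counit_apply:
  assumes "a \<in> carr H" "b \<in> carr H" "s \<in> carr (U \<otimes> U)"
  shows "id_counit U U (\<lambda>f. f a) s b = npair H s (pure H H a b)"
proof -
  have "\<forall>s\<in>carr (U \<otimes> U). id_counit U U (\<lambda>f. f a) s b = npair H s (pure H H a b)"
    by (rule tensor_ext[of _ _ scalars]) (use assms in \<open>simp_all add: lin_evaluation_comp\<close>)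
  then show ?thesis using assms by blast
qed

lemma counit_id_apply:
  assumes "a \<in> carr H" "b \<in> carr H" "s \<in> carr (U \<otimes> U)"
  shows "counit_id U U (\<lambda>f. f a) s b = npair H s (pure H H b a)"
proof -
  have "\<forall>s\<in>carr (U \<otimes> U). counit_id U U (\<lambda>f. f a) s b = npair H s (pure H H b a)"
    by (rule tensor_ext[of _ _ scalars]) (use assms in \<open>simp_all add: lin_evaluation_comp\<close>)
  then show ?thesis using assms by blast
qed

text \<open>The nested pairing is nondegenerate on the side of \<open>U \<otimes> U\<close>, since evaluations at points of \<open>H\<close>
separate the elements of \<open>U\<close>; likewise for tensors with one or two factors in \<open>U\<close>.\<close>

lemma UU_eqI:
  assumes st: "s \<in> carr (U \<otimes> U)" "t \<in> carr (U \<otimes> U)"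
    and eq: "\<And>a b. a \<in> carr H \<Longrightarrow> b \<in> carr H \<Longrightarrow> npair H s (pure H H a b) = npair H t (pure H H a b)"
  shows "s = t"
proof (rule tensor_eq_right[OF vU vU st])
  fix \<beta> assume "\<beta> \<in> (\<lambda>a (f :: 'h \<Rightarrow> 'k). f a) ` carr H"
  then obtain a where a: "\<beta> = (\<lambda>f. f a)" "a \<in> carr H" by blast
  show "lin U scalars \<beta>" using a by simp
  show "id_counit U U \<beta> s = id_counit U U \<beta> t"
    unfolding a using st a eq by (intro U_eqI) (simp_all add: id_counit_apply)
next
  fix y assume "y \<in> carr U" "\<And>\<beta>. \<beta> \<in> (\<lambda>a (f :: 'h \<Rightarrow> 'k). f a) ` carr H \<Longrightarrow> \<beta> y = 0"
  then show "y = 0" by (intro U_eq_zero) auto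
qed

lemma UU_eqI_tensor:
  assumes "s \<in> carr (U \<otimes> U)" "t \<in> carr (U \<otimes> U)" "\<And>p. p \<in> carr (H \<otimes> H) \<Longrightarrow> npair H s p = npair H t p"
  shows "s = t"
  using assms by (intro UU_eqI) simp_all

lemma UU_separated: "s \<in> carr (U \<otimes> U) \<Longrightarrow> (\<And>p. p \<in> carr (H \<otimes> H) \<Longrightarrow> npair H s p = 0) \<Longrightarrow> s = 0"
  using UU_eqI_tensor[of s 0] vspace_zero[OF vspace_tensor, of U U] lin_zero[OF _ _ lin_npair1[OF lin_id], of "\<lambda>_. 0"]
  by (metis lin_npair1 lin_id lin_zero vspace_scalars vspace_tensor)

lemma eq_right_evaluation:
  assumes "vspace X" "s \<in> carr (X \<otimes> U)" "t \<in> carr (X \<otimes> U)"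
    "\<And>b. b \<in> carr H \<Longrightarrow> id_counit X U (\<lambda>f. f b) s = id_counit X U (\<lambda>f. f b) t"
  shows "s = t"
proof (rule tensor_eq_right[of X U _ _ "(\<lambda>b f. f b) ` carr H"])
  fix y assume "y \<in> carr U" "\<And>\<beta>. \<beta> \<in> (\<lambda>b (f :: 'h \<Rightarrow> 'k). f b) ` carr H \<Longrightarrow> \<beta> y = 0"
  then show "y = 0" by (intro U_eq_zero) auto
qed (use assms in auto)

lemma eq_left_evaluation:
  assumes "vspace X" "s \<in> carr (U \<otimes> X)" "t \<in> carr (U \<otimes> X)"
    "\<And>b. b \<in> carr H \<Longrightarrow> counit_id U X (\<lambda>f. f b) s = counit_id U X (\<lambda>f. f b) t"
  shows "s = t"
proof (rule tensor_eq_left[of U X _ _ "(\<lambda>b f. f b) ` carr H"])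
  fix y assume "y \<in> carr U" "\<And>\<beta>. \<beta> \<in> (\<lambda>b (f :: 'h \<Rightarrow> 'k). f b) ` carr H \<Longrightarrow> \<beta> y = 0"
  then show "y = 0" by (intro U_eq_zero) auto
qed (use assms in auto)

lemma eq_right_pairing:
  assumes "vspace X" "s \<in> carr (X \<otimes> (U \<otimes> U))" "t \<in> carr (X \<otimes> (U \<otimes> U))"
    "\<And>q. q \<in> carr (H \<otimes> H) \<Longrightarrow> id_counit X (U \<otimes> U) (\<lambda>s. npair H s q) s = id_counit X (U \<otimes> U) (\<lambda>s. npair H s q) t"
  shows "s = t"
proof (rule tensor_eq_right[of X "U \<otimes> U" _ _ "(\<lambda>q s. npair H s q) ` carr (H \<otimes> H)"])
  fix y assume "y \<in> carr (U \<otimes> U)" "\<And>\<beta>. \<beta> \<in> (\<lambda>q s. npair H s q) ` carr (H \<otimes> H) \<Longrightarrow> \<beta> y = 0"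
  then show "y = 0" by (intro UU_separated) auto
qed (use assms in auto)

lemma eq_left_pairing:
  assumes "vspace X" "s \<in> carr (U \<otimes> U \<otimes> X)" "t \<in> carr (U \<otimes> U \<otimes> X)"
    "\<And>q. q \<in> carr (H \<otimes> H) \<Longrightarrow> counit_id (U \<otimes> U) X (\<lambda>s. npair H s q) s = counit_id (U \<otimes> U) X (\<lambda>s. npair H s q) t"
  shows "s = t"
proof (rule tensor_eq_left[of "U \<otimes> U" X _ _ "(\<lambda>q s. npair H s q) ` carr (H \<otimes> H)"])
  fix y assume "y \<in> carr (U \<otimes> U)" "\<And>\<beta>. \<beta> \<in> (\<lambda>q s. npair H s q) ` carr (H \<otimes> H) \<Longrightarrow> \<beta> y = 0"
  then show "y = 0" by (intro UU_separated) auto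
qed (use assms in auto)

end

lemma space_of_functionals_dual: "vspace H \<Longrightarrow> space_of_functionals H (dual H)"
  by unfold_locales (auto simp: fun_eq_iff)

section \<open>Transposes on triple tensor products\<close>

context space_of_functionals
begin

text \<open>The nested pairing of \<open>U \<otimes> U \<otimes> U\<close> with \<open>H \<otimes> (H \<otimes> H)\<close>: outer factors are paired with outer factors
from the opposite end, so \<open>(f \<otimes> g) \<otimes> h\<close> and \<open>a \<otimes> (b \<otimes> c)\<close> give \<open>f c * g b * h a\<close>. The opposite bracketing
on the two sides reflects that the first two factors of one side face the last two of the other.\<close>

definition npair3 :: "('k, ('k, 'h \<Rightarrow> 'k, 'h \<Rightarrow> 'k) tens, 'h \<Rightarrow> 'k) tens \<Rightarrow> ('k, 'h, ('k, 'h, 'h) tens) tens \<Rightarrow> 'k"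
  where "npair3 = tlift (U \<otimes> U) U (\<lambda>s h. tlift H (H \<otimes> H) (\<lambda>a q. h a * npair H s q))"

lemma lin_npair3: "lin (U \<otimes> U \<otimes> U) (dual (H \<otimes> (H \<otimes> H))) npair3"
  unfolding npair3_def by (rule lin_quadrilinear_lift) simp_all

lemma lin_npair3_left [simp]: "lin W (U \<otimes> U \<otimes> U) h \<Longrightarrow> lin W scalars (\<lambda>w. npair3 (h w) P)"
  by (rule lin_dual_apply[OF lin_comp[OF lin_npair3]])

lemma lin_npair3_right [simp]:
  "t \<in> carr (U \<otimes> U \<otimes> U) \<Longrightarrow> lin W (H \<otimes> (H \<otimes> H)) h \<Longrightarrow> lin W scalars (\<lambda>w. npair3 t (h w))"
  by (rule lin_comp[OF dual_lin[OF lin_in[OF lin_npair3]]])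

lemma npair3_pure [simp]:
  "s \<in> carr (U \<otimes> U) \<Longrightarrow> h \<in> carr U \<Longrightarrow> a \<in> carr H \<Longrightarrow> q \<in> carr (H \<otimes> H)
    \<Longrightarrow> npair3 (pure (U \<otimes> U) U s h) (pure H (H \<otimes> H) a q) = h a * npair H s q"
  unfolding npair3_def by (rule quadrilinear_lift_pure) simp_all

lemma npair3_assoc_inv:
  assumes "f \<in> carr U" "s \<in> carr (U \<otimes> U)" "p \<in> carr (H \<otimes> H)" "c \<in> carr H"
  shows "npair3 (assoc_inv U U U (pure U (U \<otimes> U) f s)) (assoc H H H (pure (H \<otimes> H) H p c)) = f c * npair H s p"
proof -
  have 1: "\<forall>p\<in>carr (H \<otimes> H). npair3 (assoc_inv U U U (pure U (U \<otimes> U) f (pure U U g h)))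
      (assoc H H H (pure (H \<otimes> H) H p c)) = f c * npair H (pure U U g h) p"
    if "g \<in> carr U" "h \<in> carr U" for g h
    by (rule tensor_ext[of _ _ scalars]) (use assms that in simp_all)
  have "\<forall>s\<in>carr (U \<otimes> U). npair3 (assoc_inv U U U (pure U (U \<otimes> U) f s))
      (assoc H H H (pure (H \<otimes> H) H p c)) = f c * npair H s p"
    by (rule tensor_ext[of _ _ scalars]) (use assms 1 in simp_all)
  then show ?thesis using assms by blast
qed

lemma UUU_eqI:
  assumes st: "s \<in> carr (U \<otimes> U \<otimes> U)" "t \<in> carr (U \<otimes> U \<otimes> U)"
    and eq: "\<And>P. P \<in> carr (H \<otimes> H \<otimes> H) \<Longrightarrow> npair3 s (assoc H H H P) = npair3 t (assoc H H H P)"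
  shows "s = t"
proof (rule tensor_eq_right[OF vspace_tensor vU st])
  fix \<beta> assume "\<beta> \<in> (\<lambda>a (f :: 'h \<Rightarrow> 'k). f a) ` carr H"
  then obtain a where a: "\<beta> = (\<lambda>f. f a)" "a \<in> carr H" by blast
  show "lin U scalars \<beta>" using a by simp
  have sl: "\<forall>s\<in>carr (U \<otimes> U \<otimes> U). npair H (id_counit (U \<otimes> U) U (\<lambda>f. f a) s) q = npair3 s (pure H (H \<otimes> H) a q)"
    if "q \<in> carr (H \<otimes> H)" for q
    by (rule tensor_ext[of _ _ scalars]) (use a that in \<open>simp_all add: lin_scale[OF lin_npair1[OF lin_id]]\<close>)
  have eq': "npair3 s (pure H (H \<otimes> H) a q) = npair3 t (pure H (H \<otimes> H) a q)" if "q \<in> carr (H \<otimes> H)" for q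
    using eq[of "assoc_inv H H H (pure H (H \<otimes> H) a q)"] a that by simp
  show "id_counit (U \<otimes> U) U \<beta> s = id_counit (U \<otimes> U) U \<beta> t"
    unfolding a by (rule UU_eqI) (use st a eq' sl in simp_all)
next
  fix y assume "y \<in> carr U" "\<And>\<beta>. \<beta> \<in> (\<lambda>a (f :: 'h \<Rightarrow> 'k). f a) ` carr H \<Longrightarrow> \<beta> y = 0"
  then show "y = 0" by (intro U_eq_zero) auto
qed

text \<open>Under the nested pairing, a crossing of the first two factors is transposed into a crossing of the
last two, and conversely.\<close>

lemma npair3_br12:
  assumes l: "lin (H \<otimes> H) (H \<otimes> H) \<Phi>" "lin (U \<otimes> U) (U \<otimes> U) K"
    and adj: "\<And>s p. s \<in> carr (U \<otimes> U) \<Longrightarrow> p \<in> carr (H \<otimes> H) \<Longrightarrow> npair H (K s) p = npair H s (\<Phi> p)"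
    and t: "t \<in> carr (U \<otimes> U \<otimes> U)" and P: "P \<in> carr (H \<otimes> H \<otimes> H)"
  shows "npair3 (br12 U U U K t) (assoc H H H P) = npair3 t (assoc H H H (br23 H H H \<Phi> P))"
proof -
  note [simp] = l lin_in[OF l(1)] lin_in[OF l(2)]
  have 1: "\<forall>P\<in>carr (H \<otimes> H \<otimes> H). npair3 (br12 U U U K (pure (U \<otimes> U) U s h)) (assoc H H H P)
      = npair3 (pure (U \<otimes> U) U s h) (assoc H H H (br23 H H H \<Phi> P))"
    if "s \<in> carr (U \<otimes> U)" "h \<in> carr U" for s h
    by (rule tensor_ext3[of _ _ _ scalars]) (use that in \<open>simp_all add: adj\<close>)
  have "\<forall>t\<in>carr (U \<otimes> U \<otimes> U). npair3 (br12 U U U K t) (assoc H H H P)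
      = npair3 t (assoc H H H (br23 H H H \<Phi> P))"
    by (rule tensor_ext[of _ _ scalars]) (use 1 P in simp_all)
  then show ?thesis using t by blast
qed

lemma npair3_br23:
  assumes l: "lin (H \<otimes> H) (H \<otimes> H) \<Phi>" "lin (U \<otimes> U) (U \<otimes> U) K"
    and adj: "\<And>s p. s \<in> carr (U \<otimes> U) \<Longrightarrow> p \<in> carr (H \<otimes> H) \<Longrightarrow> npair H (K s) p = npair H s (\<Phi> p)"
    and t: "t \<in> carr (U \<otimes> U \<otimes> U)" and P: "P \<in> carr (H \<otimes> H \<otimes> H)"
  shows "npair3 (br23 U U U K t) (assoc H H H P) = npair3 t (assoc H H H (br12 H H H \<Phi> P))"
proof -
  note [simp] = l lin_in[OF l(1)] lin_in[OF l(2)]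
  have 1: "\<forall>P\<in>carr (H \<otimes> H \<otimes> H). npair3 (br23 U U U K (pure (U \<otimes> U) U (pure U U f g) h)) (assoc H H H P)
      = npair3 (pure (U \<otimes> U) U (pure U U f g) h) (assoc H H H (br12 H H H \<Phi> P))"
    if "f \<in> carr U" "g \<in> carr U" "h \<in> carr U" for f g h
  proof (rule tensor_ext[of _ _ scalars])
    fix p c assume pc: "p \<in> carr (H \<otimes> H)" "c \<in> carr H"
    show "npair3 (br23 U U U K (pure (U \<otimes> U) U (pure U U f g) h)) (assoc H H H (pure (H \<otimes> H) H p c))
      = npair3 (pure (U \<otimes> U) U (pure U U f g) h) (assoc H H H (br12 H H H \<Phi> (pure (H \<otimes> H) H p c)))"
      using that pc npair3_assoc_inv[of f "pure U U g h"] by (simp add: npair3_assoc_inv adj)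
  qed (use that in simp_all)
  have "\<forall>t\<in>carr (U \<otimes> U \<otimes> U). npair3 (br23 U U U K t) (assoc H H H P)
      = npair3 t (assoc H H H (br12 H H H \<Phi> P))"
    by (rule tensor_ext3[of _ _ _ scalars]) (use 1 P in simp_all)
  then show ?thesis using t by blast
qed

text \<open>If \<open>\<Delta>\<close> is the transpose of \<open>\<mu>\<close>, then \<open>\<Delta> \<otimes> id\<close> is the transpose of \<open>id \<otimes> \<mu>\<close>, and conversely.\<close>

lemma npair3_comult_id:
  assumes l: "lin (H \<otimes> H) H \<mu>" "lin U (U \<otimes> U) \<Delta>"
    and adj: "\<And>f p. f \<in> carr U \<Longrightarrow> p \<in> carr (H \<otimes> H) \<Longrightarrow> npair H (\<Delta> f) p = f (\<mu> p)"
    and s: "s \<in> carr (U \<otimes> U)" and P: "P \<in> carr (H \<otimes> H \<otimes> H)"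
  shows "npair3 (tmap U U (U \<otimes> U) U \<Delta> (\<lambda>f. f) s) (assoc H H H P)
    = npair H s (tmap H (H \<otimes> H) H H (\<lambda>x. x) \<mu> (assoc H H H P))"
proof -
  note [simp] = l lin_in[OF l(1)] lin_in[OF l(2)]
  have 1: "\<forall>P\<in>carr (H \<otimes> H \<otimes> H). npair3 (tmap U U (U \<otimes> U) U \<Delta> (\<lambda>f. f) (pure U U f g)) (assoc H H H P)
    = npair H (pure U U f g) (tmap H (H \<otimes> H) H H (\<lambda>x. x) \<mu> (assoc H H H P))"
    if "f \<in> carr U" "g \<in> carr U" for f g
    by (rule tensor_ext3[of _ _ _ scalars]) (use that in \<open>simp_all add: adj\<close>)
  have "\<forall>s\<in>carr (U \<otimes> U). npair3 (tmap U U (U \<otimes> U) U \<Delta> (\<lambda>f. f) s) (assoc H H H P)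
    = npair H s (tmap H (H \<otimes> H) H H (\<lambda>x. x) \<mu> (assoc H H H P))"
    by (rule tensor_ext[of _ _ scalars]) (use 1 P in simp_all)
  then show ?thesis using s by blast
qed

lemma npair3_id_comult:
  assumes l: "lin (H \<otimes> H) H \<mu>" "lin U (U \<otimes> U) \<Delta>"
    and adj: "\<And>f p. f \<in> carr U \<Longrightarrow> p \<in> carr (H \<otimes> H) \<Longrightarrow> npair H (\<Delta> f) p = f (\<mu> p)"
    and s: "s \<in> carr (U \<otimes> U)" and P: "P \<in> carr (H \<otimes> H \<otimes> H)"
  shows "npair3 (assoc_inv U U U (tmap U U U (U \<otimes> U) (\<lambda>f. f) \<Delta> s)) (assoc H H H P)
    = npair H s (tmap (H \<otimes> H) H H H \<mu> (\<lambda>x. x) P)"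
proof -
  note [simp] = l lin_in[OF l(1)] lin_in[OF l(2)]
  have 1: "\<forall>P\<in>carr (H \<otimes> H \<otimes> H). npair3 (assoc_inv U U U (tmap U U U (U \<otimes> U) (\<lambda>f. f) \<Delta> (pure U U f g))) (assoc H H H P)
    = npair H (pure U U f g) (tmap (H \<otimes> H) H H H \<mu> (\<lambda>x. x) P)"
    if "f \<in> carr U" "g \<in> carr U" for f g
    by (rule tensor_ext[of _ _ scalars]) (use that in \<open>simp_all add: adj npair3_assoc_inv\<close>)
  have "\<forall>s\<in>carr (U \<otimes> U). npair3 (assoc_inv U U U (tmap U U U (U \<otimes> U) (\<lambda>f. f) \<Delta> s)) (assoc H H H P)
    = npair H s (tmap (H \<otimes> H) H H H \<mu> (\<lambda>x. x) P)"
    by (rule tensor_ext[of _ _ scalars]) (use 1 P in simp_all)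
  then show ?thesis using s by blast
qed

end

section \<open>Coalgebras and braided coalgebras by transposition\<close>

locale dual_coalgebra = space_of_functionals H U
  for H :: "('k::field, 'h::ab_group_add) vs" and U :: "('k, 'h \<Rightarrow> 'k) vs" +
  fixes \<mu> :: "('k, 'h, 'h) tens \<Rightarrow> 'h" and e :: 'h
    and \<Delta> :: "('h \<Rightarrow> 'k) \<Rightarrow> ('k, 'h \<Rightarrow> 'k, 'h \<Rightarrow> 'k) tens"
  assumes algebra: "unital_algebra H \<mu> e" and \<Delta> [simp]: "lin U (U \<otimes> U) \<Delta>"
    and \<Delta>_adj: "\<And>f p. f \<in> carr U \<Longrightarrow> p \<in> carr (H \<otimes> H) \<Longrightarrow> npair H (\<Delta> f) p = f (\<mu> p)"
begin

lemma \<mu> [simp]: "lin (H \<otimes> H) H \<mu>" and e_in [simp]: "e \<in> carr H"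
  and \<mu>_unit: "\<And>x. x \<in> carr H \<Longrightarrow> \<mu> (pure H H e x) = x" "\<And>x. x \<in> carr H \<Longrightarrow> \<mu> (pure H H x e) = x"
  and \<mu>_assoc: "\<And>t. t \<in> carr (H \<otimes> H \<otimes> H) \<Longrightarrow> \<mu> (tmap (H \<otimes> H) H H H \<mu> (\<lambda>x. x) t)
      = \<mu> (tmap H (H \<otimes> H) H H (\<lambda>x. x) \<mu> (assoc H H H t))"
  using algebra by (auto simp: unital_algebra_def)

lemmas [simp] = lin_in[OF \<mu>] lin_in[OF \<Delta>] lin_comp[OF \<mu>] lin_comp[OF \<Delta>]

text \<open>Coassociativity is the transpose of associativity, and the counit axioms are the transposes of the
unit axioms.\<close>

lemma coalgebra: "coalgebra U \<Delta> (\<lambda>f. f e)"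
  unfolding coalgebra_def
proof (intro conjI ballI)
  fix c assume c: "c \<in> carr U"
  have "tmap U U (U \<otimes> U) U \<Delta> (\<lambda>x. x) (\<Delta> c) = assoc_inv U U U (tmap U U U (U \<otimes> U) (\<lambda>x. x) \<Delta> (\<Delta> c))"
    by (rule UUU_eqI)
      (use c in \<open>simp_all add: npair3_comult_id[OF \<mu> \<Delta> \<Delta>_adj] npair3_id_comult[OF \<mu> \<Delta> \<Delta>_adj] \<Delta>_adj \<mu>_assoc\<close>)
  then show "assoc U U U (tmap U U (U \<otimes> U) U \<Delta> (\<lambda>x. x) (\<Delta> c)) = tmap U U U (U \<otimes> U) (\<lambda>x. x) \<Delta> (\<Delta> c)"
    using c by simp
  show "counit_id U U (\<lambda>f. f e) (\<Delta> c) = c" "id_counit U U (\<lambda>f. f e) (\<Delta> c) = c"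
    by (rule U_eqI; use c in \<open>simp add: id_counit_apply counit_id_apply \<Delta>_adj \<mu>_unit\<close>)+
qed simp_all

text \<open>Every condition on \<open>K\<close> is tested against \<open>H \<otimes> H \<otimes> H\<close> or \<open>H \<otimes> H\<close>, where it becomes the condition
of the same kind on \<open>\<Psi>\<close>: the Yang-Baxter equation is its own transpose, and each compatibility with the
comultiplication is the transpose of a compatibility with the multiplication.\<close>

lemma braided_coalgebra_adjoint:
  assumes b: "braided H \<Psi>" and iso: "lin_iso (U \<otimes> U) (U \<otimes> U) K"
    and c: "compat_mult1 H \<mu> e H \<Psi>" "compat_mult2 H \<mu> e H \<Psi>"
    and adj: "\<And>s p. s \<in> carr (U \<otimes> U) \<Longrightarrow> p \<in> carr (H \<otimes> H) \<Longrightarrow> npair H (K s) p = npair H s (\<Psi> p)"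
  shows "braided_coalgebra U \<Delta> (\<lambda>f. f e) K"
proof -
  have l: "lin (H \<otimes> H) (H \<otimes> H) \<Psi>" "lin (U \<otimes> U) (U \<otimes> U) K" using b iso by (auto simp: braided_def lin_iso_def)
  note [simp] = l lin_in[OF l(1)] lin_in[OF l(2)] lin_comp[OF l(1)] lin_comp[OF l(2)]
  note adj3 = npair3_br12[OF l adj] npair3_br23[OF l adj]
    npair3_comult_id[OF \<mu> \<Delta> \<Delta>_adj] npair3_id_comult[OF \<mu> \<Delta> \<Delta>_adj]
  have "braided U K"
    unfolding braided_def
  proof (intro conjI ballI vU iso)
    fix t assume t: "t \<in> carr (U \<otimes> U \<otimes> U)"
    show "br12 U U U K (br23 U U U K (br12 U U U K t)) = br23 U U U K (br12 U U U K (br23 U U U K t))"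
      by (rule UUU_eqI) (use t b in \<open>simp_all add: adj3 braided_def\<close>)
  qed
  moreover have "compat_comult1 U \<Delta> (\<lambda>f. f e) U K"
    unfolding compat_comult1_def
  proof (intro conjI ballI)
    fix t assume t: "t \<in> carr (U \<otimes> U)"
    have "assoc_inv U U U (tmap U U U (U \<otimes> U) (\<lambda>w. w) \<Delta> (K t))
        = br12 U U U K (br23 U U U K (tmap U U (U \<otimes> U) U \<Delta> (\<lambda>w. w) t))"
      by (rule UUU_eqI) (use t c in \<open>simp_all add: adj3 adj compat_mult1_def\<close>)
    then show "tmap U U U (U \<otimes> U) (\<lambda>w. w) \<Delta> (K t)
        = assoc U U U (br12 U U U K (br23 U U U K (tmap U U (U \<otimes> U) U \<Delta> (\<lambda>w. w) t)))"
      using t assoc_assoc_inv[of U U U "tmap U U U (U \<otimes> U) (\<lambda>w. w) \<Delta> (K t)"] by simp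
    show "id_counit U U (\<lambda>f. f e) (K t) = counit_id U U (\<lambda>f. f e) t"
      by (rule U_eqI) (use t c in \<open>simp_all add: id_counit_apply counit_id_apply adj compat_mult1_def\<close>)
  qed
  moreover have "compat_comult2 U \<Delta> (\<lambda>f. f e) U K"
    unfolding compat_comult2_def
  proof (intro conjI ballI)
    fix t assume t: "t \<in> carr (U \<otimes> U)"
    show "tmap U U (U \<otimes> U) U \<Delta> (\<lambda>v. v) (K t)
        = br23 U U U K (br12 U U U K (assoc_inv U U U (tmap U U U (U \<otimes> U) (\<lambda>v. v) \<Delta> t)))"
      by (rule UUU_eqI) (use t c in \<open>simp_all add: adj3 adj compat_mult2_def\<close>)
    show "counit_id U U (\<lambda>f. f e) (K t) = id_counit U U (\<lambda>f. f e) t"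
      by (rule U_eqI) (use t c in \<open>simp_all add: id_counit_apply counit_id_apply adj compat_mult2_def\<close>)
  qed
  ultimately show ?thesis using coalgebra by (simp add: braided_coalgebra_def)
qed

end

section \<open>Transposing the left strand of a braiding\<close>

context space_of_functionals
begin

lemma lin_slice_left: "w \<in> carr (H \<otimes> U) \<Longrightarrow> lin H H (\<lambda>b. id_counit H U (\<lambda>f. f b) w)"
  by (rule lin_id_counit_param) simp_all

lemma lin_slice_right: "w \<in> carr (U \<otimes> H) \<Longrightarrow> lin H H (\<lambda>b. counit_id U H (\<lambda>f. f b) w)"
  by (rule lin_counit_id_param) simp_all

end

text \<open>\<open>K : U \<otimes> H \<rightarrow> H \<otimes> U\<close> is obtained from \<open>\<Phi> : H \<otimes> H \<rightarrow> H \<otimes> H\<close> by turning around one strand: the functional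
that enters \<open>K\<close> on the left is applied to the left output of \<open>\<Phi>\<close>, and the functional that leaves \<open>K\<close> on the
right is evaluated at the right input of \<open>\<Phi>\<close>.\<close>

locale left_transposed = space_of_functionals H U
  for H :: "('k::field, 'h::ab_group_add) vs" and U :: "('k, 'h \<Rightarrow> 'k) vs" +
  fixes \<Phi> :: "('k, 'h, 'h) tens \<Rightarrow> ('k, 'h, 'h) tens"
    and K :: "('k, 'h \<Rightarrow> 'k, 'h) tens \<Rightarrow> ('k, 'h, 'h \<Rightarrow> 'k) tens"
  assumes \<Phi> [simp]: "lin (H \<otimes> H) (H \<otimes> H) \<Phi>" and K [simp]: "lin (U \<otimes> H) (H \<otimes> U) K"
    and K_slice: "\<And>g a b. g \<in> carr U \<Longrightarrow> a \<in> carr H \<Longrightarrow> b \<in> carr H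
      \<Longrightarrow> id_counit H U (\<lambda>f. f b) (K (pure U H g a)) = counit_id H H g (\<Phi> (pure H H a b))"
begin

lemmas [simp] = lin_in[OF \<Phi>] lin_in[OF K] lin_comp[OF \<Phi>] lin_comp[OF K]

text \<open>A functional that passes two elements of \<open>H\<close> to its right and is then evaluated at \<open>b\<close> amounts to \<open>b\<close> passing
the two elements to its left and being fed to the functional.\<close>

lemma UHH_slice:
  assumes f: "f \<in> carr U" and q: "q \<in> carr (H \<otimes> H)" and b: "b \<in> carr H"
  shows "id_counit (H \<otimes> H) U (\<lambda>f. f b) (br23 H U H K (br12 U H H K (assoc_inv U H H (pure U (H \<otimes> H) f q))))
    = counit_id H (H \<otimes> H) f (assoc H H H (br12 H H H \<Phi> (br23 H H H \<Phi> (pure (H \<otimes> H) H q b))))"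
proof -
  \<comment> \<open>\<open>?T w\<close> evaluates the functional in the second factor of \<open>w\<close> at the first factor of its argument.\<close>
  let ?T = "\<lambda>w. tmap H H H H (\<lambda>b'. id_counit H U (\<lambda>f. f b') w) (\<lambda>y. y)"
  have sl: "\<forall>k\<in>carr (H \<otimes> U). id_counit (H \<otimes> H) U (\<lambda>f. f b) (assoc_inv H H U (pure H (H \<otimes> U) x k))
      = pure H H x (id_counit H U (\<lambda>f. f b) k)" if x: "x \<in> carr H" for x
    by (rule tensor_ext[of _ _ "H \<otimes> H"]) (use b x in \<open>simp_all add: lin_scale[OF lin_pure2[OF _ _ lin_id]]\<close>)
  have ev: "\<forall>k\<in>carr (H \<otimes> H). ?T (pure H U x u) k = pure H H x (counit_id H H u k)"
    if xu: "x \<in> carr H" "u \<in> carr U" for x u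
    by (rule tensor_ext[of _ _ "H \<otimes> H"])
      (use xu in \<open>simp_all add: lin_slice_left lin_scaled_vector vspace_scale lin_scale[OF lin_pure1[OF _ _ lin_id]] lin_scale[OF lin_pure2[OF _ _ lin_id]]\<close>)
  have linT: "lin (H \<otimes> U) (H \<otimes> H) (\<lambda>w. ?T w k)" if "k \<in> carr (H \<otimes> H)" for k
    unfolding tmap_def by (rule lin_tlift_param) (use that in \<open>simp_all add: bilinI lin_slice_left\<close>)
  \<comment> \<open>The crossing applied last, for an arbitrary output \<open>w\<close> of the first one.\<close>
  have outer: "\<forall>w\<in>carr (H \<otimes> U). id_counit (H \<otimes> H) U (\<lambda>f. f b) (br23 H U H K (pure (H \<otimes> U) H w y))
      = ?T w (\<Phi> (pure H H y b))" if y: "y \<in> carr H" for y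
    by (rule tensor_ext[of _ _ "H \<otimes> H"]) (use b y sl ev linT in \<open>simp_all add: K_slice\<close>)
  have inner: "\<forall>k\<in>carr (H \<otimes> H). ?T (K (pure U H f x)) k
      = counit_id H (H \<otimes> H) f (assoc H H H (br12 H H H \<Phi> (assoc_inv H H H (pure H (H \<otimes> H) x k))))"
    if x: "x \<in> carr H" for x
  proof (rule tensor_ext[of _ _ "H \<otimes> H"])
    fix c y assume cy: "c \<in> carr H" "y \<in> carr H"
    have "\<forall>r\<in>carr (H \<otimes> H). counit_id H (H \<otimes> H) f (assoc H H H (pure (H \<otimes> H) H r y)) = pure H H (counit_id H H f r) y"
      by (rule tensor_ext[of _ _ "H \<otimes> H"]) (use f cy in \<open>simp_all add: lin_scale[OF lin_pure1[OF _ _ lin_id]]\<close>)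
    then show "?T (K (pure U H f x)) (pure H H c y)
      = counit_id H (H \<otimes> H) f (assoc H H H (br12 H H H \<Phi> (assoc_inv H H H (pure H (H \<otimes> H) x (pure H H c y)))))"
      using f x cy by (simp add: lin_slice_left K_slice)
  qed (use f x in \<open>simp_all add: lin_slice_left\<close>)
  have "\<forall>q\<in>carr (H \<otimes> H). id_counit (H \<otimes> H) U (\<lambda>f. f b) (br23 H U H K (br12 U H H K (assoc_inv U H H (pure U (H \<otimes> H) f q))))
    = counit_id H (H \<otimes> H) f (assoc H H H (br12 H H H \<Phi> (br23 H H H \<Phi> (pure (H \<otimes> H) H q b))))"
    by (rule tensor_ext[of _ _ "H \<otimes> H"]) (use f b outer inner in simp_all)
  then show ?thesis using q by blast
qed

text \<open>Two functionals that pass \<open>a\<close> and are then paired with \<open>q\<close> amount to \<open>a\<close> passing the two factors of \<open>q\<close>,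
which are then paired with the functionals.\<close>

lemma UUH_slice:
  assumes s: "s \<in> carr (U \<otimes> U)" and a: "a \<in> carr H" and q: "q \<in> carr (H \<otimes> H)"
  shows "id_counit H (U \<otimes> U) (\<lambda>s. npair H s q) (assoc H U U (br12 U H U K (br23 U U H K (pure (U \<otimes> U) H s a))))
    = counit_id (H \<otimes> H) H (npair H s) (br23 H H H \<Phi> (br12 H H H \<Phi> (assoc_inv H H H (pure H (H \<otimes> H) a q))))"
proof -
  let ?L = "\<lambda>s q. id_counit H (U \<otimes> U) (\<lambda>s. npair H s q) (assoc H U U (br12 U H U K (br23 U U H K (pure (U \<otimes> U) H s a))))"
  let ?R = "\<lambda>s q. counit_id (H \<otimes> H) H (npair H s) (br23 H H H \<Phi> (br12 H H H \<Phi> (assoc_inv H H H (pure H (H \<otimes> H) a q))))"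
  have split: "\<forall>z\<in>carr (H \<otimes> U). id_counit H (U \<otimes> U) (\<lambda>s. npair H s (pure H H c b)) (assoc H U U (pure (H \<otimes> U) U z v))
      = scal H (v c) (id_counit H U (\<lambda>f. f b) z)"
    if "c \<in> carr H" "b \<in> carr H" "v \<in> carr U" for b c v
    by (rule tensor_ext[of _ _ H])
      (use that in \<open>simp_all add: lin_scaled_map vspace_scale module.scale_scale[OF vspace_module[OF vH]] mult.commute\<close>)
  \<comment> \<open>Both sides are reduced to \<open>(u \<otimes> id) \<Phi> ((v \<otimes> id) \<Phi> (a \<otimes> c) \<otimes> b)\<close> for \<open>s = u \<otimes> v\<close> and \<open>q = c \<otimes> b\<close>.\<close>
  have outer: "\<forall>w\<in>carr (H \<otimes> U). id_counit H (U \<otimes> U) (\<lambda>s. npair H s (pure H H c b))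
      (assoc H U U (br12 U H U K (assoc_inv U H U (pure U (H \<otimes> U) u w))))
      = counit_id H H u (\<Phi> (pure H H (id_counit H U (\<lambda>f. f c) w) b))"
    if "c \<in> carr H" "b \<in> carr H" "u \<in> carr U" for b c u
    by (rule tensor_ext[of _ _ H])
      (use that split in \<open>simp_all add: K_slice vspace_scale
        lin_scale[OF lin_counit_id[OF _ _ _ lin_comp[OF \<Phi> lin_pure1[OF _ _ lin_id]]]]\<close>)
  have split': "\<forall>k\<in>carr (H \<otimes> H). counit_id (H \<otimes> H) H (npair H (pure U U u v)) (assoc_inv H H H (pure H (H \<otimes> H) c k))
      = scal H (v c) (counit_id H H u k)"
    if "c \<in> carr H" "u \<in> carr U" "v \<in> carr U" for c u v
    by (rule tensor_ext[of _ _ H])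
      (use that in \<open>simp_all add: lin_scaled_map vspace_scale module.scale_scale[OF vspace_module[OF vH]] mult.commute\<close>)
  have inner: "\<forall>r\<in>carr (H \<otimes> H). counit_id (H \<otimes> H) H (npair H (pure U U u v)) (br23 H H H \<Phi> (pure (H \<otimes> H) H r b))
      = counit_id H H u (\<Phi> (pure H H (counit_id H H v r) b))"
    if "b \<in> carr H" "u \<in> carr U" "v \<in> carr U" for b u v
    by (rule tensor_ext[of _ _ H])
      (use that split' in \<open>simp_all add: vspace_scale
        lin_scale[OF lin_counit_id[OF _ _ _ lin_comp[OF \<Phi> lin_pure1[OF _ _ lin_id]]]]\<close>)
  have linL: "lin (H \<otimes> H) H (\<lambda>q. ?L s q)" if "s \<in> carr (U \<otimes> U)" for s
    by (rule lin_id_counit_param) (use a that in simp_all)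
  have linR: "lin (U \<otimes> U) H (\<lambda>s. ?R s q)" if "q \<in> carr (H \<otimes> H)" for q
    by (rule lin_counit_id_param) (use a that in simp_all)
  have 1: "\<forall>q\<in>carr (H \<otimes> H). ?L (pure U U u v) q = ?R (pure U U u v) q" if "u \<in> carr U" "v \<in> carr U" for u v
    by (rule tensor_ext[of _ _ H])
      (use that a linL[of "pure U U u v"] outer inner in \<open>simp_all add: K_slice\<close>)
  have "\<forall>s\<in>carr (U \<otimes> U). ?L s q = ?R s q"
    by (rule tensor_ext[of _ _ H]) (use 1 a q linR[OF q] in simp_all)
  then show ?thesis using s by blast
qed

text \<open>Evaluating the strand of \<open>U\<close> turns the equation into \<open>\<Phi>\<^sub>1\<^sub>2 \<Phi>\<^sub>2\<^sub>3 \<Psi>\<^sub>1\<^sub>2 = \<Psi>\<^sub>2\<^sub>3 \<Phi>\<^sub>1\<^sub>2 \<Phi>\<^sub>2\<^sub>3\<close>, which says that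
\<open>H\<close> is left \<open>H\<close>-braided by \<open>\<Phi>\<close>; left and right are exchanged because a strand is turned around.\<close>

lemma right_braided_UH:
  assumes b: "left_braided H \<Psi> H \<Phi>" and iso: "lin_iso (U \<otimes> H) (H \<otimes> U) K"
  shows "right_braided H \<Psi> U K"
proof -
  have l: "lin (H \<otimes> H) (H \<otimes> H) \<Psi>" using b by (simp add: left_braided_def braided_def lin_iso_def)
  note [simp] = l lin_in[OF l] lin_comp[OF l]
  have yb: "br12 H H H \<Phi> (br23 H H H \<Phi> (br12 H H H \<Psi> t)) = br23 H H H \<Psi> (br12 H H H \<Phi> (br23 H H H \<Phi> t))"
    if "t \<in> carr (H \<otimes> H \<otimes> H)" for t using b that by (simp add: left_braided_def)
  have "\<forall>t\<in>carr (U \<otimes> H \<otimes> H). br23 H U H K (br12 U H H K (br23 U H H \<Psi> t))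
      = br12 H H U \<Psi> (br23 H U H K (br12 U H H K t))"
  proof (rule tensor_ext3_assoc_inv[of _ _ _ "H \<otimes> H \<otimes> U"])
    fix f q assume fq: "f \<in> carr U" "q \<in> carr (H \<otimes> H)"
    let ?t = "assoc_inv U H H (pure U (H \<otimes> H) f q)"
    show "br23 H U H K (br12 U H H K (br23 U H H \<Psi> ?t)) = br12 H H U \<Psi> (br23 H U H K (br12 U H H K ?t))"
    proof (rule eq_right_evaluation)
      fix b' assume b': "b' \<in> carr H"
      let ?P = "pure (H \<otimes> H) H q b'"
      have "id_counit (H \<otimes> H) U (\<lambda>f. f b') (br23 H U H K (br12 U H H K (br23 U H H \<Psi> ?t)))
          = counit_id H (H \<otimes> H) f (assoc H H H (br12 H H H \<Phi> (br23 H H H \<Phi> (br12 H H H \<Psi> ?P))))"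
        using fq b' by (simp add: UHH_slice)
      also have "\<dots> = counit_id H (H \<otimes> H) f (assoc H H H (br23 H H H \<Psi> (br12 H H H \<Phi> (br23 H H H \<Phi> ?P))))"
        using fq b' by (simp only: yb[of ?P] pure_in_tensor vH vspace_tensor)
      also have "\<dots> = \<Psi> (counit_id H (H \<otimes> H) f (assoc H H H (br12 H H H \<Phi> (br23 H H H \<Phi> ?P))))"
        using fq b' by (simp add: assoc_br23 counit_id_tmap)
      also have "\<dots> = id_counit (H \<otimes> H) U (\<lambda>f. f b') (br12 H H U \<Psi> (br23 H U H K (br12 U H H K ?t)))"
        using fq b' by (simp add: UHH_slice br12_def[of H H U \<Psi>] id_counit_tmap)
      finally show "id_counit (H \<otimes> H) U (\<lambda>f. f b') (br23 H U H K (br12 U H H K (br23 U H H \<Psi> ?t)))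
          = id_counit (H \<otimes> H) U (\<lambda>f. f b') (br12 H H U \<Psi> (br23 H U H K (br12 U H H K ?t)))" .
    qed (use fq in simp_all)
  qed simp_all
  then show ?thesis using b iso by (simp add: right_braided_def left_braided_def)
qed

text \<open>Pairing the two strands of \<open>U\<close> with \<open>q\<close>, and replacing \<open>\<Psi>U\<close> by its transpose \<open>\<Psi>\<close>, turns the equation into
\<open>\<Psi>\<^sub>1\<^sub>2 \<Phi>\<^sub>2\<^sub>3 \<Phi>\<^sub>1\<^sub>2 = \<Phi>\<^sub>2\<^sub>3 \<Phi>\<^sub>1\<^sub>2 \<Psi>\<^sub>2\<^sub>3\<close>.\<close>

lemma left_braided_UH:
  assumes b: "right_braided H \<Psi> H \<Phi>" and bU: "braided U \<Psi>U"
    and adj: "\<And>s p. s \<in> carr (U \<otimes> U) \<Longrightarrow> p \<in> carr (H \<otimes> H) \<Longrightarrow> npair H (\<Psi>U s) p = npair H s (\<Psi> p)"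
    and iso: "lin_iso (U \<otimes> H) (H \<otimes> U) K"
  shows "left_braided U \<Psi>U H K"
proof -
  have l: "lin (H \<otimes> H) (H \<otimes> H) \<Psi>" "lin (U \<otimes> U) (U \<otimes> U) \<Psi>U"
    using b bU by (simp_all add: right_braided_def braided_def lin_iso_def)
  note [simp] = l lin_in[OF l(1)] lin_comp[OF l(1)] lin_in[OF l(2)] lin_comp[OF l(2)]
  have yb: "br23 H H H \<Phi> (br12 H H H \<Phi> (br23 H H H \<Psi> t)) = br12 H H H \<Psi> (br23 H H H \<Phi> (br12 H H H \<Phi> t))"
    if "t \<in> carr (H \<otimes> H \<otimes> H)" for t using b that by (simp add: right_braided_def)
  have "\<forall>t\<in>carr (U \<otimes> U \<otimes> H). br12 U H U K (br23 U U H K (br12 U U H \<Psi>U t))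
      = br23 H U U \<Psi>U (br12 U H U K (br23 U U H K t))"
  proof (rule tensor_ext[of _ _ "H \<otimes> U \<otimes> U"])
    fix s a assume sa: "s \<in> carr (U \<otimes> U)" "a \<in> carr H"
    let ?t = "pure (U \<otimes> U) H s a"
    have "assoc H U U (br12 U H U K (br23 U U H K (br12 U U H \<Psi>U ?t)))
      = assoc H U U (br23 H U U \<Psi>U (br12 U H U K (br23 U U H K ?t)))"
    proof (rule eq_right_pairing)
      fix q assume q: "q \<in> carr (H \<otimes> H)"
      let ?P = "assoc_inv H H H (pure H (H \<otimes> H) a q)"
      have "id_counit H (U \<otimes> U) (\<lambda>s. npair H s q) (assoc H U U (br12 U H U K (br23 U U H K (br12 U U H \<Psi>U ?t))))
          = counit_id (H \<otimes> H) H (npair H (\<Psi>U s)) (br23 H H H \<Phi> (br12 H H H \<Phi> ?P))"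
        using sa q by (simp add: UUH_slice)
      also have "\<dots> = counit_id (H \<otimes> H) H (\<lambda>p. npair H s (\<Psi> p)) (br23 H H H \<Phi> (br12 H H H \<Phi> ?P))"
        by (rule counit_id_cong) (use sa q in \<open>simp_all add: adj\<close>)
      also have "\<dots> = counit_id (H \<otimes> H) H (npair H s) (br12 H H H \<Psi> (br23 H H H \<Phi> (br12 H H H \<Phi> ?P)))"
        using sa q by (simp add: br12_def[of H H H \<Psi>] counit_id_tmap)
      also have "\<dots> = counit_id (H \<otimes> H) H (npair H s) (br23 H H H \<Phi> (br12 H H H \<Phi> (br23 H H H \<Psi> ?P)))"
        using sa q by (simp only: yb[of ?P] pure_in_tensor assoc_inv_in vH vspace_tensor)
      also have "\<dots> = id_counit H (U \<otimes> U) (\<lambda>s. npair H s (\<Psi> q)) (assoc H U U (br12 U H U K (br23 U U H K ?t)))"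
        using sa q by (simp add: UUH_slice)
      also have "\<dots> = id_counit H (U \<otimes> U) (\<lambda>s. npair H (\<Psi>U s) q) (assoc H U U (br12 U H U K (br23 U U H K ?t)))"
        by (rule id_counit_cong) (use sa q in \<open>simp_all add: adj\<close>)
      also have "\<dots> = id_counit H (U \<otimes> U) (\<lambda>s. npair H s q) (assoc H U U (br23 H U U \<Psi>U (br12 U H U K (br23 U U H K ?t))))"
        using sa q by (simp add: assoc_br23 id_counit_tmap)
      finally show "id_counit H (U \<otimes> U) (\<lambda>s. npair H s q) (assoc H U U (br12 U H U K (br23 U U H K (br12 U U H \<Psi>U ?t))))
        = id_counit H (U \<otimes> U) (\<lambda>s. npair H s q) (assoc H U U (br23 H U U \<Psi>U (br12 U H U K (br23 U U H K ?t))))" .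
    qed (use sa in simp_all)
    then show "br12 U H U K (br23 U U H K (br12 U U H \<Psi>U ?t)) = br23 H U U \<Psi>U (br12 U H U K (br23 U U H K ?t))"
      by (rule assoc_cancel[of H U U, rotated 5]) (use sa in simp_all)
  qed simp_all
  then show ?thesis using bU iso by (simp add: left_braided_def)
qed

text \<open>Pairing the coproduct with \<open>q\<close> evaluates the functional at \<open>\<mu> q\<close>, so the condition becomes
\<open>\<Phi> (id \<otimes> \<mu>) = (\<mu> \<otimes> id) \<Phi>\<^sub>2\<^sub>3 \<Phi>\<^sub>1\<^sub>2\<close>; the condition on the counit becomes \<open>\<Phi> (a \<otimes> 1) = 1 \<otimes> a\<close>.\<close>

lemma compat_comult1_UH:
  assumes c: "compat_mult2 H \<mu> e H \<Phi>" and l: "lin (H \<otimes> H) H \<mu>" "lin U (U \<otimes> U) \<Delta>" and e: "e \<in> carr H"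
    and adj: "\<And>f p. f \<in> carr U \<Longrightarrow> p \<in> carr (H \<otimes> H) \<Longrightarrow> npair H (\<Delta> f) p = f (\<mu> p)"
  shows "compat_comult1 U \<Delta> (\<lambda>f. f e) H K"
proof -
  note [simp] = l lin_in[OF l(1)] lin_comp[OF l(1)] lin_in[OF l(2)] lin_comp[OF l(2)] e
  have cm: "\<Phi> (tmap H (H \<otimes> H) H H (\<lambda>v. v) \<mu> (assoc H H H t))
      = tmap (H \<otimes> H) H H H \<mu> (\<lambda>v. v) (br23 H H H \<Phi> (br12 H H H \<Phi> t))"
    if "t \<in> carr (H \<otimes> H \<otimes> H)" for t using c that by (simp add: compat_mult2_def)
  have "\<forall>t\<in>carr (U \<otimes> H). tmap H U H (U \<otimes> U) (\<lambda>w. w) \<Delta> (K t)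
      = assoc H U U (br12 U H U K (br23 U U H K (tmap U H (U \<otimes> U) H \<Delta> (\<lambda>w. w) t)))"
  proof (rule tensor_ext[of _ _ "H \<otimes> (U \<otimes> U)"])
    fix f a assume fa: "f \<in> carr U" "a \<in> carr H"
    let ?t = "pure U H f a"
    show "tmap H U H (U \<otimes> U) (\<lambda>w. w) \<Delta> (K ?t)
      = assoc H U U (br12 U H U K (br23 U U H K (tmap U H (U \<otimes> U) H \<Delta> (\<lambda>w. w) ?t)))"
    proof (rule eq_right_pairing)
      fix q assume q: "q \<in> carr (H \<otimes> H)"
      let ?P = "assoc_inv H H H (pure H (H \<otimes> H) a q)"
      have "id_counit H (U \<otimes> U) (\<lambda>s. npair H s q) (tmap H U H (U \<otimes> U) (\<lambda>w. w) \<Delta> (K ?t))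
          = id_counit H U (\<lambda>f. npair H (\<Delta> f) q) (K ?t)"
        using fa q by (simp add: id_counit_tmap)
      also have "\<dots> = id_counit H U (\<lambda>f. f (\<mu> q)) (K ?t)"
        by (rule id_counit_cong) (use fa q in \<open>simp_all add: adj\<close>)
      also have "\<dots> = counit_id H H f (\<Phi> (pure H H a (\<mu> q)))"
        using fa q by (simp add: K_slice)
      also have "\<dots> = counit_id H H f (\<Phi> (tmap H (H \<otimes> H) H H (\<lambda>v. v) \<mu> (assoc H H H ?P)))"
        using fa q by simp
      also have "\<dots> = counit_id H H f (tmap (H \<otimes> H) H H H \<mu> (\<lambda>v. v) (br23 H H H \<Phi> (br12 H H H \<Phi> ?P)))"
        using fa q by (simp only: cm[of ?P] pure_in_tensor assoc_inv_in vH vspace_tensor)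
      also have "\<dots> = counit_id (H \<otimes> H) H (\<lambda>p. f (\<mu> p)) (br23 H H H \<Phi> (br12 H H H \<Phi> ?P))"
        using fa q by (simp add: counit_id_tmap)
      also have "\<dots> = counit_id (H \<otimes> H) H (npair H (\<Delta> f)) (br23 H H H \<Phi> (br12 H H H \<Phi> ?P))"
        by (rule counit_id_cong) (use fa q in \<open>simp_all add: adj\<close>)
      also have "\<dots> = id_counit H (U \<otimes> U) (\<lambda>s. npair H s q)
          (assoc H U U (br12 U H U K (br23 U U H K (tmap U H (U \<otimes> U) H \<Delta> (\<lambda>w. w) ?t))))"
        using fa q by (simp add: UUH_slice)
      finally show "id_counit H (U \<otimes> U) (\<lambda>s. npair H s q) (tmap H U H (U \<otimes> U) (\<lambda>w. w) \<Delta> (K ?t))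
          = id_counit H (U \<otimes> U) (\<lambda>s. npair H s q)
            (assoc H U U (br12 U H U K (br23 U U H K (tmap U H (U \<otimes> U) H \<Delta> (\<lambda>w. w) ?t))))" .
    qed (use fa in simp_all)
  qed simp_all
  moreover have "\<forall>t\<in>carr (U \<otimes> H). id_counit H U (\<lambda>f. f e) (K t) = counit_id U H (\<lambda>f. f e) t"
    by (rule tensor_ext[of _ _ H]) (use c in \<open>simp_all add: K_slice compat_mult2_def\<close>)
  ultimately show ?thesis by (simp add: compat_comult1_def)
qed

end

section \<open>Transposing the right strand of a braiding\<close>

text \<open>The mirror image: the functional that enters \<open>K\<close> on the right is applied to the right output of \<open>\<Phi>\<close>, and
the functional that leaves \<open>K\<close> on the left is evaluated at the left input of \<open>\<Phi>\<close>.\<close>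

locale right_transposed = space_of_functionals H U
  for H :: "('k::field, 'h::ab_group_add) vs" and U :: "('k, 'h \<Rightarrow> 'k) vs" +
  fixes \<Phi> :: "('k, 'h, 'h) tens \<Rightarrow> ('k, 'h, 'h) tens"
    and K :: "('k, 'h, 'h \<Rightarrow> 'k) tens \<Rightarrow> ('k, 'h \<Rightarrow> 'k, 'h) tens"
  assumes \<Phi> [simp]: "lin (H \<otimes> H) (H \<otimes> H) \<Phi>" and K [simp]: "lin (H \<otimes> U) (U \<otimes> H) K"
    and K_slice: "\<And>b f a. b \<in> carr H \<Longrightarrow> f \<in> carr U \<Longrightarrow> a \<in> carr H
      \<Longrightarrow> counit_id U H (\<lambda>f. f a) (K (pure H U b f)) = id_counit H H f (\<Phi> (pure H H a b))"
begin

lemmas [simp] = lin_in[OF \<Phi>] lin_in[OF K] lin_comp[OF \<Phi>] lin_comp[OF K]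

lemma HHU_slice:
  assumes f: "f \<in> carr U" and q: "q \<in> carr (H \<otimes> H)" and a: "a \<in> carr H"
  shows "counit_id U (H \<otimes> H) (\<lambda>f. f a) (assoc U H H (br12 H U H K (br23 H H U K (pure (H \<otimes> H) U q f))))
    = id_counit (H \<otimes> H) H f (br23 H H H \<Phi> (br12 H H H \<Phi> (assoc_inv H H H (pure H (H \<otimes> H) a q))))"
proof -
  \<comment> \<open>\<open>?T w\<close> evaluates the functional in the first factor of \<open>w\<close> at the second factor of its argument.\<close>
  let ?T = "\<lambda>w. tmap H H H H (\<lambda>y. y) (\<lambda>b'. counit_id U H (\<lambda>f. f b') w)"
  have sl: "\<forall>k\<in>carr (U \<otimes> H). counit_id U (H \<otimes> H) (\<lambda>f. f a) (assoc U H H (pure (U \<otimes> H) H k y))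
      = pure H H (counit_id U H (\<lambda>f. f a) k) y" if y: "y \<in> carr H" for y
    by (rule tensor_ext[of _ _ "H \<otimes> H"]) (use a y in \<open>simp_all add: lin_scale[OF lin_pure1[OF _ _ lin_id]]\<close>)
  have ev: "\<forall>k\<in>carr (H \<otimes> H). ?T (pure U H u y) k = pure H H (id_counit H H u k) y"
    if uy: "u \<in> carr U" "y \<in> carr H" for u y
    by (rule tensor_ext[of _ _ "H \<otimes> H"])
      (use uy in \<open>simp_all add: lin_slice_right lin_scaled_vector vspace_scale lin_scale[OF lin_pure1[OF _ _ lin_id]] lin_scale[OF lin_pure2[OF _ _ lin_id]]\<close>)
  have linT: "lin (U \<otimes> H) (H \<otimes> H) (\<lambda>w. ?T w k)" if "k \<in> carr (H \<otimes> H)" for k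
    unfolding tmap_def by (rule lin_tlift_param) (use that in \<open>simp_all add: bilinI lin_slice_right\<close>)
  \<comment> \<open>The crossing applied last, for an arbitrary output \<open>w\<close> of the first one.\<close>
  have outer: "\<forall>w\<in>carr (U \<otimes> H). counit_id U (H \<otimes> H) (\<lambda>f. f a) (assoc U H H (br12 H U H K (assoc_inv H U H (pure H (U \<otimes> H) x w))))
      = ?T w (\<Phi> (pure H H a x))" if x: "x \<in> carr H" for x
    by (rule tensor_ext[of _ _ "H \<otimes> H"]) (use a x sl ev linT in \<open>simp_all add: K_slice\<close>)
  have inner: "\<forall>k\<in>carr (H \<otimes> H). ?T (K (pure H U y f)) k
      = id_counit (H \<otimes> H) H f (br23 H H H \<Phi> (pure (H \<otimes> H) H k y))"
    if y: "y \<in> carr H" for y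
  proof (rule tensor_ext[of _ _ "H \<otimes> H"])
    fix x c assume xc: "x \<in> carr H" "c \<in> carr H"
    have "\<forall>r\<in>carr (H \<otimes> H). id_counit (H \<otimes> H) H f (assoc_inv H H H (pure H (H \<otimes> H) x r)) = pure H H x (id_counit H H f r)"
      by (rule tensor_ext[of _ _ "H \<otimes> H"]) (use f xc in \<open>simp_all add: lin_scale[OF lin_pure2[OF _ _ lin_id]]\<close>)
    then show "?T (K (pure H U y f)) (pure H H x c)
      = id_counit (H \<otimes> H) H f (br23 H H H \<Phi> (pure (H \<otimes> H) H (pure H H x c) y))"
      using f y xc by (simp add: lin_slice_right K_slice)
  qed (use f y in \<open>simp_all add: lin_slice_right\<close>)
  have "\<forall>q\<in>carr (H \<otimes> H). counit_id U (H \<otimes> H) (\<lambda>f. f a) (assoc U H H (br12 H U H K (br23 H H U K (pure (H \<otimes> H) U q f))))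
    = id_counit (H \<otimes> H) H f (br23 H H H \<Phi> (br12 H H H \<Phi> (assoc_inv H H H (pure H (H \<otimes> H) a q))))"
    by (rule tensor_ext[of _ _ "H \<otimes> H"]) (use f a outer inner in simp_all)
  then show ?thesis using q by blast
qed

lemma HUU_slice:
  assumes s: "s \<in> carr (U \<otimes> U)" and b: "b \<in> carr H" and q: "q \<in> carr (H \<otimes> H)"
  shows "counit_id (U \<otimes> U) H (\<lambda>s. npair H s q) (br23 U H U K (br12 H U U K (assoc_inv H U U (pure H (U \<otimes> U) b s))))
    = id_counit H (H \<otimes> H) (npair H s) (assoc H H H (br12 H H H \<Phi> (br23 H H H \<Phi> (pure (H \<otimes> H) H q b))))"
proof -
  let ?L = "\<lambda>s q. counit_id (U \<otimes> U) H (\<lambda>s. npair H s q) (br23 U H U K (br12 H U U K (assoc_inv H U U (pure H (U \<otimes> U) b s))))"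
  let ?R = "\<lambda>s q. id_counit H (H \<otimes> H) (npair H s) (assoc H H H (br12 H H H \<Phi> (br23 H H H \<Phi> (pure (H \<otimes> H) H q b))))"
  have split: "\<forall>z\<in>carr (U \<otimes> H). counit_id (U \<otimes> U) H (\<lambda>s. npair H s (pure H H c d)) (assoc_inv U U H (pure U (U \<otimes> H) u z))
      = scal H (u d) (counit_id U H (\<lambda>f. f c) z)"
    if "c \<in> carr H" "d \<in> carr H" "u \<in> carr U" for c d u
    by (rule tensor_ext[of _ _ H])
      (use that in \<open>simp_all add: lin_scaled_map vspace_scale module.scale_scale[OF vspace_module[OF vH]]\<close>)
  \<comment> \<open>Both sides are reduced to \<open>(id \<otimes> v) \<Phi> (c \<otimes> (id \<otimes> u) \<Phi> (d \<otimes> b))\<close> for \<open>s = u \<otimes> v\<close> and \<open>q = c \<otimes> d\<close>.\<close>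
  have outer: "\<forall>w\<in>carr (U \<otimes> H). counit_id (U \<otimes> U) H (\<lambda>s. npair H s (pure H H c d))
      (br23 U H U K (pure (U \<otimes> H) U w v))
      = id_counit H H v (\<Phi> (pure H H c (counit_id U H (\<lambda>f. f d) w)))"
    if "c \<in> carr H" "d \<in> carr H" "v \<in> carr U" for c d v
    by (rule tensor_ext[of _ _ H])
      (use that split in \<open>simp_all add: K_slice vspace_scale
        lin_scale[OF lin_id_counit[OF _ _ _ lin_comp[OF \<Phi> lin_pure2[OF _ _ lin_id]]]]\<close>)
  have split': "\<forall>k\<in>carr (H \<otimes> H). id_counit H (H \<otimes> H) (npair H (pure U U u v)) (assoc H H H (pure (H \<otimes> H) H k y))
      = scal H (u y) (id_counit H H v k)"
    if "y \<in> carr H" "u \<in> carr U" "v \<in> carr U" for y u v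
    by (rule tensor_ext[of _ _ H])
      (use that in \<open>simp_all add: lin_scaled_map vspace_scale module.scale_scale[OF vspace_module[OF vH]]\<close>)
  have inner: "\<forall>r\<in>carr (H \<otimes> H). id_counit H (H \<otimes> H) (npair H (pure U U u v)) (assoc H H H (br12 H H H \<Phi> (assoc_inv H H H (pure H (H \<otimes> H) c r))))
      = id_counit H H v (\<Phi> (pure H H c (id_counit H H u r)))"
    if "c \<in> carr H" "u \<in> carr U" "v \<in> carr U" for c u v
    by (rule tensor_ext[of _ _ H])
      (use that split' in \<open>simp_all add: vspace_scale
        lin_scale[OF lin_id_counit[OF _ _ _ lin_comp[OF \<Phi> lin_pure2[OF _ _ lin_id]]]]\<close>)
  have linL: "lin (H \<otimes> H) H (\<lambda>q. ?L s q)" if "s \<in> carr (U \<otimes> U)" for s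
    by (rule lin_counit_id_param) (use b that in simp_all)
  have linR: "lin (U \<otimes> U) H (\<lambda>s. ?R s q)" if "q \<in> carr (H \<otimes> H)" for q
    by (rule lin_id_counit_param) (use b that in simp_all)
  have 1: "\<forall>q\<in>carr (H \<otimes> H). ?L (pure U U u v) q = ?R (pure U U u v) q" if "u \<in> carr U" "v \<in> carr U" for u v
    by (rule tensor_ext[of _ _ H])
      (use that b linL[of "pure U U u v"] outer inner in \<open>simp_all add: K_slice\<close>)
  have "\<forall>s\<in>carr (U \<otimes> U). ?L s q = ?R s q"
    by (rule tensor_ext[of _ _ H]) (use 1 b q linR[OF q] in simp_all)
  then show ?thesis using s by blast
qed

lemma left_braided_HU:
  assumes b: "right_braided H \<Psi> H \<Phi>" and iso: "lin_iso (H \<otimes> U) (U \<otimes> H) K"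
  shows "left_braided H \<Psi> U K"
proof -
  have l: "lin (H \<otimes> H) (H \<otimes> H) \<Psi>" using b by (simp add: right_braided_def braided_def lin_iso_def)
  note [simp] = l lin_in[OF l] lin_comp[OF l]
  have yb: "br23 H H H \<Phi> (br12 H H H \<Phi> (br23 H H H \<Psi> t)) = br12 H H H \<Psi> (br23 H H H \<Phi> (br12 H H H \<Phi> t))"
    if "t \<in> carr (H \<otimes> H \<otimes> H)" for t using b that by (simp add: right_braided_def)
  have "\<forall>t\<in>carr (H \<otimes> H \<otimes> U). br12 H U H K (br23 H H U K (br12 H H U \<Psi> t))
      = br23 U H H \<Psi> (br12 H U H K (br23 H H U K t))"
  proof (rule tensor_ext[of _ _ "U \<otimes> H \<otimes> H"])
    fix q f assume fq: "q \<in> carr (H \<otimes> H)" "f \<in> carr U"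
    let ?t = "pure (H \<otimes> H) U q f"
    have "assoc U H H (br12 H U H K (br23 H H U K (br12 H H U \<Psi> ?t)))
      = assoc U H H (br23 U H H \<Psi> (br12 H U H K (br23 H H U K ?t)))"
    proof (rule eq_left_evaluation)
      fix a assume a: "a \<in> carr H"
      let ?P = "assoc_inv H H H (pure H (H \<otimes> H) a q)"
      have "counit_id U (H \<otimes> H) (\<lambda>f. f a) (assoc U H H (br12 H U H K (br23 H H U K (br12 H H U \<Psi> ?t))))
          = id_counit (H \<otimes> H) H f (br23 H H H \<Phi> (br12 H H H \<Phi> (br23 H H H \<Psi> ?P)))"
        using fq a by (simp add: HHU_slice)
      also have "\<dots> = id_counit (H \<otimes> H) H f (br12 H H H \<Psi> (br23 H H H \<Phi> (br12 H H H \<Phi> ?P)))"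
        using fq a by (simp only: yb[of ?P] pure_in_tensor assoc_inv_in vH vspace_tensor)
      also have "\<dots> = \<Psi> (id_counit (H \<otimes> H) H f (br23 H H H \<Phi> (br12 H H H \<Phi> ?P)))"
        using fq a by (simp add: br12_def[of H H H \<Psi>] id_counit_tmap)
      also have "\<dots> = counit_id U (H \<otimes> H) (\<lambda>f. f a) (assoc U H H (br23 U H H \<Psi> (br12 H U H K (br23 H H U K ?t))))"
        using fq a by (simp add: HHU_slice assoc_br23 counit_id_tmap)
      finally show "counit_id U (H \<otimes> H) (\<lambda>f. f a) (assoc U H H (br12 H U H K (br23 H H U K (br12 H H U \<Psi> ?t))))
          = counit_id U (H \<otimes> H) (\<lambda>f. f a) (assoc U H H (br23 U H H \<Psi> (br12 H U H K (br23 H H U K ?t))))" .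
    qed (use fq in simp_all)
    then show "br12 H U H K (br23 H H U K (br12 H H U \<Psi> ?t)) = br23 U H H \<Psi> (br12 H U H K (br23 H H U K ?t))"
      by (rule assoc_cancel[of U H H, rotated 5]) (use fq in simp_all)
  qed simp_all
  then show ?thesis using b iso by (simp add: right_braided_def left_braided_def)
qed

lemma right_braided_HU:
  assumes b: "left_braided H \<Psi> H \<Phi>" and bU: "braided U \<Psi>U"
    and adj: "\<And>s p. s \<in> carr (U \<otimes> U) \<Longrightarrow> p \<in> carr (H \<otimes> H) \<Longrightarrow> npair H (\<Psi>U s) p = npair H s (\<Psi> p)"
    and iso: "lin_iso (H \<otimes> U) (U \<otimes> H) K"
  shows "right_braided U \<Psi>U H K"
proof -
  have l: "lin (H \<otimes> H) (H \<otimes> H) \<Psi>" "lin (U \<otimes> U) (U \<otimes> U) \<Psi>U"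
    using b bU by (simp_all add: left_braided_def braided_def lin_iso_def)
  note [simp] = l lin_in[OF l(1)] lin_comp[OF l(1)] lin_in[OF l(2)] lin_comp[OF l(2)]
  have yb: "br12 H H H \<Phi> (br23 H H H \<Phi> (br12 H H H \<Psi> t)) = br23 H H H \<Psi> (br12 H H H \<Phi> (br23 H H H \<Phi> t))"
    if "t \<in> carr (H \<otimes> H \<otimes> H)" for t using b that by (simp add: left_braided_def)
  have "\<forall>t\<in>carr (H \<otimes> U \<otimes> U). br23 U H U K (br12 H U U K (br23 H U U \<Psi>U t))
      = br12 U U H \<Psi>U (br23 U H U K (br12 H U U K t))"
  proof (rule tensor_ext3_assoc_inv[of _ _ _ "U \<otimes> U \<otimes> H"])
    fix b' s assume sb: "b' \<in> carr H" "s \<in> carr (U \<otimes> U)"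
    let ?t = "assoc_inv H U U (pure H (U \<otimes> U) b' s)"
    show "br23 U H U K (br12 H U U K (br23 H U U \<Psi>U ?t)) = br12 U U H \<Psi>U (br23 U H U K (br12 H U U K ?t))"
    proof (rule eq_left_pairing)
      fix q assume q: "q \<in> carr (H \<otimes> H)"
      let ?P = "pure (H \<otimes> H) H q b'"
      have "counit_id (U \<otimes> U) H (\<lambda>s. npair H s q) (br23 U H U K (br12 H U U K (br23 H U U \<Psi>U ?t)))
          = id_counit H (H \<otimes> H) (npair H (\<Psi>U s)) (assoc H H H (br12 H H H \<Phi> (br23 H H H \<Phi> ?P)))"
        using sb q by (simp add: HUU_slice)
      also have "\<dots> = id_counit H (H \<otimes> H) (\<lambda>p. npair H s (\<Psi> p)) (assoc H H H (br12 H H H \<Phi> (br23 H H H \<Phi> ?P)))"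
        by (rule id_counit_cong) (use sb q in \<open>simp_all add: adj\<close>)
      also have "\<dots> = id_counit H (H \<otimes> H) (npair H s) (assoc H H H (br23 H H H \<Psi> (br12 H H H \<Phi> (br23 H H H \<Phi> ?P))))"
        using sb q by (simp add: assoc_br23 id_counit_tmap)
      also have "\<dots> = id_counit H (H \<otimes> H) (npair H s) (assoc H H H (br12 H H H \<Phi> (br23 H H H \<Phi> (br12 H H H \<Psi> ?P))))"
        using sb q by (simp only: yb[of ?P] pure_in_tensor vH vspace_tensor)
      also have "\<dots> = counit_id (U \<otimes> U) H (\<lambda>s. npair H s (\<Psi> q)) (br23 U H U K (br12 H U U K ?t))"
        using sb q by (simp add: HUU_slice)
      also have "\<dots> = counit_id (U \<otimes> U) H (\<lambda>s. npair H (\<Psi>U s) q) (br23 U H U K (br12 H U U K ?t))"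
        by (rule counit_id_cong) (use sb q in \<open>simp_all add: adj\<close>)
      also have "\<dots> = counit_id (U \<otimes> U) H (\<lambda>s. npair H s q) (br12 U U H \<Psi>U (br23 U H U K (br12 H U U K ?t)))"
        using sb q by (simp add: br12_def[of U U H \<Psi>U] counit_id_tmap)
      finally show "counit_id (U \<otimes> U) H (\<lambda>s. npair H s q) (br23 U H U K (br12 H U U K (br23 H U U \<Psi>U ?t)))
          = counit_id (U \<otimes> U) H (\<lambda>s. npair H s q) (br12 U U H \<Psi>U (br23 U H U K (br12 H U U K ?t)))" .
    qed (use sb in simp_all)
  qed simp_all
  then show ?thesis using bU iso by (simp add: right_braided_def)
qed

text \<open>The mirror image of the case of \<open>U \<otimes> H\<close>: the condition becomes
\<open>\<Phi> (\<mu> \<otimes> id) = (id \<otimes> \<mu>) \<Phi>\<^sub>1\<^sub>2 \<Phi>\<^sub>2\<^sub>3\<close>, together with \<open>\<Phi> (1 \<otimes> b) = b \<otimes> 1\<close>.\<close>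

lemma compat_comult2_HU:
  assumes c: "compat_mult1 H \<mu> e H \<Phi>" and l: "lin (H \<otimes> H) H \<mu>" "lin U (U \<otimes> U) \<Delta>" and e: "e \<in> carr H"
    and adj: "\<And>f p. f \<in> carr U \<Longrightarrow> p \<in> carr (H \<otimes> H) \<Longrightarrow> npair H (\<Delta> f) p = f (\<mu> p)"
  shows "compat_comult2 U \<Delta> (\<lambda>f. f e) H K"
proof -
  note [simp] = l lin_in[OF l(1)] lin_comp[OF l(1)] lin_in[OF l(2)] lin_comp[OF l(2)] e
  have cm: "\<Phi> (tmap (H \<otimes> H) H H H \<mu> (\<lambda>w. w) t)
      = tmap H (H \<otimes> H) H H (\<lambda>w. w) \<mu> (assoc H H H (br12 H H H \<Phi> (br23 H H H \<Phi> t)))"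
    if "t \<in> carr (H \<otimes> H \<otimes> H)" for t using c that by (simp add: compat_mult1_def)
  have "\<forall>t\<in>carr (H \<otimes> U). tmap U H (U \<otimes> U) H \<Delta> (\<lambda>v. v) (K t)
      = br23 U H U K (br12 H U U K (assoc_inv H U U (tmap H U H (U \<otimes> U) (\<lambda>v. v) \<Delta> t)))"
  proof (rule tensor_ext[of _ _ "U \<otimes> U \<otimes> H"])
    fix b f assume fb: "b \<in> carr H" "f \<in> carr U"
    let ?t = "pure H U b f"
    show "tmap U H (U \<otimes> U) H \<Delta> (\<lambda>v. v) (K ?t)
      = br23 U H U K (br12 H U U K (assoc_inv H U U (tmap H U H (U \<otimes> U) (\<lambda>v. v) \<Delta> ?t)))"
    proof (rule eq_left_pairing)
      fix q assume q: "q \<in> carr (H \<otimes> H)"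
      let ?P = "pure (H \<otimes> H) H q b"
      have "counit_id (U \<otimes> U) H (\<lambda>s. npair H s q) (tmap U H (U \<otimes> U) H \<Delta> (\<lambda>v. v) (K ?t))
          = counit_id U H (\<lambda>f. npair H (\<Delta> f) q) (K ?t)"
        using fb q by (simp add: counit_id_tmap)
      also have "\<dots> = counit_id U H (\<lambda>f. f (\<mu> q)) (K ?t)"
        by (rule counit_id_cong) (use fb q in \<open>simp_all add: adj\<close>)
      also have "\<dots> = id_counit H H f (\<Phi> (tmap (H \<otimes> H) H H H \<mu> (\<lambda>w. w) ?P))"
        using fb q by (simp add: K_slice)
      also have "\<dots> = id_counit H H f (tmap H (H \<otimes> H) H H (\<lambda>w. w) \<mu> (assoc H H H (br12 H H H \<Phi> (br23 H H H \<Phi> ?P))))"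
        using fb q by (simp only: cm[of ?P] pure_in_tensor vH vspace_tensor)
      also have "\<dots> = id_counit H (H \<otimes> H) (\<lambda>p. f (\<mu> p)) (assoc H H H (br12 H H H \<Phi> (br23 H H H \<Phi> ?P)))"
        using fb q by (simp add: id_counit_tmap)
      also have "\<dots> = id_counit H (H \<otimes> H) (npair H (\<Delta> f)) (assoc H H H (br12 H H H \<Phi> (br23 H H H \<Phi> ?P)))"
        by (rule id_counit_cong) (use fb q in \<open>simp_all add: adj\<close>)
      also have "\<dots> = counit_id (U \<otimes> U) H (\<lambda>s. npair H s q)
          (br23 U H U K (br12 H U U K (assoc_inv H U U (tmap H U H (U \<otimes> U) (\<lambda>v. v) \<Delta> ?t))))"
        using fb q by (simp add: HUU_slice)
      finally show "counit_id (U \<otimes> U) H (\<lambda>s. npair H s q) (tmap U H (U \<otimes> U) H \<Delta> (\<lambda>v. v) (K ?t))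
          = counit_id (U \<otimes> U) H (\<lambda>s. npair H s q)
            (br23 U H U K (br12 H U U K (assoc_inv H U U (tmap H U H (U \<otimes> U) (\<lambda>v. v) \<Delta> ?t))))" .
    qed (use fb in simp_all)
  qed simp_all
  moreover have "\<forall>t\<in>carr (H \<otimes> U). counit_id U H (\<lambda>f. f e) (K t) = id_counit H U (\<lambda>f. f e) t"
    by (rule tensor_ext[of _ _ H]) (use c in \<open>simp_all add: K_slice compat_mult1_def\<close>)
  ultimately show ?thesis by (simp add: compat_comult2_def)
qed

end

section \<open>The twisted product of a braided algebra\<close>

locale braided_algebra =
  fixes H :: "('k::field, 'h::ab_group_add) vs" and m e \<Psi>
  assumes H: "braided_unital_algebra H m e \<Psi>"
begin

lemma vspace_H [simp]: "vspace H" and lin_m: "lin (H \<otimes> H) H m" and unit_in [simp]: "e \<in> carr H"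
  and braided_H: "braided H \<Psi>" and iso: "lin_iso (H \<otimes> H) (H \<otimes> H) \<Psi>"
  and lin_\<Psi>: "lin (H \<otimes> H) (H \<otimes> H) \<Psi>"
  and yang_baxter: "\<And>t. t \<in> carr (H \<otimes> H \<otimes> H) \<Longrightarrow> br12 H H H \<Psi> (br23 H H H \<Psi> (br12 H H H \<Psi> t))
      = br23 H H H \<Psi> (br12 H H H \<Psi> (br23 H H H \<Psi> t))"
  using H by (auto simp: braided_unital_algebra_def unital_algebra_def braided_def lin_iso_def)

text \<open>If \<open>\<Psi>\<close> is the flip, this is the opposite product.\<close>

definition \<mu> where "\<mu> t = m (\<Psi> t)"

text \<open>What the transposed braidings need of \<open>\<Phi>\<close>: the two mixed Yang-Baxter equations with one crossing \<open>\<Psi>\<close> and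
two crossings \<open>\<Phi>\<close>, and naturality with respect to the product and the unit.\<close>

definition admissible where
  "admissible \<Phi> \<longleftrightarrow> left_braided H \<Psi> H \<Phi> \<and> right_braided H \<Psi> H \<Phi>
     \<and> compat_mult1 H m e H \<Phi> \<and> compat_mult2 H m e H \<Phi>"

lemma admissible_braiding: "admissible \<Psi>"
  using H by (simp add: admissible_def left_braided_def right_braided_def braided_unital_algebra_def braided_def)

text \<open>Every axiom of \<open>\<Psi>\<close> is turned into one of its inverse by moving crossings to the other side. The two
compatibilities with the product are exchanged, since inverting a crossing exchanges its strands.\<close>

lemma admissible_inverse: "admissible (Psi_inv H \<Psi>)"
proof -
  let ?\<Phi> = "Psi_inv H \<Psi>"
  have iso': "lin_iso (H \<otimes> H) (H \<otimes> H) ?\<Phi>" unfolding Psi_inv_def by (rule lin_iso_inv[OF _ iso]) simp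
  then have l: "lin (H \<otimes> H) (H \<otimes> H) ?\<Phi>" by (simp add: lin_iso_def)
  have inv1: "?\<Phi> (\<Psi> t) = t" and inv2: "\<Psi> (?\<Phi> t) = t" if "t \<in> carr (H \<otimes> H)" for t
    using iso that f_inv_into_f[of t \<Psi> "carr (H \<otimes> H)"] by (simp_all add: Psi_inv_def lin_iso_def bij_betw_def)
  note [simp] = lin_\<Psi> l lin_m lin_in[OF lin_\<Psi>] lin_in[OF l] lin_in[OF lin_m]
  have i12: "br12 H H H ?\<Phi> (br12 H H H \<Psi> t) = t" "br12 H H H \<Psi> (br12 H H H ?\<Phi> t) = t"
    if "t \<in> carr (H \<otimes> H \<otimes> H)" for t
    by (rule br12_inverse; simp add: that inv1 inv2)+
  have i23: "br23 H H H ?\<Phi> (br23 H H H \<Psi> t) = t" "br23 H H H \<Psi> (br23 H H H ?\<Phi> t) = t"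
    if "t \<in> carr (H \<otimes> H \<otimes> H)" for t
    by (rule br23_inverse; simp add: that inv1 inv2)+
  have "left_braided H \<Psi> H ?\<Phi>"
    unfolding left_braided_def
  proof (intro conjI ballI braided_H vspace_H iso')
    fix t assume t: "t \<in> carr (H \<otimes> H \<otimes> H)"
    define u where "u = br12 H H H ?\<Phi> (br23 H H H ?\<Phi> t)"
    have u: "u \<in> carr (H \<otimes> H \<otimes> H)" "t = br23 H H H \<Psi> (br12 H H H \<Psi> u)"
      using t by (simp_all add: u_def i12 i23)
    show "br12 H H H ?\<Phi> (br23 H H H ?\<Phi> (br12 H H H \<Psi> t)) = br23 H H H \<Psi> (br12 H H H ?\<Phi> (br23 H H H ?\<Phi> t))"
      unfolding u(2) using u(1) by (simp add: yang_baxter i12 i23)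
  qed
  moreover have "right_braided H \<Psi> H ?\<Phi>"
    unfolding right_braided_def
  proof (intro conjI ballI braided_H vspace_H iso')
    fix t assume t: "t \<in> carr (H \<otimes> H \<otimes> H)"
    define u where "u = br23 H H H ?\<Phi> (br12 H H H ?\<Phi> t)"
    have u: "u \<in> carr (H \<otimes> H \<otimes> H)" "t = br12 H H H \<Psi> (br23 H H H \<Psi> u)"
      using t by (simp_all add: u_def i12 i23)
    show "br23 H H H ?\<Phi> (br12 H H H ?\<Phi> (br23 H H H \<Psi> t)) = br12 H H H \<Psi> (br23 H H H ?\<Phi> (br12 H H H ?\<Phi> t))"
      unfolding u(2) using u(1) by (simp add: yang_baxter[symmetric] i12 i23)
  qed
  moreover have "compat_mult1 H m e H ?\<Phi>"
    unfolding compat_mult1_def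
  proof (intro conjI ballI)
    fix t assume t: "t \<in> carr (H \<otimes> H \<otimes> H)"
    let ?u = "br12 H H H ?\<Phi> (br23 H H H ?\<Phi> t)"
    have "\<Psi> (tmap H (H \<otimes> H) H H (\<lambda>x. x) m (assoc H H H ?u))
        = tmap (H \<otimes> H) H H H m (\<lambda>x. x) (br23 H H H \<Psi> (br12 H H H \<Psi> ?u))"
      using H t by (simp add: braided_unital_algebra_def compat_mult2_def)
    then have "\<Psi> (tmap H (H \<otimes> H) H H (\<lambda>x. x) m (assoc H H H ?u)) = tmap (H \<otimes> H) H H H m (\<lambda>x. x) t"
      using t by (simp add: i12 i23)
    then show "?\<Phi> (tmap (H \<otimes> H) H H H m (\<lambda>w. w) t) = tmap H (H \<otimes> H) H H (\<lambda>w. w) m (assoc H H H ?u)"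
      using t by (metis inv1 assoc_in br12_in br23_in l lin_id lin_m tmap_in vspace_H vspace_tensor)
  next
    fix w assume w: "w \<in> carr H"
    then have "\<Psi> (pure H H w e) = pure H H e w" using H by (simp add: braided_unital_algebra_def compat_mult2_def)
    then show "?\<Phi> (pure H H e w) = pure H H w e" using inv1[of "pure H H w e"] w by simp
  qed
  moreover have "compat_mult2 H m e H ?\<Phi>"
    unfolding compat_mult2_def
  proof (intro conjI ballI)
    fix t assume t: "t \<in> carr (H \<otimes> H \<otimes> H)"
    let ?u = "br23 H H H ?\<Phi> (br12 H H H ?\<Phi> t)"
    have "\<Psi> (tmap (H \<otimes> H) H H H m (\<lambda>x. x) ?u)
        = tmap H (H \<otimes> H) H H (\<lambda>x. x) m (assoc H H H (br12 H H H \<Psi> (br23 H H H \<Psi> ?u)))"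
      using H t by (simp add: braided_unital_algebra_def compat_mult1_def)
    then have "\<Psi> (tmap (H \<otimes> H) H H H m (\<lambda>x. x) ?u) = tmap H (H \<otimes> H) H H (\<lambda>x. x) m (assoc H H H t)"
      using t by (simp add: i12 i23)
    then show "?\<Phi> (tmap H (H \<otimes> H) H H (\<lambda>v. v) m (assoc H H H t)) = tmap (H \<otimes> H) H H H m (\<lambda>v. v) ?u"
      using t by (metis inv1 br12_in br23_in l lin_id lin_m tmap_in vspace_H vspace_tensor)
  next
    fix w assume w: "w \<in> carr H"
    then have "\<Psi> (pure H H e w) = pure H H w e" using H by (simp add: braided_unital_algebra_def compat_mult1_def)
    then show "?\<Phi> (pure H H w e) = pure H H e w" using inv1[of "pure H H e w"] w by simp
  qed
  ultimately show ?thesis by (simp add: admissible_def)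
qed

lemma lin_\<mu> [simp]: "lin (H \<otimes> H) H \<mu>"
  unfolding \<mu>_def[abs_def] by (rule lin_comp[OF lin_m lin_\<Psi>])

lemma \<mu>_left: "t \<in> carr (H \<otimes> H \<otimes> H)
    \<Longrightarrow> tmap (H \<otimes> H) H H H \<mu> (\<lambda>x. x) t = tmap (H \<otimes> H) H H H m (\<lambda>x. x) (br12 H H H \<Psi> t)"
proof -
  assume t: "t \<in> carr (H \<otimes> H \<otimes> H)"
  note [simp] = lin_\<Psi> lin_m lin_in[OF lin_\<Psi>] lin_in[OF lin_m]
  have "\<forall>t\<in>carr (H \<otimes> H \<otimes> H). tmap (H \<otimes> H) H H H \<mu> (\<lambda>x. x) t = tmap (H \<otimes> H) H H H m (\<lambda>x. x) (br12 H H H \<Psi> t)"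
    by (rule tensor_ext[of _ _ "H \<otimes> H"]) (simp_all add: \<mu>_def)
  then show ?thesis using t by blast
qed

lemma \<mu>_right: "t \<in> carr (H \<otimes> H \<otimes> H)
    \<Longrightarrow> tmap H (H \<otimes> H) H H (\<lambda>x. x) \<mu> (assoc H H H t)
      = tmap H (H \<otimes> H) H H (\<lambda>x. x) m (assoc H H H (br23 H H H \<Psi> t))"
proof -
  assume t: "t \<in> carr (H \<otimes> H \<otimes> H)"
  note [simp] = lin_\<Psi> lin_m lin_in[OF lin_\<Psi>] lin_in[OF lin_m]
  have "\<forall>t\<in>carr (H \<otimes> H \<otimes> H). tmap H (H \<otimes> H) H H (\<lambda>x. x) \<mu> (assoc H H H t)
      = tmap H (H \<otimes> H) H H (\<lambda>x. x) m (assoc H H H (br23 H H H \<Psi> t))"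
    by (rule tensor_ext3[of _ _ _ "H \<otimes> H"]) (simp_all add: \<mu>_def)
  then show ?thesis using t by blast
qed

text \<open>The two products of three factors are \<open>m (m \<otimes> id)\<close> applied to the two sides of the Yang-Baxter equation:
\<open>\<Psi>\<close> is moved past \<open>m\<close> on the left by one compatibility condition and on the right by the other.\<close>

lemma unital_algebra_\<mu>: "unital_algebra H \<mu> e"
  unfolding unital_algebra_def
proof (intro conjI ballI vspace_H lin_\<mu> unit_in)
  note [simp] = lin_\<Psi> lin_m lin_in[OF lin_\<Psi>] lin_in[OF lin_m]
  fix t assume t: "t \<in> carr (H \<otimes> H \<otimes> H)"
  have "\<mu> (tmap (H \<otimes> H) H H H \<mu> (\<lambda>x. x) t)
      = m (tmap H (H \<otimes> H) H H (\<lambda>x. x) m (assoc H H H (br12 H H H \<Psi> (br23 H H H \<Psi> (br12 H H H \<Psi> t)))))"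
    using H t by (simp add: \<mu>_left \<mu>_def[of "tmap _ _ _ _ _ _ _"] braided_unital_algebra_def compat_mult1_def)
  also have "\<dots> = m (tmap (H \<otimes> H) H H H m (\<lambda>x. x) (br23 H H H \<Psi> (br12 H H H \<Psi> (br23 H H H \<Psi> t))))"
    using H t by (simp add: yang_baxter braided_unital_algebra_def unital_algebra_def)
  also have "\<dots> = \<mu> (tmap H (H \<otimes> H) H H (\<lambda>x. x) \<mu> (assoc H H H t))"
    using H t by (simp add: \<mu>_right \<mu>_def[of "tmap _ _ _ _ _ _ _"] braided_unital_algebra_def compat_mult2_def)
  finally show "\<mu> (tmap (H \<otimes> H) H H H \<mu> (\<lambda>x. x) t) = \<mu> (tmap H (H \<otimes> H) H H (\<lambda>x. x) \<mu> (assoc H H H t))" .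
next
  fix x assume x: "x \<in> carr H"
  show "\<mu> (pure H H e x) = x" "\<mu> (pure H H x e) = x"
    using H x by (simp_all add: \<mu>_def braided_unital_algebra_def compat_mult1_def compat_mult2_def unital_algebra_def)
qed

text \<open>The crossing inside \<open>\<mu>\<close> is moved through the two crossings \<open>\<Phi>\<close> by a mixed Yang-Baxter equation.\<close>

lemma admissible_compat_\<mu>:
  assumes "admissible \<Phi>"
  shows "compat_mult1 H \<mu> e H \<Phi>" "compat_mult2 H \<mu> e H \<Phi>"
proof -
  have l: "lin (H \<otimes> H) (H \<otimes> H) \<Phi>" using assms by (simp add: admissible_def left_braided_def lin_iso_def)
  note [simp] = lin_\<Psi> lin_m lin_in[OF lin_\<Psi>] lin_in[OF lin_m] l lin_in[OF l]
  show "compat_mult1 H \<mu> e H \<Phi>"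
    using assms unfolding compat_mult1_def by (simp add: admissible_def compat_mult1_def left_braided_def \<mu>_left \<mu>_right)
  show "compat_mult2 H \<mu> e H \<Phi>"
    using assms unfolding compat_mult2_def by (simp add: admissible_def compat_mult2_def right_braided_def \<mu>_left \<mu>_right)
qed

end

section \<open>The induced braidings as transposes\<close>

context space_of_functionals
begin

lemma
  shows lin_emb_UU: "lin (U \<otimes> U) (dual (H \<otimes> H)) (emb_UU H U)"
    and emb_UU_pure: "t \<in> carr (U \<otimes> U) \<Longrightarrow> x \<in> carr H \<Longrightarrow> y \<in> carr H
      \<Longrightarrow> emb_UU H U t (pure H H x y) = npair H t (pure H H y x)"
proof -
  show l: "lin (U \<otimes> U) (dual (H \<otimes> H)) (emb_UU H U)"
    unfolding emb_UU_def by (rule lin_quadrilinear_lift) simp_all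
  have p: "emb_UU H U (pure U U f g) (pure H H x y) = f x * g y"
    if "f \<in> carr U" "g \<in> carr U" "x \<in> carr H" "y \<in> carr H" for f g x y
    unfolding emb_UU_def by (rule quadrilinear_lift_pure) (use that in simp_all)
  assume t: "t \<in> carr (U \<otimes> U)" and xy: "x \<in> carr H" "y \<in> carr H"
  have "\<forall>t\<in>carr (U \<otimes> U). emb_UU H U t (pure H H x y) = npair H t (pure H H y x)"
    by (rule tensor_ext[of _ _ scalars]) (use xy p in \<open>simp_all add: lin_dual_apply[OF l]\<close>)
  then show "emb_UU H U t (pure H H x y) = npair H t (pure H H y x)" using t by blast
qed

lemma
  shows lin_emb_HU: "lin (H \<otimes> U) (dual (dual H \<otimes> H)) (emb_HU H U)"
    and emb_HU_pure: "t \<in> carr (H \<otimes> U) \<Longrightarrow> f \<in> carr (dual H) \<Longrightarrow> b \<in> carr H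
      \<Longrightarrow> emb_HU H U t (pure (dual H) H f b) = f (id_counit H U (\<lambda>f. f b) t)"
proof -
  note [simp] = dual_lin lin_dual_apply[OF lin_id]
  show l: "lin (H \<otimes> U) (dual (dual H \<otimes> H)) (emb_HU H U)"
    unfolding emb_HU_def by (rule lin_quadrilinear_lift) simp_all
  have p: "emb_HU H U (pure H U a g) (pure (dual H) H f b) = f a * g b"
    if "a \<in> carr H" "g \<in> carr U" "f \<in> carr (dual H)" "b \<in> carr H" for a g f b
    unfolding emb_HU_def by (rule quadrilinear_lift_pure) (use that in simp_all)
  assume t: "t \<in> carr (H \<otimes> U)" and fb: "f \<in> carr (dual H)" "b \<in> carr H"
  have "\<forall>t\<in>carr (H \<otimes> U). emb_HU H U t (pure (dual H) H f b) = f (id_counit H U (\<lambda>f. f b) t)"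
    by (rule tensor_ext[of _ _ scalars])
      (use fb p in \<open>simp_all add: lin_dual_apply[OF l] lin_comp[OF dual_lin[of f H]] lin_scale[OF dual_lin[of f H]] mult.commute\<close>)
  then show "emb_HU H U t (pure (dual H) H f b) = f (id_counit H U (\<lambda>f. f b) t)" using t by blast
qed

lemma
  shows lin_emb_UH: "lin (U \<otimes> H) (dual (H \<otimes> dual H)) (emb_UH H U)"
    and emb_UH_pure: "t \<in> carr (U \<otimes> H) \<Longrightarrow> f \<in> carr (dual H) \<Longrightarrow> b \<in> carr H
      \<Longrightarrow> emb_UH H U t (pure H (dual H) b f) = f (counit_id U H (\<lambda>f. f b) t)"
proof -
  note [simp] = dual_lin lin_dual_apply[OF lin_id]
  show l: "lin (U \<otimes> H) (dual (H \<otimes> dual H)) (emb_UH H U)"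
    unfolding emb_UH_def by (rule lin_quadrilinear_lift) simp_all
  have p: "emb_UH H U (pure U H g a) (pure H (dual H) b f) = g b * f a"
    if "a \<in> carr H" "g \<in> carr U" "f \<in> carr (dual H)" "b \<in> carr H" for a g f b
    unfolding emb_UH_def by (rule quadrilinear_lift_pure) (use that in simp_all)
  assume t: "t \<in> carr (U \<otimes> H)" and fb: "f \<in> carr (dual H)" "b \<in> carr H"
  have "\<forall>t\<in>carr (U \<otimes> H). emb_UH H U t (pure H (dual H) b f) = f (counit_id U H (\<lambda>f. f b) t)"
    by (rule tensor_ext[of _ _ scalars])
      (use fb p in \<open>simp_all add: lin_dual_apply[OF l] lin_comp[OF dual_lin[of f H]] lin_scale[OF dual_lin[of f H]]\<close>)
  then show "emb_UH H U t (pure H (dual H) b f) = f (counit_id U H (\<lambda>f. f b) t)" using t by blast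
qed

lemma Psi_UU_iso_adjoint:
  assumes l: "lin (H \<otimes> H) (H \<otimes> H) \<Phi>" and bij: "bij_UU H \<Phi> U"
  shows "lin_iso (U \<otimes> U) (U \<otimes> U) (Psi_UU H \<Phi> U)"
    and "s \<in> carr (U \<otimes> U) \<Longrightarrow> p \<in> carr (H \<otimes> H) \<Longrightarrow> npair H (Psi_UU H \<Phi> U s) p = npair H s (\<Phi> p)"
proof -
  note [simp] = lin_comp[OF l] lin_in[OF l]
  have D: "lin (U \<otimes> U) (dual (H \<otimes> H)) (dPsi_UU H \<Phi> U)"
    unfolding dPsi_UU_def pure_UU by (rule lin_quadrilinear_lift) simp_all
  have Dp: "dPsi_UU H \<Phi> U (pure U U f g) (pure H H b a) = npair H (pure U U f g) (\<Phi> (pure H H a b))"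
    if "f \<in> carr U" "g \<in> carr U" "a \<in> carr H" "b \<in> carr H" for f g a b
    unfolding dPsi_UU_def pure_UU by (rule quadrilinear_lift_pure) (use that in simp_all)
  have inj: "inj_on (emb_UU H U) (carr (U \<otimes> U))"
  proof (rule inj_onI)
    fix s t assume "s \<in> carr (U \<otimes> U)" "t \<in> carr (U \<otimes> U)" "emb_UU H U s = emb_UU H U t"
    then show "s = t" by (intro UU_eqI) (simp_all add: emb_UU_pure[symmetric])
  qed
  note I = lin_iso_inv_into[OF vspace_tensor vspace_tensor lin_emb_UU inj D bij[unfolded bij_UU_def],
      folded Psi_UU_def]
  show iso: "lin_iso (U \<otimes> U) (U \<otimes> U) (Psi_UU H \<Phi> U)" using I(1) .
  then have K: "lin (U \<otimes> U) (U \<otimes> U) (Psi_UU H \<Phi> U)" by (simp add: lin_iso_def)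
  note [simp] = K lin_comp[OF K] lin_in[OF K]
  assume s: "s \<in> carr (U \<otimes> U)" and p: "p \<in> carr (H \<otimes> H)"
  have 1: "\<forall>s\<in>carr (U \<otimes> U). npair H (Psi_UU H \<Phi> U s) (pure H H a b) = npair H s (\<Phi> (pure H H a b))"
    if "a \<in> carr H" "b \<in> carr H" for a b
  proof (rule tensor_ext[of _ _ scalars])
    fix f g assume "f \<in> carr U" "g \<in> carr U"
    then show "npair H (Psi_UU H \<Phi> U (pure U U f g)) (pure H H a b) = npair H (pure U U f g) (\<Phi> (pure H H a b))"
      using that by (simp add: emb_UU_pure[symmetric] I(2) Dp)
  qed (use that in simp_all)
  have "\<forall>p\<in>carr (H \<otimes> H). npair H (Psi_UU H \<Phi> U s) p = npair H s (\<Phi> p)"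
    by (rule tensor_ext[of _ _ scalars]) (use 1 s l in simp_all)
  then show "npair H (Psi_UU H \<Phi> U s) p = npair H s (\<Phi> p)" using p by blast
qed

text \<open>The embedding into the dual of \<open>H' \<otimes> H\<close> tests an element of \<open>H \<otimes> U\<close> with all functionals on \<open>H\<close>; as these
separate the points of \<open>H\<close>, they can be dropped from the defining equation of \<open>\<Psi>\<^sub>U\<^sub>H\<close>, which leaves an equation
between elements of \<open>H\<close>.\<close>

lemma Psi_UH_iso_transposed:
  assumes l: "lin (H \<otimes> H) (H \<otimes> H) \<Phi>" and bij: "bij_UH H \<Phi> U"
  shows "lin_iso (U \<otimes> H) (H \<otimes> U) (Psi_UH H \<Phi> U)" and "left_transposed H U \<Phi> (Psi_UH H \<Phi> U)"
proof -
  interpret D: space_of_functionals H "dual H" by (rule space_of_functionals_dual) simp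
  note [simp] = lin_comp[OF l] lin_in[OF l]
  note [simp] = subsetD[OF U_dual]
  have idU: "lin U (dual H) (\<lambda>f. f)" using U_dual by (auto intro: linI)
  have D: "lin (U \<otimes> H) (dual (dual H \<otimes> H)) (dPsi_UH H \<Phi> U)"
    unfolding dPsi_UH_def by (rule lin_quadrilinear_lift) (simp_all add: idU)
  have Dp: "dPsi_UH H \<Phi> U (pure U H g a) (pure (dual H) H f b)
      = npair H (pure (dual H) (dual H) f g) (\<Phi> (pure H H a b))"
    if "f \<in> carr (dual H)" "g \<in> carr U" "a \<in> carr H" "b \<in> carr H" for f g a b
    unfolding dPsi_UH_def by (rule quadrilinear_lift_pure) (use that in \<open>simp_all add: idU\<close>)
  have sep: "x = y" if "x \<in> carr H" "y \<in> carr H" "\<And>f. f \<in> carr (dual H) \<Longrightarrow> f x = f y" for x y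
    using dual_separates[of H "x - y"] that by (simp add: vspace_diff lin_diff[OF vH D.U_lin])
  have inj: "inj_on (emb_HU H U) (carr (H \<otimes> U))"
  proof (rule inj_onI)
    fix s t assume st: "s \<in> carr (H \<otimes> U)" "t \<in> carr (H \<otimes> U)" "emb_HU H U s = emb_HU H U t"
    have ev: "f (id_counit H U (\<lambda>f. f b) s) = f (id_counit H U (\<lambda>f. f b) t)" if "f \<in> carr (dual H)" "b \<in> carr H" for f b
      using emb_HU_pure[OF st(1) that] emb_HU_pure[OF st(2) that] st(3) by simp
    show "s = t"
    proof (rule eq_right_evaluation)
      fix b assume b: "b \<in> carr H"
      show "id_counit H U (\<lambda>f. f b) s = id_counit H U (\<lambda>f. f b) t"
        by (rule sep) (use st b in simp, use st b in simp, rule ev[OF _ b])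
    qed (use st in simp_all)
  qed
  note I = lin_iso_inv_into[OF vspace_tensor vspace_tensor lin_emb_HU inj D bij[unfolded bij_UH_def],
      folded Psi_UH_def]
  show iso: "lin_iso (U \<otimes> H) (H \<otimes> U) (Psi_UH H \<Phi> U)" using I(1) .
  then have K: "lin (U \<otimes> H) (H \<otimes> U) (Psi_UH H \<Phi> U)" by (simp add: lin_iso_def)
  note [simp] = K lin_comp[OF K] lin_in[OF K]
  show "left_transposed H U \<Phi> (Psi_UH H \<Phi> U)"
  proof (unfold_locales, rule l, rule K)
    fix g a b assume gab: "g \<in> carr U" "a \<in> carr H" "b \<in> carr H"
    have "f (id_counit H U (\<lambda>f. f b) (Psi_UH H \<Phi> U (pure U H g a))) = f (counit_id H H g (\<Phi> (pure H H a b)))"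
      if f: "f \<in> carr (dual H)" for f
    proof -
      have "f (id_counit H U (\<lambda>f. f b) (Psi_UH H \<Phi> U (pure U H g a)))
          = emb_HU H U (Psi_UH H \<Phi> U (pure U H g a)) (pure (dual H) H f b)"
        using gab f by (intro emb_HU_pure[symmetric]) simp_all
      also have "\<dots> = npair H (pure (dual H) (dual H) f g) (\<Phi> (pure H H a b))"
        using gab f by (simp add: I(2) Dp)
      also have "\<dots> = f (counit_id H H g (\<Phi> (pure H H a b)))"
        using gab f by (intro D.npair_counit_id) simp_all
      finally show ?thesis .
    qed
    then show "id_counit H U (\<lambda>f. f b) (Psi_UH H \<Phi> U (pure U H g a)) = counit_id H H g (\<Phi> (pure H H a b))"
      using gab by (intro sep) simp_all
  qed
qed

lemma Psi_HU_iso_transposed: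
  assumes l: "lin (H \<otimes> H) (H \<otimes> H) \<Phi>" and bij: "bij_HU H \<Phi> U"
  shows "lin_iso (H \<otimes> U) (U \<otimes> H) (Psi_HU H \<Phi> U)" and "right_transposed H U \<Phi> (Psi_HU H \<Phi> U)"
proof -
  interpret D: space_of_functionals H "dual H" by (rule space_of_functionals_dual) simp
  note [simp] = lin_comp[OF l] lin_in[OF l]
  note [simp] = subsetD[OF U_dual]
  have idU: "lin U (dual H) (\<lambda>f. f)" using U_dual by (auto intro: linI)
  have D: "lin (H \<otimes> U) (dual (H \<otimes> dual H)) (dPsi_HU H \<Phi> U)"
    unfolding dPsi_HU_def by (rule lin_quadrilinear_lift) (simp_all add: idU)
  have Dp: "dPsi_HU H \<Phi> U (pure H U b f) (pure H (dual H) a g)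
      = npair H (pure (dual H) (dual H) f g) (\<Phi> (pure H H a b))"
    if "f \<in> carr U" "g \<in> carr (dual H)" "a \<in> carr H" "b \<in> carr H" for f g a b
    unfolding dPsi_HU_def by (rule quadrilinear_lift_pure) (use that in \<open>simp_all add: idU\<close>)
  have sep: "x = y" if "x \<in> carr H" "y \<in> carr H" "\<And>f. f \<in> carr (dual H) \<Longrightarrow> f x = f y" for x y
    using dual_separates[of H "x - y"] that by (simp add: vspace_diff lin_diff[OF vH D.U_lin])
  have inj: "inj_on (emb_UH H U) (carr (U \<otimes> H))"
  proof (rule inj_onI)
    fix s t assume st: "s \<in> carr (U \<otimes> H)" "t \<in> carr (U \<otimes> H)" "emb_UH H U s = emb_UH H U t"
    have ev: "f (counit_id U H (\<lambda>f. f b) s) = f (counit_id U H (\<lambda>f. f b) t)" if "f \<in> carr (dual H)" "b \<in> carr H" for f b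
      using emb_UH_pure[OF st(1) that] emb_UH_pure[OF st(2) that] st(3) by simp
    show "s = t"
    proof (rule eq_left_evaluation)
      fix b assume b: "b \<in> carr H"
      show "counit_id U H (\<lambda>f. f b) s = counit_id U H (\<lambda>f. f b) t"
        by (rule sep) (use st b in simp, use st b in simp, rule ev[OF _ b])
    qed (use st in simp_all)
  qed
  note I = lin_iso_inv_into[OF vspace_tensor vspace_tensor lin_emb_UH inj D bij[unfolded bij_HU_def],
      folded Psi_HU_def]
  show iso: "lin_iso (H \<otimes> U) (U \<otimes> H) (Psi_HU H \<Phi> U)" using I(1) .
  then have K: "lin (H \<otimes> U) (U \<otimes> H) (Psi_HU H \<Phi> U)" by (simp add: lin_iso_def)
  note [simp] = K lin_comp[OF K] lin_in[OF K]
  show "right_transposed H U \<Phi> (Psi_HU H \<Phi> U)"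
  proof (unfold_locales, rule l, rule K)
    fix b f a assume bfa: "b \<in> carr H" "f \<in> carr U" "a \<in> carr H"
    have "g (counit_id U H (\<lambda>f. f a) (Psi_HU H \<Phi> U (pure H U b f))) = g (id_counit H H f (\<Phi> (pure H H a b)))"
      if g: "g \<in> carr (dual H)" for g
    proof -
      have "g (counit_id U H (\<lambda>f. f a) (Psi_HU H \<Phi> U (pure H U b f)))
          = emb_UH H U (Psi_HU H \<Phi> U (pure H U b f)) (pure H (dual H) a g)"
        using bfa g by (intro emb_UH_pure[symmetric]) simp_all
      also have "\<dots> = npair H (pure (dual H) (dual H) f g) (\<Phi> (pure H H a b))"
        using bfa g by (simp add: I(2) Dp)
      also have "\<dots> = g (id_counit H H f (\<Phi> (pure H H a b)))"
        using bfa g by (intro D.npair_id_counit) simp_all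
      finally show ?thesis .
    qed
    then show "counit_id U H (\<lambda>f. f a) (Psi_HU H \<Phi> U (pure H U b f)) = id_counit H H f (\<Phi> (pure H H a b))"
      using bfa by (intro sep) simp_all
  qed
qed

end

section \<open>The largest coalgebra in the dual\<close>

lemma carr_fspace [simp]: "carr (fspace S) = S" and scal_fspace [simp]: "scal (fspace S) = (\<lambda>c \<phi> x. c * \<phi> x)"
  by (simp_all add: fspace_def)

context braided_algebra
begin

text \<open>On a subspace closed under it, the coproduct is well defined, because the nested pairing is
nondegenerate on \<open>H' \<otimes> H'\<close>, and it is the transpose of \<open>\<mu>\<close>.\<close>

lemma closed_dual_coalgebra:
  assumes S: "S \<subseteq> carr (dual H)" "vspace (fspace S)" "coprod_closed H m \<Psi> S"
  shows "dual_coalgebra H (fspace S) \<mu> e (coprod H m \<Psi>)"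
proof -
  interpret D: space_of_functionals H "dual H" by (rule space_of_functionals_dual) simp
  interpret U: space_of_functionals H "fspace S" using S by unfold_locales auto
  let ?\<Delta> = "coprod H m \<Psi>"
  have \<Delta>: "?\<Delta> f \<in> carr (fspace S \<otimes> fspace S) \<and> represents_coprod H m \<Psi> f (?\<Delta> f)" if f: "f \<in> S" for f
  proof -
    obtain t where t: "t \<in> carr (fspace S \<otimes> fspace S)" "represents_coprod H m \<Psi> f t"
      using S(3) f by (auto simp: coprod_closed_def)
    have "?\<Delta> f = t"
      unfolding coprod_def
    proof (rule the_equality)
      show "t \<in> carr (dual H \<otimes> dual H) \<and> represents_coprod H m \<Psi> f t" using t U.UU_subset by blast
      show "t' = t" if "t' \<in> carr (dual H \<otimes> dual H) \<and> represents_coprod H m \<Psi> f t'" for t'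
        using that t U.UU_subset by (intro D.UU_eqI) (auto simp: represents_coprod_def)
    qed
    then show ?thesis using t by simp
  qed
  have adj: "npair H (?\<Delta> f) p = f (\<mu> p)" if f: "f \<in> S" and p: "p \<in> carr (H \<otimes> H)" for f p
  proof -
    have "\<forall>p\<in>carr (H \<otimes> H). npair H (?\<Delta> f) p = f (\<mu> p)"
      by (rule tensor_ext[of _ _ scalars]) (use f \<Delta>[OF f] in \<open>simp_all add: represents_coprod_def \<mu>_def[symmetric]\<close>)
    then show ?thesis using p by blast
  qed
  have "lin (fspace S) (fspace S \<otimes> fspace S) ?\<Delta>"
  proof (rule linI)
    show "?\<Delta> f \<in> carr (fspace S \<otimes> fspace S)" if "f \<in> carr (fspace S)" for f using \<Delta> that by simp
    show "?\<Delta> (f + g) = ?\<Delta> f + ?\<Delta> g" if "f \<in> carr (fspace S)" "g \<in> carr (fspace S)" for f g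
      by (rule U.UU_eqI_tensor)
        (use that \<Delta> adj vspace_add[OF S(2), of f g] in
          \<open>simp_all add: vspace_add[OF vspace_tensor] lin_add[OF U.lin_npair1[OF lin_id]]\<close>)
    show "?\<Delta> (scal (fspace S) c f) = scal (fspace S \<otimes> fspace S) c (?\<Delta> f)" if "f \<in> carr (fspace S)" for c f
      by (rule U.UU_eqI_tensor)
        (use that \<Delta> adj vspace_scale[OF S(2), of f c] in
          \<open>simp_all add: vspace_scale[OF vspace_tensor] lin_scale[OF U.lin_npair1[OF lin_id]]\<close>)
  qed
  then show ?thesis
    using unital_algebra_\<mu> adj by (intro dual_coalgebra.intro dual_coalgebra_axioms.intro U.space_of_functionals_axioms) simp_all
qed

lemma coalgebra_in_dual_iff_closed:
  "coalgebra_in_dual H m e \<Psi> C \<longleftrightarrow> C \<subseteq> carr (dual H) \<and> vspace (fspace C) \<and> coprod_closed H m \<Psi> C"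
  using closed_dual_coalgebra[of C] dual_coalgebra.coalgebra by (auto simp: coalgebra_in_dual_def)

text \<open>Let \<open>S\<close> be the span. Since \<open>C \<otimes> C \<subseteq> S \<otimes> S\<close> for each of the coalgebras \<open>C\<close>, their elements have their
coproduct in \<open>S \<otimes> S\<close>; the functionals with this property form a subspace, which therefore contains \<open>S\<close>.\<close>

lemma coalgebra_in_dual_span_Union:
  assumes "\<And>C. C \<in> \<C> \<Longrightarrow> coalgebra_in_dual H m e \<Psi> C"
  shows "coalgebra_in_dual H m e \<Psi> (module.span (\<lambda>c \<phi> x. c * \<phi> x) (\<Union>\<C>))"
proof -
  interpret F: vector_space "\<lambda>(c::'k) \<phi> (x::'h). c * \<phi> x" by (rule vector_space_fun)
  let ?S = "F.span (\<Union>\<C>)"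
  have sub: "F.subspace (carr (dual H))" using vspace_dual[of H] by (simp add: vspace_def dual_def)
  have S: "?S \<subseteq> carr (dual H)"
    using assms sub by (intro F.span_minimal) (auto simp: coalgebra_in_dual_def)
  have v: "vspace (fspace ?S)" by (simp add: vspace_def F.vector_space_axioms)
  interpret U: space_of_functionals H "fspace ?S" using S v by unfold_locales auto
  let ?R = "{f. \<exists>t\<in>carr (fspace ?S \<otimes> fspace ?S). represents_coprod H m \<Psi> f t}"
  have "F.subspace ?R"
  proof (rule F.subspaceI)
    show "0 \<in> ?R"
      using vspace_zero[OF vspace_tensor[of "fspace ?S" "fspace ?S"]] lin_zero[OF _ _ U.lin_npair1[OF lin_id]]
      by (auto simp: represents_coprod_def intro!: bexI[of _ 0])
    show "f + g \<in> ?R" if fg: "f \<in> ?R" "g \<in> ?R" for f g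
    proof -
      obtain s t where "s \<in> carr (fspace ?S \<otimes> fspace ?S)" "represents_coprod H m \<Psi> f s"
        "t \<in> carr (fspace ?S \<otimes> fspace ?S)" "represents_coprod H m \<Psi> g t" using fg by blast
      then show ?thesis
        by (auto simp: represents_coprod_def vspace_add[OF vspace_tensor] lin_add[OF U.lin_npair1[OF lin_id]]
            intro!: bexI[of _ "s + t"])
    qed
    show "(\<lambda>x. c * f x) \<in> ?R" if f: "f \<in> ?R" for c f
    proof -
      obtain t where "t \<in> carr (fspace ?S \<otimes> fspace ?S)" "represents_coprod H m \<Psi> f t" using f by blast
      then show ?thesis
        by (auto simp: represents_coprod_def vspace_scale[OF vspace_tensor] lin_scale[OF U.lin_npair1[OF lin_id]]
            intro!: bexI[of _ "scal (fspace ?S \<otimes> fspace ?S) c t"])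
    qed
  qed
  moreover have "\<Union>\<C> \<subseteq> ?R"
  proof
    fix f assume "f \<in> \<Union>\<C>"
    then obtain C where C: "C \<in> \<C>" "f \<in> C" by blast
    then obtain t where "t \<in> carr (fspace C \<otimes> fspace C)" "represents_coprod H m \<Psi> f t"
      using assms[OF C(1)] by (auto simp: coalgebra_in_dual_def coprod_closed_def)
    moreover have "C \<subseteq> ?S" using C F.span_superset by blast
    then have "carr (fspace C \<otimes> fspace C) \<subseteq> carr (fspace ?S \<otimes> fspace ?S)" by (intro tensor_mono) simp_all
    ultimately show "f \<in> ?R" by blast
  qed
  ultimately have "?S \<subseteq> ?R" by (rule F.span_minimal[rotated])
  then have "coprod_closed H m \<Psi> ?S" unfolding coprod_closed_def by blast
  then show ?thesis using S v by (simp add: coalgebra_in_dual_iff_closed)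
qed

lemma largest_coalgebra_in_dual:
  "\<exists>C. coalgebra_in_dual H m e \<Psi> C \<and> (\<forall>D. coalgebra_in_dual H m e \<Psi> D \<longrightarrow> D \<subseteq> C)"
proof (intro exI conjI allI impI)
  interpret F: vector_space "\<lambda>(c::'k) \<phi> (x::'h). c * \<phi> x" by (rule vector_space_fun)
  let ?\<C> = "{C. coalgebra_in_dual H m e \<Psi> C}"
  show "coalgebra_in_dual H m e \<Psi> (F.span (\<Union>?\<C>))" by (rule coalgebra_in_dual_span_Union) simp
  show "D \<subseteq> F.span (\<Union>?\<C>)" if "coalgebra_in_dual H m e \<Psi> D" for D
    using that F.span_superset[of "\<Union>?\<C>"] by auto
qed

theorem induced_braidings:
  assumes S: "S \<subseteq> carr (dual H)" "vspace (fspace S)" "coprod_closed H m \<Psi> S" and bij: "bij_UU H \<Psi> (fspace S)"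
    and \<Phi>: "admissible \<Phi>"
  defines "U \<equiv> fspace S" and "\<Delta> \<equiv> coprod H m \<Psi>" and "\<Psi>U \<equiv> Psi_UU H \<Psi> (fspace S)"
  shows "braided_coalgebra U \<Delta> (\<lambda>f. f e) \<Psi>U"
    and "bij_UH H \<Phi> U \<Longrightarrow> left_braided U \<Psi>U H (Psi_UH H \<Phi> U) \<and> right_braided H \<Psi> U (Psi_UH H \<Phi> U)
      \<and> compat_comult1 U \<Delta> (\<lambda>f. f e) H (Psi_UH H \<Phi> U)"
    and "bij_HU H \<Phi> U \<Longrightarrow> left_braided H \<Psi> U (Psi_HU H \<Phi> U) \<and> right_braided U \<Psi>U H (Psi_HU H \<Phi> U)
      \<and> compat_comult2 U \<Delta> (\<lambda>f. f e) H (Psi_HU H \<Phi> U)"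
proof -
  interpret dual_coalgebra H U \<mu> e \<Delta>
    unfolding U_def \<Delta>_def by (rule closed_dual_coalgebra[OF S])
  have \<Psi>U: "\<Psi>U = Psi_UU H \<Psi> U" by (simp add: \<Psi>U_def U_def)
  note adj = Psi_UU_iso_adjoint[OF lin_\<Psi> bij[folded U_def], folded \<Psi>U]
  note comp = admissible_compat_\<mu>[OF admissible_braiding] admissible_compat_\<mu>[OF \<Phi>]
  have lr: "left_braided H \<Psi> H \<Phi>" "right_braided H \<Psi> H \<Phi>" and l: "lin (H \<otimes> H) (H \<otimes> H) \<Phi>"
    using \<Phi> by (simp_all add: admissible_def left_braided_def lin_iso_def)
  show bc: "braided_coalgebra U \<Delta> (\<lambda>f. f e) \<Psi>U"
    by (rule braided_coalgebra_adjoint[OF braided_H adj(1) comp(1,2) adj(2)])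
  then have bU: "braided U \<Psi>U" by (simp add: braided_coalgebra_def)
  show "left_braided U \<Psi>U H (Psi_UH H \<Phi> U) \<and> right_braided H \<Psi> U (Psi_UH H \<Phi> U)
      \<and> compat_comult1 U \<Delta> (\<lambda>f. f e) H (Psi_UH H \<Phi> U)" if "bij_UH H \<Phi> U"
  proof -
    note K = Psi_UH_iso_transposed[OF l that]
    interpret K: left_transposed H U \<Phi> "Psi_UH H \<Phi> U" by (rule K)
    show ?thesis
      using K.left_braided_UH[OF lr(2) bU adj(2) K(1)] K.right_braided_UH[OF lr(1) K(1)]
        K.compat_comult1_UH[OF comp(4) lin_\<mu> \<Delta> unit_in \<Delta>_adj] by blast
  qed
  show "left_braided H \<Psi> U (Psi_HU H \<Phi> U) \<and> right_braided U \<Psi>U H (Psi_HU H \<Phi> U)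
      \<and> compat_comult2 U \<Delta> (\<lambda>f. f e) H (Psi_HU H \<Phi> U)" if "bij_HU H \<Phi> U"
  proof -
    note K = Psi_HU_iso_transposed[OF l that]
    interpret K: right_transposed H U \<Phi> "Psi_HU H \<Phi> U" by (rule K)
    show ?thesis
      using K.left_braided_HU[OF lr(2) K(1)] K.right_braided_HU[OF lr(1) bU adj(2) K(1)]
        K.compat_comult2_HU[OF comp(3) lin_\<mu> \<Delta> unit_in \<Delta>_adj] by blast
  qed
qed

end

theorem proposition4p4:
  fixes H :: "('k::field, 'h::ab_group_add) vs"
    and m :: "('k, 'h, 'h) tens \<Rightarrow> 'h"
    and e :: 'h
    and \<Psi> :: "('k, 'h, 'h) tens \<Rightarrow> ('k, 'h, 'h) tens"
  assumes "braided_unital_algebra H m e \<Psi>"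
  shows "\<exists>Hcirc. coalgebra_in_dual H m e \<Psi> Hcirc
     \<and> (\<forall>C. coalgebra_in_dual H m e \<Psi> C \<longrightarrow> C \<subseteq> Hcirc)
     \<and> (\<forall>S. subcoalgebra_in_dual H m \<Psi> Hcirc S \<and> separates_points H S \<and> bij_UU H \<Psi> (fspace S) \<longrightarrow>
          (let U = fspace S; \<Delta> = coprod H m \<Psi>; \<epsilon> = (\<lambda>f. f e); \<Psi>U = Psi_UU H \<Psi> U in
             braided_coalgebra U \<Delta> \<epsilon> \<Psi>U
           \<and> (\<forall>\<Phi>\<in>{\<Psi>, Psi_inv H \<Psi>}.
                (bij_UH H \<Phi> U \<longrightarrow>
                     left_braided U \<Psi>U H (Psi_UH H \<Phi> U)
                   \<and> right_braided H \<Psi> U (Psi_UH H \<Phi> U)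
                   \<and> compat_comult1 U \<Delta> \<epsilon> H (Psi_UH H \<Phi> U))
              \<and> (bij_HU H \<Phi> U \<longrightarrow>
                     left_braided H \<Psi> U (Psi_HU H \<Phi> U)
                   \<and> right_braided U \<Psi>U H (Psi_HU H \<Phi> U)
                   \<and> compat_comult2 U \<Delta> \<epsilon> H (Psi_HU H \<Phi> U)))))"
proof -
  interpret braided_algebra H m e \<Psi> by unfold_locales (rule assms)
  obtain C where C: "coalgebra_in_dual H m e \<Psi> C" "\<And>D. coalgebra_in_dual H m e \<Psi> D \<Longrightarrow> D \<subseteq> C"
    using largest_coalgebra_in_dual by blast
  show ?thesis
    unfolding Let_def
  proof (intro exI[of _ C] conjI allI impI ballI)
    show "coalgebra_in_dual H m e \<Psi> C" by (rule C)
    show "D \<subseteq> C" if "coalgebra_in_dual H m e \<Psi> D" for D by (rule C(2)[OF that])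
  next
    fix S assume S: "subcoalgebra_in_dual H m \<Psi> C S \<and> separates_points H S \<and> bij_UU H \<Psi> (fspace S)"
    then have "S \<subseteq> carr (dual H)" "vspace (fspace S)" "coprod_closed H m \<Psi> S" "bij_UU H \<Psi> (fspace S)"
      using C(1) by (auto simp: subcoalgebra_in_dual_def coalgebra_in_dual_def)
    note ib = induced_braidings[OF this]
    show "braided_coalgebra (fspace S) (coprod H m \<Psi>) (\<lambda>f. f e) (Psi_UU H \<Psi> (fspace S))"
      by (rule ib(1)[OF admissible_braiding])
    fix \<Phi> assume "\<Phi> \<in> {\<Psi>, Psi_inv H \<Psi>}"
    then have \<Phi>: "admissible \<Phi>" using admissible_braiding admissible_inverse by blast
    show "left_braided (fspace S) (Psi_UU H \<Psi> (fspace S)) H (Psi_UH H \<Phi> (fspace S))"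
      "right_braided H \<Psi> (fspace S) (Psi_UH H \<Phi> (fspace S))"
      "compat_comult1 (fspace S) (coprod H m \<Psi>) (\<lambda>f. f e) H (Psi_UH H \<Phi> (fspace S))"
      if "bij_UH H \<Phi> (fspace S)"
      using ib(2)[OF \<Phi> that] by blast+
    show "left_braided H \<Psi> (fspace S) (Psi_HU H \<Phi> (fspace S))"
      "right_braided (fspace S) (Psi_UU H \<Psi> (fspace S)) H (Psi_HU H \<Phi> (fspace S))"
      "compat_comult2 (fspace S) (coprod H m \<Psi>) (\<lambda>f. f e) H (Psi_HU H \<Phi> (fspace S))"
      if "bij_HU H \<Phi> (fspace S)"
      using ib(3)[OF \<Phi> that] by blast+
  qed
qed

end
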